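(* Let $0<s<1$, $n\geq 1$ with $2s<n$, and let $B_r\subset\mathbb{R}^n$ denote the open ball of radius $r$ centred at the origin. For any $\ell\in\mathbb{R}_+\setminus\mathbb{N}$ such that also $\ell-2s\in\mathbb{R}_+\setminus\mathbb{N}$ there exists a constant $\beta>0$ such that for all sufficiently small $\epsilon>0$ there are conductivities $\gamma_1,\gamma_2\in C^\ell(\mathbb{R}^n)$ with $$\|\Lambda_{\gamma_1}-\Lambda_{\gamma_2}\|_{H^s(B_3\setminus\overline B_2)\to(H^s(B_3\setminus\overline B_2))^*}\leq \exp\left(-\epsilon^{-\frac{n}{(2n+3)\ell}}\right),$$ $$\|\gamma_1-\gamma_2\|_{L^\infty(B_1)}\geq\epsilon,\qquad \|\gamma_i\|_{C^\ell(B_1)}\leq\beta,\qquad 1\leq\gamma_i\leq 2,\quad i=1,2.$$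
   Context: Here $\Omega=B_1$, $\Omega_e=\mathbb{R}^n\setminus\overline{B_1}$, and $\Lambda_\gamma$ is the exterior Dirichlet-to-Neumann map of the fractional conductivity equation in $B_1$: with $$B_\gamma(u,\phi)=\frac{C_{n,s}}{2}\int_{\mathbb{R}^{2n}}\frac{\gamma^{1/2}(x)\gamma^{1/2}(y)}{|x-y|^{n+2s}}(u(x)-u(y))(\phi(x)-\phi(y))\,dx\,dy,$$ for exterior data $f$ let $u_f\in H^s(\mathbb{R}^n)$ be the unique solution with $u_f=f$ in $\Omega_e$ and $B_\gamma(u_f,\phi)=0$ for all $\phi\in C_c^\infty(B_1)$, and $\langle\Lambda_\gamma f,g\rangle=B_\gamma(u_f,g)$. The norm displayed is the operator norm of $\Lambda_{\gamma_1}-\Lambda_{\gamma_2}$ restricted to data $f,g\in H^s(\mathbb{R}^n)$ supported in/restricted to the annulus $B_3\setminus\overline{B_2}$, i.e. as a map $H^s(B_3\setminus\overline B_2)\to (H^s(B_3\setminus\overline B_2))^*$. $C^\ell$ for non-integer $\ell$ denotes the Hölder space $C^{\lfloor \ell\rfloor,\ell-\lfloor\ell\rfloor}$. *)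

theory Defs
  imports "HOL-Analysis.Analysis" "HOL-Probability.Essential_Supremum"
begin

type_synonym 'n fn = "real^'n \<Rightarrow> real"

definition pd :: "'n::finite \<Rightarrow> 'n fn \<Rightarrow> 'n fn" where
  "pd i g x = deriv (\<lambda>t. g (x + t *\<^sub>R axis i 1)) 0"

fun dpart :: "'n::finite list \<Rightarrow> 'n fn \<Rightarrow> 'n fn" where
  "dpart [] f = f"
| "dpart (i # is) f = pd i (dpart is f)"

definition Ck_on :: "nat \<Rightarrow> (real^'n::finite) set \<Rightarrow> 'n fn \<Rightarrow> bool" where
  "Ck_on k U f \<longleftrightarrow>
     (\<forall>is. length is \<le> k \<longrightarrow> continuous_on U (dpart is f)) \<and>
     (\<forall>is. length is < k \<longrightarrow> (\<forall>i. \<forall>x\<in>U.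
        (\<lambda>t. dpart is f (x + t *\<^sub>R axis i 1)) differentiable (at 0)))"

definition test_fun :: "(real^'n::finite) set \<Rightarrow> 'n fn \<Rightarrow> bool" where
  "test_fun U \<phi> \<longleftrightarrow> (\<forall>k. Ck_on k UNIV \<phi>) \<and>
     (\<exists>K. compact K \<and> K \<subseteq> U \<and> (\<forall>x. x \<notin> K \<longrightarrow> \<phi> x = 0))"

definition holder_norm :: "real \<Rightarrow> (real^'n::finite) set \<Rightarrow> 'n fn \<Rightarrow> ereal" where
  "holder_norm l U f =
     (let m = nat \<lfloor>l\<rfloor>; a = l - of_int \<lfloor>l\<rfloor> in
      (SUP is\<in>{is. length is \<le> m}. SUP x\<in>U. ereal \<bar>dpart is f x\<bar>) +
      (SUP is\<in>{is. length is = m}. SUP p\<in>{(x,y). x \<in> U \<and> y \<in> U \<and> x \<noteq> y}.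
          ereal (\<bar>dpart is f (fst p) - dpart is f (snd p)\<bar> / dist (fst p) (snd p) powr a)))"

definition holder_space :: "real \<Rightarrow> ('n::finite fn) set" where
  "holder_space l = {f. Ck_on (nat \<lfloor>l\<rfloor>) UNIV f \<and> holder_norm l UNIV f < \<infinity>}"

definition C_ns :: "nat \<Rightarrow> real \<Rightarrow> real" where
  "C_ns n s = 4 powr s * Gamma (real n / 2 + s) / (pi powr (real n / 2) * \<bar>Gamma (- s)\<bar>)"

definition gagliardo :: "real \<Rightarrow> 'n::finite fn \<Rightarrow> 'n fn \<Rightarrow> ((real^'n) \<times> (real^'n)) \<Rightarrow> real" where
  "gagliardo s u v p = (u (fst p) - u (snd p)) * (v (fst p) - v (snd p))
        / norm (fst p - snd p) powr (real CARD('n) + 2 * s)"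

definition Hs :: "real \<Rightarrow> ('n::finite fn) set" where
  "Hs s = {u. u \<in> borel_measurable lborel \<and> integrable lborel (\<lambda>x. (u x)\<^sup>2) \<and>
             integrable (lborel \<Otimes>\<^sub>M lborel) (gagliardo s u u)}"

text \<open>H^s norm: squared norm = L2 norm^2 + (C_{n,s}/2) Gagliardo seminorm^2,
  i.e. the Fourier norm with weight 1 + |xi|^{2s}.\<close>
definition hs_norm :: "real \<Rightarrow> 'n::finite fn \<Rightarrow> real" where
  "hs_norm s u = sqrt ((LINT x|lborel. (u x)\<^sup>2) +
       C_ns CARD('n) s / 2 * integral\<^sup>L (lborel \<Otimes>\<^sub>M lborel) (gagliardo s u u))"

definition Bform :: "real \<Rightarrow> 'n::finite fn \<Rightarrow> 'n fn \<Rightarrow> 'n fn \<Rightarrow> real" where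
  "Bform s \<gamma> u v = C_ns CARD('n) s / 2 *
     integral\<^sup>L (lborel \<Otimes>\<^sub>M lborel)
       (\<lambda>p. sqrt (\<gamma> (fst p)) * sqrt (\<gamma> (snd p)) * gagliardo s u v p)"

definition is_solution :: "real \<Rightarrow> 'n::finite fn \<Rightarrow> 'n fn \<Rightarrow> 'n fn \<Rightarrow> bool" where
  "is_solution s \<gamma> f u \<longleftrightarrow> u \<in> Hs s \<and>
     (AE x in lborel. x \<notin> cball 0 1 \<longrightarrow> u x = f x) \<and>
     (\<forall>\<phi>. test_fun (ball 0 1) \<phi> \<longrightarrow> Bform s \<gamma> u \<phi> = 0)"

text \<open>The DN pairing <Lambda_gamma f, g> = B_gamma(u_f, g); independent of the choice of solution.\<close>
definition DN :: "real \<Rightarrow> 'n::finite fn \<Rightarrow> 'n fn \<Rightarrow> 'n fn \<Rightarrow> real" where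
  "DN s \<gamma> f g = Bform s \<gamma> (SOME u. is_solution s \<gamma> f u) g"

definition Hs_annulus :: "real \<Rightarrow> ('n::finite fn) set" where
  "Hs_annulus s = {f \<in> Hs s. AE x in lborel. x \<notin> ball 0 3 - cball 0 2 \<longrightarrow> f x = 0}"

definition DN_diff_norm :: "real \<Rightarrow> 'n::finite fn \<Rightarrow> 'n fn \<Rightarrow> ereal" where
  "DN_diff_norm s \<gamma>1 \<gamma>2 =
     (SUP p\<in>{(f,g). f \<in> Hs_annulus s \<and> g \<in> Hs_annulus s \<and> hs_norm s f \<le> 1 \<and> hs_norm s g \<le> 1}.
        ereal \<bar>DN s \<gamma>1 (fst p) (snd p) - DN s \<gamma>2 (fst p) (snd p)\<bar>)"

end

theory Submission
  imports Defs
begin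

text \<open>
  The conductivities are \<open>1 + c \<Sum>\<^bsub>j\<in>\<sigma>\<^esub> \<psi>(x/r - j)\<close> with \<open>c\<close> comparable to \<open>\<epsilon>\<close> and
  \<open>r = \<epsilon>\<^bsup>1/l\<^esup>\<close>, where \<open>\<sigma>\<close> runs through the subsets of a grid of about \<open>\<epsilon>\<^bsup>-n/l\<^esup>\<close> points of
  the unit ball; their Hoelder norms are bounded, and two different ones are more than \<open>\<epsilon>\<close> apart.
  Data in the annulus \<open>2 < |y| < 3\<close> see the unit ball only through the kernel
  \<open>|x - y|\<^bsup>-n-2s\<^esup>\<close>, which is a polynomial in \<open>x\<close> of degree \<open>2N\<close> in each coordinate up to an
  error \<open>O(\<rho>\<^bsup>N\<^esup>)\<close> with \<open>\<rho> < 1\<close>. Up to such an error the pairing is therefore determined by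
  \<open>O(N\<^bsup>2n\<^esup>)\<close> bounded numbers depending on the conductivity, namely the moments of \<open>\<gamma>\<^bsup>1/2\<^esup> - 1\<close> and
  the solution operator tested on pairs of monomials. If \<open>N\<close> is comparable to
  \<open>\<epsilon>\<^bsup>-n/((2n+3)l)\<^esup>\<close>, a net of mesh \<open>exp (- const N)\<close> for these numbers has
  \<open>exp (O(N\<^bsup>2n+1\<^esup>))\<close> cells, fewer than there are conductivities, so two conductivities share
  a cell.
\<close>

section \<open>Square-integrable functions and the Riesz representation\<close>

text \<open>\<open>DN\<close> selects an arbitrary solution that is characterised by test functions
  only, so a solution must be shown to exist and every choice must be brought to a common form. It
  is split a.e. as \<open>f' + v\<close> with \<open>v\<close> in \<open>H0 s\<close>. Here
  \<open>v\<close> solves a problem with the bounded right-hand side \<open>pot s f'\<close>: ball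
  and annulus are at distance at least 1, so the kernel between them is bounded. Replacing test
  functions by all of \<open>H0 s\<close> needs density in the energy norm. This comes from
  mollifications that do not increase the energy, which is where 2s < n enters.

  The coefficients in the monomial expansions grow like M^N, but a mesh rho^N / M^(2N) is still
  exp(-const N), so this growth changes only constants. With theta = n/((2n+3)l) and L =
  eps^(-theta), the number of bumps is comparable to eps^(-n/l) = L^(2n+3), while a cell of the net
  is described by O(L^(2n+1)) bits. The two spare powers of L absorb all constants.\<close>

definition sq_integrable :: "'a measure \<Rightarrow> ('a \<Rightarrow> real) \<Rightarrow> bool" where
  "sq_integrable M F \<longleftrightarrow> F \<in> borel_measurable M \<and> integrable M (\<lambda>x. (F x)\<^sup>2)"

lemma sq_integrable_mult:
  assumes "sq_integrable M F" "sq_integrable M G"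
  shows "integrable M (\<lambda>x. F x * G x)"
proof (rule Bochner_Integration.integrable_bound)
  show "integrable M (\<lambda>x. (F x)\<^sup>2 + (G x)\<^sup>2)"
    using assms by (auto simp: sq_integrable_def)
  show "(\<lambda>x. F x * G x) \<in> borel_measurable M"
    using assms by (auto simp: sq_integrable_def)
  have "\<bar>a * b\<bar> \<le> a\<^sup>2 + b\<^sup>2" for a b :: real
  proof -
    have "2 * (\<bar>a\<bar> * \<bar>b\<bar>) \<le> a\<^sup>2 + b\<^sup>2" using sum_squares_bound[of "\<bar>a\<bar>" "\<bar>b\<bar>"] by simp
    moreover have "0 \<le> \<bar>a\<bar> * \<bar>b\<bar>" by simp
    ultimately show ?thesis unfolding abs_mult by linarith
  qed
  then show "AE x in M. norm (F x * G x) \<le> norm ((F x)\<^sup>2 + (G x)\<^sup>2)"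
    by simp
qed

lemma sq_integrable_lin:
  assumes "sq_integrable M F" "sq_integrable M G"
  shows "sq_integrable M (\<lambda>x. a * F x + b * G x)"
proof -
  have "integrable M (\<lambda>x. a\<^sup>2 * (F x)\<^sup>2 + (2 * a * b) * (F x * G x) + b\<^sup>2 * (G x)\<^sup>2)"
    using assms sq_integrable_mult[OF assms] by (auto simp: sq_integrable_def)
  then have "integrable M (\<lambda>x. (a * F x + b * G x)\<^sup>2)"
    by (rule back_subst[where P="integrable M"]) (auto simp: power2_eq_square algebra_simps)
  then show ?thesis using assms by (auto simp: sq_integrable_def)
qed

text \<open>The case \<open>c = 0\<close> is included because the forms below are seminorms and may
  vanish on nonzero vectors.\<close>

lemma quadratic_nonneg_imp_discriminant:
  fixes a b c :: real
  assumes "0 \<le> c" and nn: "\<And>t. 0 \<le> a + 2 * b * t + c * t\<^sup>2"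
  shows "b\<^sup>2 \<le> a * c"
proof (cases "c = 0")
  case True
  have "b = 0"
  proof (rule ccontr)
    assume "b \<noteq> 0"
    \<comment> \<open>The expression is affine in t here, and at this point it equals -1.\<close>
    then show False using nn[of "- (a + 1) / (2 * b)"] True by (simp add: field_simps)
  qed
  then show ?thesis using True by simp
next
  case False
  then have "0 < c" using assms by simp
  \<comment> \<open>The parabola is evaluated at its vertex.\<close>
  have "0 \<le> a + 2 * b * (- b / c) + c * (- b / c)\<^sup>2" by (rule nn)
  also have "\<dots> = a - b\<^sup>2 / c" using \<open>0 < c\<close> by (simp add: field_simps power2_eq_square)
  finally show ?thesis using \<open>0 < c\<close> by (simp add: field_simps)
qed

lemma integral_Cauchy_Schwarz:
  assumes "sq_integrable M F" "sq_integrable M G"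
  shows "(\<integral>x. F x * G x \<partial>M)\<^sup>2 \<le> (\<integral>x. (F x)\<^sup>2 \<partial>M) * (\<integral>x. (G x)\<^sup>2 \<partial>M)"
proof (rule quadratic_nonneg_imp_discriminant)
  fix t
  have i: "integrable M (\<lambda>x. (F x)\<^sup>2)" "integrable M (\<lambda>x. (G x)\<^sup>2)" "integrable M (\<lambda>x. F x * G x)"
    using assms sq_integrable_mult[OF assms] by (auto simp: sq_integrable_def)
  have "0 \<le> (\<integral>x. (F x + t * G x)\<^sup>2 \<partial>M)" by simp
  also have "\<dots> = (\<integral>x. ((F x)\<^sup>2 + (2 * t) * (F x * G x) + t\<^sup>2 * (G x)\<^sup>2) \<partial>M)"
    by (rule Bochner_Integration.integral_cong) (auto simp: power2_eq_square algebra_simps)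
  also have "\<dots> = (\<integral>x. (F x)\<^sup>2 \<partial>M) + 2 * (\<integral>x. F x * G x \<partial>M) * t + (\<integral>x. (G x)\<^sup>2 \<partial>M) * t\<^sup>2"
    using i by simp
  finally show "0 \<le> \<dots>" .
qed simp

lemma integral_Cauchy_Schwarz_abs:
  assumes "sq_integrable M F" "sq_integrable M G"
  shows "\<bar>\<integral>x. F x * G x \<partial>M\<bar> \<le> sqrt (\<integral>x. (F x)\<^sup>2 \<partial>M) * sqrt (\<integral>x. (G x)\<^sup>2 \<partial>M)"
  using real_sqrt_le_mono[OF integral_Cauchy_Schwarz[OF assms]] by (simp add: real_sqrt_mult)

text \<open>Norm balls are closed under a.e. convergence. This gives the bounds for limits in
  \<open>H0_complete\<close> and, applied to sums, the strong convergence that follows.\<close>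

lemma sq_integrable_Fatou:
  assumes "\<And>k. sq_integrable M (F k)" and [measurable]: "G \<in> borel_measurable M"
    and "AE x in M. (\<lambda>k. F k x) \<longlonglongrightarrow> G x"
    and "\<And>k. (\<integral>x. (F k x)\<^sup>2 \<partial>M) \<le> c"
  shows "sq_integrable M G" "(\<integral>x. (G x)\<^sup>2 \<partial>M) \<le> c"
proof -
  have [measurable]: "F k \<in> borel_measurable M" and i: "integrable M (\<lambda>x. (F k x)\<^sup>2)" for k
    using assms(1)[of k] by (auto simp: sq_integrable_def)
  have c: "0 \<le> c" using assms(4)[of 0] by (rule order_trans[rotated]) simp
  have "(\<integral>\<^sup>+x. ennreal ((G x)\<^sup>2) \<partial>M) = (\<integral>\<^sup>+x. liminf (\<lambda>k. ennreal ((F k x)\<^sup>2)) \<partial>M)"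
  proof (rule nn_integral_cong_AE, use assms(3) in eventually_elim)
    fix x assume "(\<lambda>k. F k x) \<longlonglongrightarrow> G x"
    then have "(\<lambda>k. ennreal ((F k x)\<^sup>2)) \<longlonglongrightarrow> ennreal ((G x)\<^sup>2)"
      by (intro tendsto_ennrealI tendsto_power)
    then show "ennreal ((G x)\<^sup>2) = liminf (\<lambda>k. ennreal ((F k x)\<^sup>2))"
      by (metis lim_imp_Liminf sequentially_bot)
  qed
  also have "\<dots> \<le> liminf (\<lambda>k. \<integral>\<^sup>+x. ennreal ((F k x)\<^sup>2) \<partial>M)"
    by (rule nn_integral_liminf) measurable
  also have "\<dots> \<le> liminf (\<lambda>k. ennreal c)"
    by (rule Liminf_mono) (simp add: nn_integral_eq_integral[OF i] ennreal_leI assms(4))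
  finally have le: "(\<integral>\<^sup>+x. ennreal ((G x)\<^sup>2) \<partial>M) \<le> ennreal c" by (simp add: Liminf_const)
  then have i: "integrable M (\<lambda>x. (G x)\<^sup>2)"
    by (intro integrableI_nonneg) (auto intro: le_less_trans)
  then show "sq_integrable M G" by (simp add: sq_integrable_def)
  show "(\<integral>x. (G x)\<^sup>2 \<partial>M) \<le> c"
    using le c by (simp add: nn_integral_eq_integral[OF i])
qed

text \<open>Fatou's lemma for \<open>2 F\<^sub>k\<^sup>2 + 2 G\<^sup>2 - (F\<^sub>k - G)\<^sup>2 = (F\<^sub>k + G)\<^sup>2\<close>: norms that do not
  exceed the norm of the limit turn pointwise convergence into strong convergence.\<close>

lemma sq_integrable_strong_limit:
  assumes F: "\<And>k. sq_integrable M (F k)" and G: "sq_integrable M G"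
    and ae: "AE x in M. (\<lambda>k. F k x) \<longlonglongrightarrow> G x"
    and le: "\<And>k. (\<integral>x. (F k x)\<^sup>2 \<partial>M) \<le> (\<integral>x. (G x)\<^sup>2 \<partial>M)" and "0 < e"
  shows "\<exists>k. (\<integral>x. (F k x - G x)\<^sup>2 \<partial>M) < e"
proof (rule ccontr)
  assume "\<not> ?thesis"
  then have ge: "e \<le> (\<integral>x. (F k x - G x)\<^sup>2 \<partial>M)" for k by (meson not_le)
  have S: "sq_integrable M (\<lambda>x. F k x + G x)" for k
    using sq_integrable_lin[OF F[of k] G, of 1 1] by simp
  have iF: "integrable M (\<lambda>x. (F k x)\<^sup>2)" "integrable M (\<lambda>x. (F k x - G x)\<^sup>2)" 
      "integrable M (\<lambda>x. (G x)\<^sup>2)" for k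
    using F[of k] G sq_integrable_lin[OF F[of k] G, of 1 "-1"] by (auto simp: sq_integrable_def)
  have bd: "(\<integral>x. (F k x + G x)\<^sup>2 \<partial>M) \<le> 4 * (\<integral>x. (G x)\<^sup>2 \<partial>M) - e" for k
  proof -
    have "(\<integral>x. (F k x + G x)\<^sup>2 \<partial>M) = (\<integral>x. 2 * (F k x)\<^sup>2 + 2 * (G x)\<^sup>2 - (F k x - G x)\<^sup>2 \<partial>M)"
      by (rule Bochner_Integration.integral_cong) (auto simp: power2_eq_square algebra_simps)
    also have "\<dots> = 2 * (\<integral>x. (F k x)\<^sup>2 \<partial>M) + 2 * (\<integral>x. (G x)\<^sup>2 \<partial>M) - (\<integral>x. (F k x - G x)\<^sup>2 \<partial>M)"
      using iF by simp
    finally show ?thesis using ge[of k] le[of k] by simp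
  qed
  have lim: "AE x in M. (\<lambda>k. F k x + G x) \<longlonglongrightarrow> 2 * G x"
    using ae
  proof eventually_elim
    case (elim x)
    from tendsto_add[OF this tendsto_const[of "G x"]] show ?case unfolding mult_2 .
  qed
  have "(\<integral>x. (2 * G x)\<^sup>2 \<partial>M) \<le> 4 * (\<integral>x. (G x)\<^sup>2 \<partial>M) - e"
    using G by (intro sq_integrable_Fatou(2)[OF S _ lim bd]) (auto simp: sq_integrable_def)
  then show False using \<open>0 < e\<close> by (simp add: power_mult_distrib)
qed

text \<open>The rate 1/8 leaves room for the weights 2^k: the integral of the sum of
  \<open>2^k * (a k x)^2\<close> is at most the sum of c/4^k, so the sum is finite a.e. The
  inequality |a| <= 2^-k + 2^k a^2 then makes the increments absolutely summable, without passing to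
  a subsequence.\<close>

lemma AE_convergent_of_fast_Cauchy:
  fixes v :: "nat \<Rightarrow> 'a \<Rightarrow> real"
  assumes v: "\<And>k. sq_integrable M (v k)"
    and c: "\<And>k. (\<integral>x. (v (Suc k) x - v k x)\<^sup>2 \<partial>M) \<le> c * (1/8)^k"
  shows "AE x in M. convergent (\<lambda>k. v k x)"
proof -
  define a where "a k x = v (Suc k) x - v k x" for k x
  have a: "sq_integrable M (a k)" for k
    using sq_integrable_lin[OF v[of "Suc k"] v[of k], of 1 "-1"] by (simp add: a_def[abs_def])
  have [measurable]: "a k \<in> borel_measurable M" and i: "integrable M (\<lambda>x. (a k x)\<^sup>2)" for k
    using a[of k] by (auto simp: sq_integrable_def)
  have c0: "0 \<le> c"
  proof -
    have "0 \<le> (\<integral>x. (v (Suc 0) x - v 0 x)\<^sup>2 \<partial>M)" by simp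
    also have "\<dots> \<le> c * (1/8)^0" by (rule c)
    finally show ?thesis by simp
  qed
  have "(\<integral>\<^sup>+x. (\<Sum>k. ennreal (2^k * (a k x)\<^sup>2)) \<partial>M) = (\<Sum>k. \<integral>\<^sup>+x. ennreal (2^k * (a k x)\<^sup>2) \<partial>M)"
    by (rule nn_integral_suminf) measurable
  also have "\<dots> \<le> (\<Sum>k. ennreal (c * (1/4)^k))"
  proof (intro suminf_le allI)
    fix k
    have "(\<integral>\<^sup>+x. ennreal (2^k * (a k x)\<^sup>2) \<partial>M) = ennreal (2^k * (\<integral>x. (a k x)\<^sup>2 \<partial>M))"
      using i[of k] by (subst nn_integral_eq_integral) auto
    also have "\<dots> \<le> ennreal (2^k * (c * (1/8)^k))"
      using c[of k] by (intro ennreal_leI mult_left_mono) (auto simp: a_def)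
    also have "2^k * (c * (1/8)^k) = c * (1/4)^k"
      using power_mult_distrib[of 2 "1/8::real" k] by simp
    finally show "(\<integral>\<^sup>+x. ennreal (2^k * (a k x)\<^sup>2) \<partial>M) \<le> ennreal (c * (1/4)^k)" .
  qed auto
  also have "\<dots> < \<infinity>"
    using c0 by (subst suminf_ennreal2) (auto intro!: summable_mult summable_geometric)
  finally have "AE x in M. (\<Sum>k. ennreal (2^k * (a k x)\<^sup>2)) \<noteq> \<infinity>"
    by (intro nn_integral_PInf_AE) auto
  then show ?thesis
  proof eventually_elim
    fix x assume "(\<Sum>k. ennreal (2^k * (a k x)\<^sup>2)) \<noteq> \<infinity>"
    then have s: "summable (\<lambda>k. 2^k * (a k x)\<^sup>2)"
      by (intro summable_suminf_not_top) auto
    have "summable (\<lambda>k. (1/2)^k + 2^k * (a k x)\<^sup>2)"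
      by (intro summable_add s summable_geometric) auto
    then have "summable (\<lambda>k. a k x)"
    proof (rule summable_comparison_test'[where N=0])
      fix k :: nat
      have "0 \<le> ((1/2)^k - \<bar>a k x\<bar>)\<^sup>2 * 2^k" by simp
      also have "\<dots> = (1/2)^k - 2 * \<bar>a k x\<bar> + 2^k * (a k x)\<^sup>2"
        by (simp add: power2_eq_square power_divide field_simps)
      finally show "norm (a k x) \<le> (1/2)^k + 2^k * (a k x)\<^sup>2" by simp
    qed
    then have "convergent (\<lambda>n. \<Sum>k<n. a k x)" by (simp add: summable_iff_convergent)
    then have "convergent (\<lambda>n. v 0 x + (\<Sum>k<n. a k x))" by (simp add: convergent_add_const_iff)
    moreover have "v 0 x + (\<Sum>k<n. a k x) = v n x" for n
      by (induction n) (auto simp: a_def)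
    ultimately show "convergent (\<lambda>k. v k x)" by simp
  qed
qed

text \<open>The functions need only form a complete space for the seminorm of \<open>B\<close>, so that no
  quotient by null functions is necessary.\<close>

lemma Riesz_representation_seminorm:
  fixes V :: "('a \<Rightarrow> real) set" and B :: "('a \<Rightarrow> real) \<Rightarrow> ('a \<Rightarrow> real) \<Rightarrow> real"
  assumes zero: "(\<lambda>_. 0) \<in> V"
    and lin: "\<And>u v a b. u \<in> V \<Longrightarrow> v \<in> V \<Longrightarrow> (\<lambda>x. a * u x + b * v x) \<in> V"
    and Blin: "\<And>u v w a b. u \<in> V \<Longrightarrow> v \<in> V \<Longrightarrow> w \<in> V \<Longrightarrow>
        B (\<lambda>x. a * u x + b * v x) w = a * B u w + b * B v w"
    and Bsym: "\<And>u v. B u v = B v u"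
    and Bpos: "\<And>u. 0 \<le> B u u"
    and llin: "\<And>u v a b. u \<in> V \<Longrightarrow> v \<in> V \<Longrightarrow> l (\<lambda>x. a * u x + b * v x) = a * l u + b * l v"
    and lbd: "\<And>u. u \<in> V \<Longrightarrow> \<bar>l u\<bar> \<le> K * sqrt (B u u)"
    and complete: "\<And>v. (\<And>k. v k \<in> V) \<Longrightarrow>
        (\<And>j k. j \<le> k \<Longrightarrow> B (\<lambda>x. v k x - v j x) (\<lambda>x. v k x - v j x) \<le> 4 * (1/8)^j) \<Longrightarrow>
        \<exists>w\<in>V. \<forall>j::nat. B (\<lambda>x. w x - v j x) (\<lambda>x. w x - v j x) \<le> 4 * (1/8)^j"
  shows "\<exists>w\<in>V. \<forall>\<phi>\<in>V. B w \<phi> = l \<phi>"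
proof -
  \<comment> \<open>Twice the usual energy functional; a minimiser represents
    \<open>l\<close>.\<close>
  define J where "J v = B v v - 2 * l v" for v
  have Bquad: "B (\<lambda>x. a * u x + b * v x) (\<lambda>x. a * u x + b * v x) = a\<^sup>2 * B u u + 2 * a * b * B u v + b\<^sup>2 * B v v"
    if "u \<in> V" "v \<in> V" for u v a b
  proof -
    have "B (\<lambda>x. a * u x + b * v x) (\<lambda>x. a * u x + b * v x)
        = a * B (\<lambda>x. a * u x + b * v x) u + b * B (\<lambda>x. a * u x + b * v x) v"
      using Blin[OF that lin[OF that, of a b], of a b] by (simp add: Bsym)
    also have "\<dots> = a\<^sup>2 * B u u + 2 * a * b * B u v + b\<^sup>2 * B v v"
      using that by (simp add: Blin Bsym[of v u] power2_eq_square algebra_simps)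
    finally show ?thesis .
  qed
  have CS: "(B u v)\<^sup>2 \<le> B u u * B v v" if "u \<in> V" "v \<in> V" for u v
  proof (rule quadratic_nonneg_imp_discriminant)
    fix t
    have "0 \<le> B (\<lambda>x. 1 * u x + t * v x) (\<lambda>x. 1 * u x + t * v x)" by (rule Bpos)
    then show "0 \<le> B u u + 2 * B u v * t + B v v * t\<^sup>2"
      unfolding Bquad[OF that] by (simp add: algebra_simps)
  qed (rule Bpos)
  \<comment> \<open>Completing the square bounds \<open>J\<close> from below, so that its infimum is
    meaningful.\<close>
  have Jlow: "- K\<^sup>2 \<le> J v" if "v \<in> V" for v
  proof -
    have "0 \<le> (sqrt (B v v) - K)\<^sup>2" by simp
    also have "\<dots> = B v v - 2 * (K * sqrt (B v v)) + K\<^sup>2"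
      using Bpos[of v] by (simp add: power2_diff algebra_simps)
    finally show ?thesis using lbd[OF that] by (simp add: J_def abs_le_iff)
  qed
  define m where "m = Inf (J ` V)"
  have bdd: "bdd_below (J ` V)" using Jlow by (auto simp: bdd_below_def)
  have mle: "m \<le> J v" if "v \<in> V" for v
    unfolding m_def using that bdd by (auto intro: cInf_lower)
  have "\<exists>v\<in>V. J v < m + (1/8)^k" for k :: nat
  proof -
    have "Inf (J ` V) < m + (1/8)^k" by (simp add: m_def)
    then show ?thesis using zero by (subst (asm) cInf_less_iff[OF _ bdd]) auto
  qed
  then obtain v where vV: "\<And>k. v k \<in> V" and vJ: "\<And>k::nat. J (v k) < m + (1/8)^k" by metis
  \<comment> \<open>Parallelogram identity: the linear terms cancel, and the midpoint has
    \<open>J\<close> at least \<open>m\<close>. A minimising sequence is therefore Cauchy, with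
    exactly the rate that \<open>complete\<close> asks for.\<close>
  have diff: "B (\<lambda>x. v k x - v j x) (\<lambda>x. v k x - v j x) \<le> 4 * (1/8)^j" if "j \<le> k" for j k
  proof -
    have "B (\<lambda>x. 1 * v k x + (-1) * v j x) (\<lambda>x. 1 * v k x + (-1) * v j x)
        = 2 * J (v k) + 2 * J (v j) - 4 * J (\<lambda>x. (1/2) * v k x + (1/2) * v j x)"
      unfolding J_def Bquad[OF vV vV] llin[OF vV vV] by (simp add: power2_eq_square algebra_simps)
    also have "\<dots> \<le> 2 * (m + (1/8)^k) + 2 * (m + (1/8)^j) - 4 * m"
    proof -
      have "2 * a + 2 * b - 4 * c \<le> 2 * (m + x) + 2 * (m + y) - 4 * m"
        if "a < m + x" "b < m + y" "m \<le> c" for a b c x y m :: real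
        using that by argo
      then show ?thesis using vJ[of k] vJ[of j] mle[OF lin[OF vV[of k] vV[of j], of "1/2" "1/2"]] by blast
    qed
    also have "\<dots> \<le> 4 * (1/8)^j"
      using power_decreasing[OF that, of "1/8::real"] by simp
    finally show ?thesis by simp
  qed
  obtain w where w: "w \<in> V" "\<And>j. B (\<lambda>x. w x - v j x) (\<lambda>x. w x - v j x) \<le> 4 * (1/8)^j"
    using complete[OF vV diff] by auto
  have "B w \<phi> = l \<phi>" if "\<phi> \<in> V" for \<phi>
  proof -
    \<comment> \<open>First variation without an actual minimiser: \<open>v k\<close> is within 8^-k
      of the infimum, so the quadratic in t stays nonnegative after adding 8^-k, and its
      discriminant bounds the defect.\<close>
    have 1: "(B (v k) \<phi> - l \<phi>)\<^sup>2 \<le> (1/8)^k * B \<phi> \<phi>" for k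
    proof (rule quadratic_nonneg_imp_discriminant)
      fix t
      have "m \<le> J (\<lambda>x. 1 * v k x + t * \<phi> x)" by (rule mle, rule lin[OF vV that])
      also have "\<dots> = J (v k) + 2 * (B (v k) \<phi> - l \<phi>) * t + B \<phi> \<phi> * t\<^sup>2"
        unfolding J_def Bquad[OF vV that] llin[OF vV that] by (simp add: algebra_simps)
      finally show "0 \<le> (1/8)^k + 2 * (B (v k) \<phi> - l \<phi>) * t + B \<phi> \<phi> * t\<^sup>2"
        using vJ[of k] by linarith
    qed (rule Bpos)
    have 2: "(B w \<phi> - B (v k) \<phi>)\<^sup>2 \<le> 4 * (1/8)^k * B \<phi> \<phi>" for k
    proof -
      have "B w \<phi> - B (v k) \<phi> = B (\<lambda>x. 1 * w x + (-1) * v k x) \<phi>"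
        unfolding Blin[OF w(1) vV that] by simp
      moreover have "(B (\<lambda>x. 1 * w x + (-1) * v k x) \<phi>)\<^sup>2 \<le> 
          B (\<lambda>x. 1 * w x + (-1) * v k x) (\<lambda>x. 1 * w x + (-1) * v k x) * B \<phi> \<phi>"
        by (rule CS[OF lin[OF w(1) vV] that])
      ultimately show ?thesis
        using mult_right_mono[OF w(2)[of k] Bpos[of \<phi>]] by simp
    qed
    have lim: "(\<lambda>k. (1/8)^k * c) \<longlonglongrightarrow> 0" for c :: real
      by (intro tendsto_mult_left_zero LIMSEQ_realpow_zero) auto
    have "(\<lambda>k. (B (v k) \<phi> - l \<phi>)\<^sup>2) \<longlonglongrightarrow> 0"
      by (rule tendsto_sandwich[OF _ _ tendsto_const lim[of "B \<phi> \<phi>"]]) (use 1 in auto)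
    moreover have "(\<lambda>k. (B w \<phi> - B (v k) \<phi>)\<^sup>2) \<longlonglongrightarrow> 0"
      by (rule tendsto_sandwich[OF _ _ tendsto_const lim[of "4 * B \<phi> \<phi>"]]) (use 2 in \<open>auto simp: algebra_simps\<close>)
    ultimately have "(\<lambda>k. (B (v k) \<phi> - l \<phi>) + (B w \<phi> - B (v k) \<phi>)) \<longlonglongrightarrow> 0 + 0"
      by (intro tendsto_add) (simp_all add: power_tendsto_0_iff)
    then have "(\<lambda>k::nat. B w \<phi> - l \<phi>) \<longlonglongrightarrow> 0" by simp
    then show ?thesis by (simp add: LIMSEQ_const_iff)
  qed
  then show ?thesis using w(1) by blast
qed

section \<open>A smooth bump\<close>

text \<open>The derivative appears as an existential witness, so that closure under sums, products
  and affine substitution follows by induction on the order.\<close>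

fun kdiff :: "nat \<Rightarrow> (real \<Rightarrow> real) \<Rightarrow> bool" where
  "kdiff 0 f = True"
| "kdiff (Suc k) f = (\<exists>f'. (\<forall>t. (f has_real_derivative f' t) (at t)) \<and> kdiff k f')"

lemma kdiff_Suc_mono: "kdiff (Suc k) f \<Longrightarrow> kdiff k f"
proof (induction k arbitrary: f)
  case (Suc k)
  then obtain f' where "\<forall>t. (f has_real_derivative f' t) (at t)" "kdiff (Suc k) f'"
    unfolding kdiff.simps(2)[of "Suc k"] by blast
  then show ?case using Suc.IH[of f'] by auto
qed simp

lemma kdiff_add: "kdiff k f \<Longrightarrow> kdiff k g \<Longrightarrow> kdiff k (\<lambda>t. f t + g t)"
proof (induction k arbitrary: f g)
  case (Suc k)
  then obtain f' g' where "\<forall>t. (f has_real_derivative f' t) (at t)" "kdiff k f'"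
    "\<forall>t. (g has_real_derivative g' t) (at t)" "kdiff k g'" by auto
  then show ?case using Suc.IH[of f' g'] by (auto intro!: exI[of _ "\<lambda>t. f' t + g' t"] derivative_intros)
qed simp

lemma kdiff_mult: "kdiff k f \<Longrightarrow> kdiff k g \<Longrightarrow> kdiff k (\<lambda>t. f t * g t)"
proof (induction k arbitrary: f g)
  case (Suc k)
  then obtain f' g' where *: "\<And>t. (f has_real_derivative f' t) (at t)" "kdiff k f'"
    "\<And>t. (g has_real_derivative g' t) (at t)" "kdiff k g'" by auto
  have "kdiff k f" "kdiff k g" using Suc.prems kdiff_Suc_mono by auto
  then have "kdiff k (\<lambda>t. f' t * g t + g' t * f t)"
    using * Suc.IH by (intro kdiff_add) auto
  moreover have "((\<lambda>t. f t * g t) has_real_derivative (f' t * g t + g' t * f t)) (at t)" for t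
    by (rule DERIV_mult[OF *(1) *(3)])
  ultimately show ?case
    by (intro kdiff.simps(2)[THEN iffD2] exI[of _ "\<lambda>t. f' t * g t + g' t * f t"] conjI allI)
qed simp

lemma kdiff_0: "kdiff k (\<lambda>t. 0)"
  by (induction k) (auto intro!: exI[of _ "\<lambda>_. 0"])

lemma kdiff_const: "kdiff k (\<lambda>t. c)"
  by (cases k) (auto intro!: exI[of _ "\<lambda>_. 0"] kdiff_0)

lemma kdiff_affine: "kdiff k f \<Longrightarrow> kdiff k (\<lambda>t. f (a * t + b))"
proof (induction k arbitrary: f)
  case (Suc k)
  then obtain f' where *: "\<And>t. (f has_real_derivative f' t) (at t)" "kdiff k f'" by auto
  have "kdiff k (\<lambda>t. f' (a * t + b) * a)"
    by (intro kdiff_mult kdiff_const Suc.IH *)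
  moreover have "((\<lambda>t. f (a * t + b)) has_real_derivative f' (a * t + b) * a) (at t)" for t
    by (rule DERIV_chain2[OF *(1)]) (auto intro!: derivative_eq_intros)
  ultimately show ?case
    by (intro kdiff.simps(2)[THEN iffD2] exI[of _ "\<lambda>t. f' (a * t + b) * a"] conjI allI)
qed simp

text \<open>The polynomial is a parameter because functions p(1/t) exp(-1/t) are closed under
  differentiation, whereas the single function exp(-1/t) is not.\<close>

definition flat :: "real poly \<Rightarrow> real \<Rightarrow> real" where
  "flat p t = (if 0 < t then poly p (1 / t) * exp (- (1 / t)) else 0)"

lemma poly_exp_at_top: "((\<lambda>z. poly p z * exp (- z)) \<longlongrightarrow> 0) at_top" for p :: "real poly"
proof -
  have "((\<lambda>z. \<Sum>i\<le>degree p. coeff p i * (z ^ i / exp z)) \<longlongrightarrow> (\<Sum>i\<le>degree p. coeff p i * 0)) at_top"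
    by (intro tendsto_sum tendsto_mult tendsto_const tendsto_power_div_exp_0)
  moreover have "(\<lambda>z. \<Sum>i\<le>degree p. coeff p i * (z ^ i / exp z)) = (\<lambda>z. poly p z * exp (- z))"
    by (auto simp: poly_altdef sum_distrib_right exp_minus divide_inverse mult.assoc)
  ultimately show ?thesis by simp
qed

text \<open>For t > 0 the derivative of p(1/t) exp(-1/t) is t^-2 (p - p')(1/t) exp(-1/t); the two
  \<open>pCons 0\<close> multiply by X^2. At 0 the difference quotient from the right is (X p)(1/h)
  exp(-1/h), which tends to 0.\<close>

lemma DERIV_flat: "(flat p has_real_derivative flat (pCons 0 (pCons 0 (p - pderiv p))) t) (at t)"
proof -
  let ?q = "pCons 0 (pCons 0 (p - pderiv p))"
  consider "t < 0" | "t = 0" | "0 < t" by linarith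
  then show ?thesis
  proof cases
    case 1
    have "(flat p has_real_derivative 0) (at t)"
      by (rule has_field_derivative_transform_within_open[of "\<lambda>_. 0" _ _ "{..<0}"])
        (use 1 in \<open>auto simp: flat_def\<close>)
    then show ?thesis using 1 by (simp add: flat_def)
  next
    case 3
    have "((\<lambda>t. poly p (1 / t) * exp (- (1 / t))) has_real_derivative flat ?q t) (at t)"
      using 3 by (auto intro!: derivative_eq_intros DERIV_chain2[OF poly_DERIV] 
          simp: flat_def field_simps power2_eq_square)
    then show ?thesis
      by (rule has_field_derivative_transform_within_open[of _ _ _ "{0<..}"])
        (use 3 in \<open>auto simp: flat_def\<close>)
  next
    case 2
    have "((\<lambda>h. flat p h / h) \<longlongrightarrow> 0) (at_right 0)"
    proof -
      have "((\<lambda>h. poly (pCons 0 p) (inverse h) * exp (- inverse h)) \<longlongrightarrow> 0) (at_right 0)"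
        by (rule filterlim_compose[OF poly_exp_at_top filterlim_inverse_at_top_right])
      then show ?thesis
        by (rule tendsto_cong[THEN iffD1, rotated])
          (auto simp: eventually_at_filter flat_def divide_inverse mult_ac)
    qed
    moreover have "((\<lambda>h. flat p h / h) \<longlongrightarrow> 0) (at_left 0)"
      by (rule tendsto_cong[THEN iffD1, OF _ tendsto_const])
        (auto simp: eventually_at_filter flat_def)
    ultimately have "((\<lambda>h. flat p h / h) \<longlongrightarrow> 0) (at 0)"
      by (simp add: filterlim_split_at)
    then show ?thesis using 2 by (simp add: DERIV_def flat_def)
  qed
qed

lemma kdiff_flat: "kdiff k (flat p)"
  by (induction k arbitrary: p) (auto intro: DERIV_flat)

definition bump1 :: "real \<Rightarrow> real" where
  "bump1 t = flat 1 (1 + t) * flat 1 (1 - t)"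

lemma kdiff_bump1: "kdiff k bump1"
proof -
  have "bump1 = (\<lambda>t. flat 1 (1 * t + 1) * flat 1 (-1 * t + 1))"
    by (rule ext) (simp add: bump1_def add.commute[of 1])
  then show ?thesis
    using kdiff_mult[OF kdiff_affine[OF kdiff_flat[of k 1], of 1 1] kdiff_affine[OF kdiff_flat[of k 1], of "-1" 1]]
    by simp
qed

lemma bump1_nonneg: "0 \<le> bump1 t"
  by (auto simp: bump1_def flat_def)

lemma bump1_0_pos: "0 < bump1 0"
  by (auto simp: bump1_def flat_def)

lemma bump1_support: "1 \<le> \<bar>t\<bar> \<Longrightarrow> bump1 t = 0"
  by (auto simp: bump1_def flat_def)

definition dbump :: "nat \<Rightarrow> real \<Rightarrow> real" where
  "dbump k = (deriv ^^ k) bump1"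

lemma dbump_0 [simp]: "dbump 0 = bump1" by (simp add: dbump_def)

lemma kdiff_dbump: "kdiff m (dbump k)"
proof (induction k arbitrary: m)
  case (Suc k)
  from Suc[of "Suc m"] obtain f' where f': "\<forall>t. (dbump k has_real_derivative f' t) (at t)" "kdiff m f'"
    by auto
  then have "f' = dbump (Suc k)" by (intro ext) (simp add: dbump_def DERIV_imp_deriv[symmetric] DERIV_imp_deriv)
  then show ?case using f' by simp
qed (simp add: kdiff_bump1)

lemma DERIV_dbump: "(dbump k has_real_derivative dbump (Suc k) t) (at t)"
proof -
  from kdiff_dbump[of 1 k] obtain f' where f': "\<forall>t. (dbump k has_real_derivative f' t) (at t)"
    by auto
  then have "f' = dbump (Suc k)" by (intro ext) (simp add: dbump_def DERIV_imp_deriv[symmetric] DERIV_imp_deriv)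
  then show ?thesis using f' by simp
qed

lemma continuous_dbump: "continuous_on S (dbump k)"
  using DERIV_dbump DERIV_isCont continuous_at_imp_continuous_on by blast

lemma dbump_support: "1 < \<bar>t\<bar> \<Longrightarrow> dbump k t = 0"
proof (induction k arbitrary: t)
  case (Suc k)
  have "(dbump k has_real_derivative 0) (at t)"
    by (rule has_field_derivative_transform_within_open[of "\<lambda>_. 0" _ _ "- {-1..1}"])
      (use Suc in \<open>auto simp: open_Compl\<close>)
  then show ?case using DERIV_dbump DERIV_unique by blast
qed (simp add: bump1_support)

text \<open>One constant serves all derivatives up to order \<open>m\<close>. It is at least 1, so
  that one can divide by it and compare its powers.\<close>

lemma dbump_bounded: "\<exists>A\<ge>1. \<forall>k\<le>m. \<forall>t. \<bar>dbump k t\<bar> \<le> A"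
proof (induction m)
  case (Suc m)
  then obtain A where A: "1 \<le> A" "\<And>k t. k \<le> m \<Longrightarrow> \<bar>dbump k t\<bar> \<le> A" by auto
  have "compact (dbump (Suc m) ` {-1..1})"
    by (intro compact_continuous_image continuous_dbump) auto
  then obtain C where C: "\<And>t. t \<in> {-1..1} \<Longrightarrow> \<bar>dbump (Suc m) t\<bar> \<le> C"
    using compact_imp_bounded bounded_iff by (metis imageI real_norm_def)
  have "\<bar>dbump (Suc m) t\<bar> \<le> max A C" for t
    using C[of t] dbump_support[of t "Suc m"] A(1) by (cases "\<bar>t\<bar> \<le> 1") (auto simp: abs_le_iff le_max_iff_disj)
  then show ?case using A by (intro exI[of _ "max A C"]) (auto simp: le_Suc_eq le_max_iff_disj)
next
  case 0
  have "compact (dbump 0 ` {-1..1})"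
    by (intro compact_continuous_image continuous_dbump) auto
  then obtain C where C: "\<And>t. t \<in> {-1..1} \<Longrightarrow> \<bar>dbump 0 t\<bar> \<le> C"
    using compact_imp_bounded bounded_iff by (metis imageI real_norm_def)
  have "\<bar>dbump 0 t\<bar> \<le> max 1 C" for t
    using C[of t] dbump_support[of t 0] by (cases "\<bar>t\<bar> \<le> 1") (auto simp: abs_le_iff le_max_iff_disj)
  then show ?case by (intro exI[of _ "max 1 C"]) auto
qed

section \<open>Tensor products of bumps and their partial derivatives\<close>

lemma dpart_closed:
  assumes pd: "\<And>g i. g \<in> S \<Longrightarrow> pd i g \<in> S" and "f \<in> S"
  shows "dpart is f \<in> S"
proof (induction "is")
  case (Cons i "is")
  then show ?case using pd[of "dpart is f" i] by simp
qed (simp add: assms(2))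

text \<open>Smoothness is proved by exhibiting a class of continuous functions that is closed under
  partial derivatives; it is applied to convolutions with \<open>psi\<close> and to sums of
  bumps.\<close>

lemma Ck_onI:
  assumes "f \<in> S" "\<And>g i. g \<in> S \<Longrightarrow> pd i g \<in> S" "\<And>g. g \<in> S \<Longrightarrow> continuous_on UNIV g"
    "\<And>g i x. g \<in> S \<Longrightarrow> (\<lambda>t. g (x + t *\<^sub>R axis i 1)) differentiable (at 0)"
  shows "Ck_on k U f"
proof -
  have "dpart is f \<in> S" for "is" by (rule dpart_closed) (use assms in auto)
  then show ?thesis unfolding Ck_on_def
    using assms(3,4) continuous_on_subset by blast
qed

lemma prod_DERIV_axis:
  fixes x :: "real^'n::finite" and a :: "'n \<Rightarrow> real \<Rightarrow> real"
  assumes "\<And>t. (a i has_real_derivative a' t) (at t)"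
  shows "((\<lambda>t. \<Prod>j\<in>UNIV. a j ((x + t *\<^sub>R axis i 1) $ j)) has_real_derivative 
      (\<Prod>j\<in>UNIV. (a(i := a')) j (x $ j))) (at 0)"
proof -
  have "(\<lambda>t. \<Prod>j\<in>UNIV. a j ((x + t *\<^sub>R axis i 1) $ j)) 
      = (\<lambda>t. a i (x $ i + t) * (\<Prod>j\<in>UNIV - {i}. a j (x $ j)))"
    by (subst prod.remove[of _ i]) (auto simp: axis_def intro!: ext arg_cong2[where f="(*)"] prod.cong)
  moreover have "((\<lambda>t. a i (x $ i + t) * (\<Prod>j\<in>UNIV - {i}. a j (x $ j))) has_real_derivative
      a' (x $ i) * (\<Prod>j\<in>UNIV - {i}. a j (x $ j))) (at 0)"
    using assms[of "x $ i + 0"] by (intro DERIV_cmult_right) (simp add: DERIV_shift[of _ _ 0 "x $ i", simplified] add.commute)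
  moreover have "a' (x $ i) * (\<Prod>j\<in>UNIV - {i}. a j (x $ j)) = (\<Prod>j\<in>UNIV. (a(i := a')) j (x $ j))"
    by (subst prod.remove[of _ i]) (auto intro!: arg_cong2[where f="(*)"] prod.cong)
  ultimately show ?thesis by simp
qed

text \<open>\<open>psi \<kappa>\<close> is the partial derivative of order \<open>\<kappa>\<close> of the tensor product of the one-dimensional bumps.\<close>

definition psi :: "('n::finite \<Rightarrow> nat) \<Rightarrow> real^'n \<Rightarrow> real" where
  "psi \<kappa> x = (\<Prod>i\<in>UNIV. dbump (\<kappa> i) (x $ i))"

lemma psi_DERIV: "((\<lambda>t. psi \<kappa> (x + t *\<^sub>R axis i 1)) has_real_derivative psi (\<kappa>(i := Suc (\<kappa> i))) x) (at 0)"
proof -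
  have "((\<lambda>t. psi \<kappa> (x + t *\<^sub>R axis i 1)) has_real_derivative 
     (\<Prod>j\<in>UNIV. ((\<lambda>j. dbump (\<kappa> j))(i := dbump (Suc (\<kappa> i)))) j (x $ j))) (at 0)"
    unfolding psi_def by (rule prod_DERIV_axis) (rule DERIV_dbump)
  moreover have "((\<lambda>j. dbump (\<kappa> j))(i := dbump (Suc (\<kappa> i)))) = (\<lambda>j. dbump ((\<kappa>(i := Suc (\<kappa> i))) j))"
    by auto
  ultimately show ?thesis by (simp add: psi_def)
qed

lemma continuous_psi: "continuous_on S (psi \<kappa>)"
proof -
  have "continuous_on S (\<lambda>x. dbump (\<kappa> i) (x $ i))" for i
    by (rule continuous_on_compose2[OF continuous_dbump[of UNIV]]) (auto intro: continuous_on_component)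
  then show ?thesis unfolding psi_def by (intro continuous_on_prod)
qed

lemma psi_support: "psi \<kappa> x \<noteq> 0 \<Longrightarrow> \<bar>x $ i\<bar> \<le> 1"
  unfolding psi_def using dbump_support[of "x $ i" "\<kappa> i"] by (auto simp: prod_zero_iff not_less[symmetric])

text \<open>For the Lipschitz bound each factor is divided by \<open>A\<close>: a difference of
  products of numbers bounded by 1 is at most the sum of the differences of the factors. The order
  \<open>Suc m\<close> in the hypothesis covers the derivative of a factor of order
  \<open>m\<close>.\<close>

lemma psi_bounds:
  fixes x y :: "real^'n::finite"
  assumes A: "1 \<le> A" "\<And>k t. k \<le> Suc m \<Longrightarrow> \<bar>dbump k t\<bar> \<le> A" and \<kappa>: "\<And>i. \<kappa> i \<le> m"
  shows "\<bar>psi \<kappa> x\<bar> \<le> A ^ CARD('n)"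
    and "\<bar>psi \<kappa> x - psi \<kappa> y\<bar> \<le> A ^ CARD('n) * real CARD('n) * dist x y"
proof -
  have d: "\<bar>dbump (\<kappa> i) t\<bar> \<le> A" for i t using A(2)[of "\<kappa> i"] \<kappa>[of i] by simp
  show "\<bar>psi \<kappa> x\<bar> \<le> A ^ CARD('n)"
    unfolding psi_def abs_prod using prod_mono[of UNIV "\<lambda>i. \<bar>dbump (\<kappa> i) (x $ i)\<bar>" "\<lambda>_. A"] d by simp
  have n: "\<bar>dbump (\<kappa> i) t / A\<bar> \<le> 1" for i t using d[of i t] A(1) by simp
  have lip: "\<bar>dbump (\<kappa> i) s / A - dbump (\<kappa> i) t / A\<bar> \<le> \<bar>s - t\<bar>" for i s t
  proof -
    have "norm (dbump (\<kappa> i) s - dbump (\<kappa> i) t) \<le> A * norm (s - t)"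
      by (rule field_differentiable_bound[where S=UNIV and f'="dbump (Suc (\<kappa> i))"])
        (use A(2)[of "Suc (\<kappa> i)"] \<kappa>[of i] DERIV_dbump in auto)
    then show ?thesis using A(1) by (simp add: divide_le_eq mult.commute flip: diff_divide_distrib)
  qed
  have p: "psi \<kappa> x = A ^ CARD('n) * (\<Prod>i\<in>UNIV. dbump (\<kappa> i) (x $ i) / A)" for x :: "real^'n"
    using A(1) by (simp add: psi_def prod_dividef)
  have "norm ((\<Prod>i\<in>UNIV. dbump (\<kappa> i) (x $ i) / A) - (\<Prod>i\<in>UNIV. dbump (\<kappa> i) (y $ i) / A))
     \<le> (\<Sum>i\<in>UNIV. norm (dbump (\<kappa> i) (x $ i) / A - dbump (\<kappa> i) (y $ i) / A))"
    by (rule norm_prod_diff) (use n in auto)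
  also have "\<dots> \<le> (\<Sum>i\<in>(UNIV::'n set). dist x y)"
  proof (rule sum_mono)
    fix i
    have "\<bar>x $ i - y $ i\<bar> \<le> dist x y" using component_le_norm_cart[of "x - y" i] by (simp add: dist_norm)
    then show "norm (dbump (\<kappa> i) (x $ i) / A - dbump (\<kappa> i) (y $ i) / A) \<le> dist x y"
      using lip[of i "x $ i" "y $ i"] by simp
  qed
  finally have "\<bar>(\<Prod>i\<in>UNIV. dbump (\<kappa> i) (x $ i) / A) - (\<Prod>i\<in>UNIV. dbump (\<kappa> i) (y $ i) / A)\<bar> \<le> real CARD('n) * dist x y"
    by simp
  then have "A ^ CARD('n) * \<bar>(\<Prod>i\<in>UNIV. dbump (\<kappa> i) (x $ i) / A) - (\<Prod>i\<in>UNIV. dbump (\<kappa> i) (y $ i) / A)\<bar>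
     \<le> A ^ CARD('n) * (real CARD('n) * dist x y)"
    using A(1) by (intro mult_left_mono) auto
  moreover have "A ^ CARD('n) * \<bar>(\<Prod>i\<in>UNIV. dbump (\<kappa> i) (x $ i) / A) - (\<Prod>i\<in>UNIV. dbump (\<kappa> i) (y $ i) / A)\<bar>
     = \<bar>psi \<kappa> x - psi \<kappa> y\<bar>"
    using A(1) by (subst (1 2) p) (simp add: abs_mult flip: right_diff_distrib)
  ultimately show "\<bar>psi \<kappa> x - psi \<kappa> y\<bar> \<le> A ^ CARD('n) * real CARD('n) * dist x y" by (simp add: mult.assoc)
qed

lemma psi_0_pos: "0 < psi (\<lambda>_. 0) 0" and psi_nonneg: "0 \<le> psi (\<lambda>_. 0) x"
  using bump1_0_pos bump1_nonneg by (auto simp: psi_def intro!: prod_pos prod_nonneg)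

section \<open>The quadratic form on functions supported in the ball\<close>

abbreviation plane :: "((real^'n::finite) \<times> (real^'n)) measure" where
  "plane \<equiv> lborel \<Otimes>\<^sub>M lborel"

text \<open>The exponent is half of n + 2s, so that \<open>gagliardo s u v\<close> is the product of
  \<open>dq s u\<close> and \<open>dq s v\<close> and the energy becomes an L2 norm on the
  plane.\<close>

definition dq :: "real \<Rightarrow> 'n::finite fn \<Rightarrow> (real^'n) \<times> (real^'n) \<Rightarrow> real" where
  "dq s u p = (u (fst p) - u (snd p)) / norm (fst p - snd p) powr ((real CARD('n) + 2 * s) / 2)"

lemma gagliardo_eq: "gagliardo s u v p = dq s u p * dq s v p"
  unfolding gagliardo_def dq_def by (simp flip: powr_add)

lemma dq_measurable [measurable]:
  assumes [measurable]: "u \<in> borel_measurable borel"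
  shows "dq s u \<in> borel_measurable plane"
  unfolding dq_def by measurable

lemma dq_lin: "dq s (\<lambda>x. a * u x + b * v x) p = a * dq s u p + b * dq s v p"
proof -
  have "(a * x + b * y - (a * z + b * w)) / d = a * ((x - z) / d) + b * ((y - w) / d)" for x y z w d :: real
    by (cases "d = 0") (simp_all add: field_simps)
  then show ?thesis unfolding dq_def .
qed

lemma Hs_iff: "u \<in> Hs s \<longleftrightarrow> u \<in> borel_measurable borel \<and> sq_integrable lborel u \<and> sq_integrable plane (dq s u)"
  by (auto simp: Hs_def sq_integrable_def gagliardo_eq[abs_def] power2_eq_square)

lemma Hs_lin: "u \<in> Hs s \<Longrightarrow> v \<in> Hs s \<Longrightarrow> (\<lambda>x. a * u x + b * v x) \<in> Hs s"
  using sq_integrable_lin[of lborel u v a b] sq_integrable_lin[of plane "dq s u" "dq s v" a b]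
  by (auto simp: Hs_iff dq_lin[of s a u b v, abs_def])

text \<open>The constants below are uniform over this class. The value 1 off the ball confines the
  perturbation \<open>sqrt \<gamma> - 1\<close> to the ball and removes \<open>\<gamma>\<close> from
  the annulus.\<close>

definition adm :: "'n::finite fn \<Rightarrow> bool" where
  "adm \<gamma> \<longleftrightarrow> \<gamma> \<in> borel_measurable borel \<and> (\<forall>x. 1 \<le> \<gamma> x \<and> \<gamma> x \<le> 2) \<and> (\<forall>x. 1 < norm x \<longrightarrow> \<gamma> x = 1)"

lemma C_ns_pos:
  assumes "0 < s" "s < 1" shows "0 < C_ns n s"
proof -
  \<comment> \<open>\<open>Gamma\<close> takes the value 0 at its poles, so positivity of the
    quotient rests on \<open>s\<close> not being an integer.\<close>
  have "Gamma (- s) \<noteq> 0"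
  proof
    assume "Gamma (- s) = 0"
    then have "- s \<in> \<int>" using nonpos_Ints_Int by (auto simp: Gamma_eq_zero_iff)
    then have "s \<in> \<int>" using Ints_minus by fastforce
    then show False using assms by (auto elim!: Ints_cases)
  qed
  then show ?thesis using assms unfolding C_ns_def
    by (intro divide_pos_pos mult_pos_pos Gamma_real_pos) auto
qed

text \<open>\<open>Bform\<close> is the inner product in \<open>L\<^sup>2\<close> of the quotients \<open>dq\<close> multiplied by \<open>bw\<close>.\<close>

definition bw :: "real \<Rightarrow> 'n::finite fn \<Rightarrow> (real^'n) \<times> (real^'n) \<Rightarrow> real" where
  "bw s \<gamma> p = sqrt (C_ns CARD('n) s / 2 * (sqrt (\<gamma> (fst p)) * sqrt (\<gamma> (snd p))))"

definition bdq :: "real \<Rightarrow> 'n::finite fn \<Rightarrow> 'n fn \<Rightarrow> (real^'n) \<times> (real^'n) \<Rightarrow> real" where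
  "bdq s \<gamma> u p = bw s \<gamma> p * dq s u p"

lemma bdq_lin: "bdq s \<gamma> (\<lambda>x. a * u x + b * v x) p = a * bdq s \<gamma> u p + b * bdq s \<gamma> v p"
  unfolding bdq_def dq_lin by (simp add: algebra_simps)

lemma adm_measurable: "adm \<gamma> \<Longrightarrow> \<gamma> \<in> borel_measurable borel" by (simp add: adm_def)

lemma bdq_measurable:
  assumes "adm \<gamma>" and [measurable]: "u \<in> borel_measurable borel"
  shows "bdq s \<gamma> u \<in> borel_measurable plane"
proof -
  note adm_measurable[OF assms(1), measurable]
  show ?thesis unfolding bdq_def bw_def by measurable
qed

lemma adm_sqrt: "adm \<gamma> \<Longrightarrow> 1 \<le> sqrt (\<gamma> x) \<and> sqrt (\<gamma> x) \<le> 2" 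
proof -
  assume "adm \<gamma>"
  then have "1 \<le> \<gamma> x" "\<gamma> x \<le> 4" by (auto simp: adm_def intro: order_trans[of _ 2])
  then show ?thesis using real_sqrt_le_mono[of "\<gamma> x" 4] by simp
qed

lemma adm_sqrt_mult: "adm \<gamma> \<Longrightarrow> 1 \<le> sqrt (\<gamma> x) * sqrt (\<gamma> y) \<and> sqrt (\<gamma> x) * sqrt (\<gamma> y) \<le> 2"
proof -
  assume a: "adm \<gamma>"
  have "sqrt (\<gamma> x) \<le> sqrt 2" "sqrt (\<gamma> y) \<le> sqrt 2" using a by (auto simp: adm_def)
  moreover have "1 \<le> sqrt (\<gamma> x)" "1 \<le> sqrt (\<gamma> y)" using adm_sqrt[OF a] by auto
  ultimately show ?thesis using mult_mono[of "sqrt (\<gamma> x)" "sqrt 2" "sqrt (\<gamma> y)" "sqrt 2"]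
     mult_mono[of 1 "sqrt (\<gamma> x)" 1 "sqrt (\<gamma> y)"] by auto
qed

context
  fixes s :: real
  assumes s: "0 < s" "s < 1"
begin

lemma bw_bounds:
  fixes \<gamma> :: "'n::finite fn"
  assumes "adm \<gamma>"
  shows "C_ns CARD('n) s / 2 \<le> (bw s \<gamma> p)\<^sup>2" "(bw s \<gamma> p)\<^sup>2 \<le> C_ns CARD('n) s"
proof -
  have C: "0 < C_ns CARD('n) s" by (rule C_ns_pos[OF s])
  have w: "1 \<le> sqrt (\<gamma> (fst p)) * sqrt (\<gamma> (snd p))" "sqrt (\<gamma> (fst p)) * sqrt (\<gamma> (snd p)) \<le> 2"
    using adm_sqrt_mult[OF assms] by auto
  have eq: "(bw s \<gamma> p)\<^sup>2 = C_ns CARD('n) s / 2 * (sqrt (\<gamma> (fst p)) * sqrt (\<gamma> (snd p)))"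
    unfolding bw_def using C w by (intro real_sqrt_pow2 mult_nonneg_nonneg[of "C_ns CARD('n) s / 2"]) auto
  show "C_ns CARD('n) s / 2 \<le> (bw s \<gamma> p)\<^sup>2"
    unfolding eq using mult_left_mono[OF w(1), of "C_ns CARD('n) s / 2"] C by simp
  show "(bw s \<gamma> p)\<^sup>2 \<le> C_ns CARD('n) s"
    unfolding eq using mult_left_mono[OF w(2), of "C_ns CARD('n) s / 2"] C by simp
qed

lemma Bform_eq:
  fixes \<gamma> :: "'n::finite fn"
  assumes "adm \<gamma>"
  shows "Bform s \<gamma> u v = (\<integral>p. bdq s \<gamma> u p * bdq s \<gamma> v p \<partial>plane)"
proof -
  have C: "0 < C_ns CARD('n) s" by (rule C_ns_pos[OF s])
  have "0 \<le> sqrt (\<gamma> (fst p)) * sqrt (\<gamma> (snd p))" for p using adm_sqrt_mult[OF assms, of "fst p" "snd p"] by simp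
  then have "bdq s \<gamma> u p * bdq s \<gamma> v p = C_ns CARD('n) s / 2 * (sqrt (\<gamma> (fst p)) * sqrt (\<gamma> (snd p)) * gagliardo s u v p)" for p
    using C real_sqrt_mult_self[of "C_ns CARD('n) s / 2 * (sqrt (\<gamma> (fst p)) * sqrt (\<gamma> (snd p)))"]
    unfolding bdq_def bw_def gagliardo_eq by (simp add: mult_ac del: real_sqrt_mult_self)
  then show ?thesis unfolding Bform_def integral_mult_right_zero[symmetric]
    by (intro Bochner_Integration.integral_cong refl) simp
qed

lemma Bform_sym: "Bform s \<gamma> u v = Bform s \<gamma> v u"
  unfolding Bform_def gagliardo_def by (simp add: mult.commute mult.left_commute)

lemma sq_integrable_bdq:
  assumes "adm \<gamma>" "u \<in> borel_measurable borel"
  shows "sq_integrable plane (bdq s \<gamma> u) \<longleftrightarrow> sq_integrable plane (dq s u)"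
proof
  have [measurable]: "u \<in> borel_measurable borel" "bdq s \<gamma> u \<in> borel_measurable plane"
    by (fact assms(2), rule bdq_measurable[OF assms])
  let ?C = "C_ns CARD('a) s"
  have C: "0 < ?C" by (rule C_ns_pos[OF s])
  have *: "(bdq s \<gamma> u p)\<^sup>2 = (bw s \<gamma> p)\<^sup>2 * (dq s u p)\<^sup>2" for p by (simp add: bdq_def power_mult_distrib)
  { assume L: "sq_integrable plane (dq s u)"
    have "integrable plane (\<lambda>p. (bdq s \<gamma> u p)\<^sup>2)"
    proof (rule Bochner_Integration.integrable_bound)
      show "integrable plane (\<lambda>p. ?C * (dq s u p)\<^sup>2)" using L by (auto simp: sq_integrable_def)
      show "AE p in plane. norm ((bdq s \<gamma> u p)\<^sup>2) \<le> norm (?C * (dq s u p)\<^sup>2)"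
        unfolding * using bw_bounds(2)[OF assms(1)] C by (intro AE_I2) (auto simp: intro!: mult_right_mono)
    qed measurable
    then show "sq_integrable plane (bdq s \<gamma> u)" by (simp add: sq_integrable_def) }
  { assume L: "sq_integrable plane (bdq s \<gamma> u)"
    have "integrable plane (\<lambda>p. (dq s u p)\<^sup>2)"
    proof (rule Bochner_Integration.integrable_bound)
      show "integrable plane (\<lambda>p. 2 / ?C * (bdq s \<gamma> u p)\<^sup>2)" using L by (auto simp: sq_integrable_def)
      have "(dq s u p)\<^sup>2 \<le> 2 / ?C * (bdq s \<gamma> u p)\<^sup>2" for p
        unfolding * using mult_right_mono[OF bw_bounds(1)[OF assms(1), of p], of "(dq s u p)\<^sup>2"] C
        by (simp add: field_simps)
      then show "AE p in plane. norm ((dq s u p)\<^sup>2) \<le> norm (2 / ?C * (bdq s \<gamma> u p)\<^sup>2)"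
        using C by (intro AE_I2) simp
    qed measurable
    then show "sq_integrable plane (dq s u)" by (simp add: sq_integrable_def) }
qed

lemma Hs_bdq: "adm \<gamma> \<Longrightarrow> u \<in> Hs s \<Longrightarrow> sq_integrable plane (bdq s \<gamma> u)"
  by (simp add: Hs_iff sq_integrable_bdq)

lemma Bform_lin:
  assumes "adm \<gamma>" "u \<in> Hs s" "v \<in> Hs s" "w \<in> Hs s"
  shows "Bform s \<gamma> (\<lambda>x. a * u x + b * v x) w = a * Bform s \<gamma> u w + b * Bform s \<gamma> v w"
proof -
  have i: "integrable plane (\<lambda>p. bdq s \<gamma> u p * bdq s \<gamma> w p)" "integrable plane (\<lambda>p. bdq s \<gamma> v p * bdq s \<gamma> w p)"
    using assms by (auto intro!: sq_integrable_mult Hs_bdq)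
  have "Bform s \<gamma> (\<lambda>x. a * u x + b * v x) w
    = (\<integral>p. a * (bdq s \<gamma> u p * bdq s \<gamma> w p) + b * (bdq s \<gamma> v p * bdq s \<gamma> w p) \<partial>plane)"
    unfolding Bform_eq[OF assms(1)] bdq_lin by (simp add: algebra_simps)
  also have "\<dots> = a * Bform s \<gamma> u w + b * Bform s \<gamma> v w"
    using i by (simp add: Bform_eq[OF assms(1)])
  finally show ?thesis .
qed

lemma Bform_nonneg: "adm \<gamma> \<Longrightarrow> 0 \<le> Bform s \<gamma> u u"
  by (simp add: Bform_eq)

lemma Bform_CS:
  assumes "adm \<gamma>" "u \<in> Hs s" "v \<in> Hs s"
  shows "\<bar>Bform s \<gamma> u v\<bar> \<le> sqrt (Bform s \<gamma> u u) * sqrt (Bform s \<gamma> v v)"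
  using integral_Cauchy_Schwarz_abs[OF Hs_bdq[OF assms(1,2)] Hs_bdq[OF assms(1,3)]]
  unfolding Bform_eq[OF assms(1)] power2_eq_square .

lemma Bform_ge_dq:
  fixes \<gamma> :: "'n::finite fn"
  assumes "adm \<gamma>" "u \<in> Hs s"
  shows "C_ns CARD('n) s / 2 * (\<integral>p. (dq s u p)\<^sup>2 \<partial>plane) \<le> Bform s \<gamma> u u"
    and "Bform s \<gamma> u u \<le> C_ns CARD('n) s * (\<integral>p. (dq s u p)\<^sup>2 \<partial>plane)"
proof -
  have i: "integrable plane (\<lambda>p. (bdq s \<gamma> u p)\<^sup>2)" "integrable plane (\<lambda>p. (dq s u p)\<^sup>2)"
    using Hs_bdq[OF assms] assms(2) by (auto simp: sq_integrable_def Hs_iff)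
  have *: "(bdq s \<gamma> u p)\<^sup>2 = (bw s \<gamma> p)\<^sup>2 * (dq s u p)\<^sup>2" for p by (simp add: bdq_def power_mult_distrib)
  have B: "Bform s \<gamma> u u = (\<integral>p. (bdq s \<gamma> u p)\<^sup>2 \<partial>plane)"
    by (simp add: Bform_eq[OF assms(1)] power2_eq_square)
  have "(\<integral>p. C_ns CARD('n) s / 2 * (dq s u p)\<^sup>2 \<partial>plane) \<le> Bform s \<gamma> u u"
    unfolding B
  proof (rule integral_mono)
    show "C_ns CARD('n) s / 2 * (dq s u p)\<^sup>2 \<le> (bdq s \<gamma> u p)\<^sup>2" for p
      unfolding * by (rule mult_right_mono[OF bw_bounds(1)[OF assms(1)]]) simp
  qed (use i in simp_all)
  then show "C_ns CARD('n) s / 2 * (\<integral>p. (dq s u p)\<^sup>2 \<partial>plane) \<le> Bform s \<gamma> u u" by simp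
  have "Bform s \<gamma> u u \<le> (\<integral>p. C_ns CARD('n) s * (dq s u p)\<^sup>2 \<partial>plane)"
    unfolding B
  proof (rule integral_mono)
    show "(bdq s \<gamma> u p)\<^sup>2 \<le> C_ns CARD('n) s * (dq s u p)\<^sup>2" for p
      unfolding * by (rule mult_right_mono[OF bw_bounds(2)[OF assms(1)]]) simp
  qed (use i in simp_all)
  then show "Bform s \<gamma> u u \<le> C_ns CARD('n) s * (\<integral>p. (dq s u p)\<^sup>2 \<partial>plane)" by simp
qed

end

section \<open>Independence of null sets\<close>

lemma AE_plane:
  fixes P :: "real^'n::finite \<Rightarrow> bool"
  assumes "AE x in lborel. P x"
  shows "AE p in plane. P (fst p) \<and> P (snd p)"
proof -
  obtain N where N: "N \<in> null_sets lborel" "{x. \<not> P x} \<subseteq> N"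
    using assms by (auto elim!: AE_E2 simp: eventually_ae_filter)
  have "N \<times> (UNIV::(real^'n) set) \<in> null_sets plane" "(UNIV::(real^'n) set) \<times> N \<in> null_sets plane"
    by (rule lborel.times_in_null_sets1[OF N(1)], simp, rule lborel.times_in_null_sets2[OF _ N(1)], simp)
  then have "N \<times> UNIV \<union> UNIV \<times> N \<in> null_sets plane" by (rule null_sets.Un)
  then show ?thesis by (rule AE_I') (use N(2) in auto)
qed

lemma dq_cong_AE:
  assumes "AE x in lborel. u x = v x"
  shows "AE p in plane. dq s u p = dq s v p"
  using AE_plane[OF assms] by eventually_elim (simp add: dq_def)

lemma Hs_cong_AE:
  assumes "u \<in> Hs s" "v \<in> borel_measurable borel" "AE x in lborel. u x = v x"
  shows "v \<in> Hs s"
proof -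
  have [measurable]: "u \<in> borel_measurable borel" "v \<in> borel_measurable borel"
    using assms by (auto simp: Hs_iff)
  have "integrable lborel (\<lambda>x. (v x)\<^sup>2)"
    using assms(1,3) by (subst integrable_cong_AE[of _ _ "\<lambda>x. (u x)\<^sup>2"]) (auto simp: Hs_iff sq_integrable_def)
  moreover have "integrable plane (\<lambda>x. (dq s v x)\<^sup>2)"
    using assms(1) dq_cong_AE[OF assms(3), of s]
    by (subst integrable_cong_AE[of _ _ "\<lambda>x. (dq s u x)\<^sup>2"]) (auto simp: Hs_iff sq_integrable_def)
  ultimately show ?thesis by (auto simp: Hs_iff sq_integrable_def)
qed

lemma Bform_cong_AE:
  fixes u v u' v' :: "'n::finite fn"
  assumes [measurable]: "\<gamma> \<in> borel_measurable borel" "u \<in> borel_measurable borel" "v \<in> borel_measurable borel"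
     "u' \<in> borel_measurable borel" "v' \<in> borel_measurable borel"
    and "AE x in lborel. u x = u' x" "AE x in lborel. v x = v' x"
  shows "Bform s \<gamma> u v = Bform s \<gamma> u' v'"
  unfolding Bform_def gagliardo_eq
proof (intro arg_cong2[where f="(*)"] refl integral_cong_AE)
  show "AE p in plane. sqrt (\<gamma> (fst p)) * sqrt (\<gamma> (snd p)) * (dq s u p * dq s v p) =
      sqrt (\<gamma> (fst p)) * sqrt (\<gamma> (snd p)) * (dq s u' p * dq s v' p)"
    using dq_cong_AE[OF assms(6), of s] dq_cong_AE[OF assms(7), of s] by eventually_elim simp
qed measurable

text \<open>The functions vanish off the closed ball at every point and not just a.e., so that
  integrands can be rewritten pointwise. That test functions of the open ball are dense in this
  space is \<open>test_fun_dense\<close>.\<close>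

definition H0 :: "real \<Rightarrow> ('n::finite fn) set" where
  "H0 s = {v \<in> Hs s. \<forall>x. 1 < norm x \<longrightarrow> v x = 0}"

lemma H0_lin: "u \<in> H0 s \<Longrightarrow> v \<in> H0 s \<Longrightarrow> (\<lambda>x. a * u x + b * v x) \<in> H0 s"
  by (auto simp: H0_def Hs_lin)

lemma H0_Hs: "v \<in> H0 s \<Longrightarrow> v \<in> Hs s" by (simp add: H0_def)

lemma zero_in_H0: "(\<lambda>_. 0) \<in> H0 s"
  by (auto simp: H0_def Hs_iff sq_integrable_def dq_def)

text \<open>The quotient of \<open>v \<in> H0\<close> at a point of the ball and a point of the annulus
  \<open>1 < |y| < 2\<close> is \<open>v x\<close> up to a bounded factor.\<close>

lemma Poincare_dq:
  assumes "0 < s"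
  shows "\<exists>P>0. \<forall>v\<in>H0 s. (\<integral>x. (v x)\<^sup>2 \<partial>lborel) \<le> P * (\<integral>p. (dq s (v::'n::finite fn) p)\<^sup>2 \<partial>plane)"
proof -
  define q where "q = real CARD('n) + 2 * s"
  have q: "0 < q" using assms by (simp add: q_def add_nonneg_pos)
  define A where "A = ball (0::real^'n) 2 - cball 0 1"
  have A: "open A" "A \<in> sets borel" unfolding A_def by (auto intro: open_Diff)
  have "(3/2) *\<^sub>R axis undefined 1 \<in> A" by (simp add: A_def norm_axis_1)
  then have "\<not> negligible A" using open_not_negligible[OF A(1)] by blast
  then have "emeasure lborel A \<noteq> 0"
    using A(2) by (auto simp: negligible_iff_null_sets null_sets_def)
  moreover have "emeasure lborel A < \<infinity>"
    by (rule emeasure_bounded_finite) (simp add: A_def bounded_diff)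
  ultimately obtain \<mu> where \<mu>: "0 < \<mu>" "emeasure lborel A = ennreal \<mu>"
    by (metis ennreal_enn2real_if enn2real_positive_iff infinity_ennreal_def less_irrefl zero_less_iff_neq_zero)
  \<comment> \<open>A point of the ball and a point of \<open>A\<close> are at distance at most 3,
    and integrating over the second point produces the measure of \<open>A\<close>.\<close>
  define P where "P = 3 powr q / \<mu>"
  have "(\<integral>x. (v x)\<^sup>2 \<partial>lborel) \<le> P * (\<integral>p. (dq s v p)\<^sup>2 \<partial>plane)" if "v \<in> H0 s" for v :: "'n fn"
  proof -
    have [measurable]: "v \<in> borel_measurable borel" using that by (auto simp: H0_def Hs_iff)
    have i: "integrable lborel (\<lambda>x. (v x)\<^sup>2)" "integrable plane (\<lambda>p. (dq s v p)\<^sup>2)"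
      using that by (auto simp: H0_def Hs_iff sq_integrable_def)
    have pt: "ennreal ((v x)\<^sup>2 / 3 powr q) * indicator A y \<le> ennreal ((dq s v (x, y))\<^sup>2)" for x y
    proof (cases "y \<in> A \<and> norm x \<le> 1")
      case True
      then have y: "1 < norm y" "norm y < 2" by (auto simp: A_def)
      then have vy: "v y = 0" using that by (auto simp: H0_def)
      have n: "0 < norm (x - y)" "norm (x - y) \<le> 3"
        using True y norm_triangle_ineq4[of x y] by auto
      have "norm (x - y) powr q \<le> 3 powr q" using n q by (intro powr_mono2) auto
      moreover have "(dq s v (x, y))\<^sup>2 = (v x)\<^sup>2 / norm (x - y) powr q"
        using vy by (simp add: dq_def q_def power2_eq_square flip: powr_add)
      ultimately have "(v x)\<^sup>2 / 3 powr q \<le> (dq s v (x, y))\<^sup>2"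
        using n by (auto intro!: divide_left_mono)
      then show ?thesis using True by (auto intro!: ennreal_leI)
    next
      case False
      then show ?thesis using that by (auto simp: H0_def indicator_def not_le)
    qed
    have "ennreal (\<integral>x. (v x)\<^sup>2 / 3 powr q \<partial>lborel) * ennreal \<mu> = (\<integral>\<^sup>+x. ennreal ((v x)\<^sup>2 / 3 powr q) \<partial>lborel) * ennreal \<mu>"
      using i by (subst nn_integral_eq_integral) auto
    also have "\<dots> = (\<integral>\<^sup>+x. ennreal ((v x)\<^sup>2 / 3 powr q) * emeasure lborel A \<partial>lborel)"
      by (simp add: nn_integral_multc \<mu>)
    also have "\<dots> = (\<integral>\<^sup>+x. \<integral>\<^sup>+y. ennreal ((v x)\<^sup>2 / 3 powr q) * indicator A y \<partial>lborel \<partial>lborel)"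
      using A by (simp add: nn_integral_cmult_indicator)
    also have "\<dots> \<le> (\<integral>\<^sup>+x. \<integral>\<^sup>+y. ennreal ((dq s v (x, y))\<^sup>2) \<partial>lborel \<partial>lborel)"
      by (intro nn_integral_mono pt)
    also have "\<dots> = (\<integral>\<^sup>+p. ennreal ((dq s v p)\<^sup>2) \<partial>plane)"
      by (subst lborel.nn_integral_fst) auto
    also have "\<dots> = ennreal (\<integral>p. (dq s v p)\<^sup>2 \<partial>plane)"
      using i by (intro nn_integral_eq_integral) auto
    finally have "(\<integral>x. (v x)\<^sup>2 / 3 powr q \<partial>lborel) * \<mu> \<le> (\<integral>p. (dq s v p)\<^sup>2 \<partial>plane)"
      using \<mu> by (simp flip: ennreal_mult'')
    then show ?thesis using \<mu> by (simp add: P_def field_simps)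
  qed
  moreover have "0 < P" using \<mu> by (simp add: P_def)
  ultimately show ?thesis by blast
qed

lemma Poincare_Bform:
  assumes "0 < s" "s < 1"
  shows "\<exists>P>0. \<forall>\<gamma>. adm \<gamma> \<longrightarrow> (\<forall>v\<in>H0 s. (\<integral>x. (v x)\<^sup>2 \<partial>lborel) \<le> P * Bform s \<gamma> v (v::'n::finite fn))"
proof -
  obtain P where P: "0 < P" "\<And>v. v \<in> H0 s \<Longrightarrow> (\<integral>x. (v x)\<^sup>2 \<partial>lborel) \<le> P * (\<integral>p. (dq s (v::'n::finite fn) p)\<^sup>2 \<partial>plane)"
    using Poincare_dq[OF assms(1)] by blast
  let ?C = "C_ns CARD('n) s"
  have C: "0 < ?C" by (rule C_ns_pos[OF assms])
  have "(\<integral>x. (v x)\<^sup>2 \<partial>lborel) \<le> P * 2 / ?C * Bform s \<gamma> v v" if "adm \<gamma>" "v \<in> H0 s" for \<gamma> v :: "'n fn"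
  proof -
    have "P * (\<integral>p. (dq s v p)\<^sup>2 \<partial>plane) \<le> P * (2 / ?C * Bform s \<gamma> v v)"
      using Bform_ge_dq(1)[OF assms that(1) H0_Hs[OF that(2)]] C P(1)
      by (intro mult_left_mono) (auto simp: field_simps)
    then show ?thesis using P(2)[OF that(2)] by simp
  qed
  then show ?thesis using P(1) C by (intro exI[of _ "P * 2 / ?C"]) auto
qed

text \<open>The Poincare inequality turns the energy rate into an L2 rate that is fast enough for
  a.e. convergence. Fatou's lemma for the quotients of \<open>v (k + j) - v j\<close> then returns
  the energy bound with the same constant.\<close>

lemma H0_complete:
  fixes \<gamma> :: "'n::finite fn"
  assumes s: "0 < s" "s < 1" and \<gamma>: "adm \<gamma>" and v: "\<And>k. v k \<in> H0 s"
    and c: "\<And>j k. j \<le> k \<Longrightarrow> Bform s \<gamma> (\<lambda>x. v k x - v j x) (\<lambda>x. v k x - v j x) \<le> 4 * (1/8)^j"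
  shows "\<exists>w\<in>H0 s. \<forall>j::nat. Bform s \<gamma> (\<lambda>x. w x - v j x) (\<lambda>x. w x - v j x) \<le> 4 * (1/8)^j"
proof -
  obtain P where P: "0 < P" "\<And>v. v \<in> H0 s \<Longrightarrow> (\<integral>x. (v x)\<^sup>2 \<partial>lborel) \<le> P * Bform s \<gamma> v v"
    using Poincare_Bform[OF s] \<gamma> by blast
  have d: "(\<lambda>x. v k x - v j x) \<in> H0 s" for j k
    using H0_lin[OF v[of k] v[of j], of 1 "-1"] by simp
  have [measurable]: "v k \<in> borel_measurable borel" for k using v[of k] by (auto simp: H0_def Hs_iff)
  have vL: "sq_integrable lborel (v k)" for k using v[of k] by (auto simp: H0_def Hs_iff)
  have L2: "(\<integral>x. (v k x - v j x)\<^sup>2 \<partial>lborel) \<le> P * 4 * (1/8)^j" if "j \<le> k" for j k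
    using order_trans[OF P(2)[OF d] mult_left_mono[OF c[OF that], of P]] P(1) by simp
  \<comment> \<open>Cutting off outside the ball makes the limit vanish there everywhere, as
    \<open>H0\<close> demands.\<close>
  define w where "w x = (if norm x \<le> 1 then lim (\<lambda>k. v k x) else 0)" for x
  have [measurable]: "w \<in> borel_measurable borel" unfolding w_def by measurable
  have "AE x in lborel. convergent (\<lambda>k. v k x)"
    by (rule AE_convergent_of_fast_Cauchy[OF vL, where c="P * 4"]) (rule L2, simp)
  then have ae: "AE x in lborel. (\<lambda>k. v k x) \<longlonglongrightarrow> w x"
  proof eventually_elim
    case (elim x)
    show ?case
    proof (cases "norm x \<le> 1")
      case True
      then show ?thesis using elim by (simp add: w_def convergent_LIMSEQ_iff)
    next
      case False
      then show ?thesis using v by (simp add: w_def H0_def)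
    qed
  qed
  have dqlim: "AE p in plane. (\<lambda>k. bdq s \<gamma> (\<lambda>x. v (k + j) x - v j x) p) \<longlonglongrightarrow> bdq s \<gamma> (\<lambda>x. w x - v j x) p" for j
    using AE_plane[OF ae]
  proof eventually_elim
    case (elim p)
    then have "(\<lambda>k. v (k + j) (fst p)) \<longlonglongrightarrow> w (fst p)" "(\<lambda>k. v (k + j) (snd p)) \<longlonglongrightarrow> w (snd p)"
      by (auto intro: LIMSEQ_ignore_initial_segment)
    then show ?case unfolding bdq_def dq_def divide_inverse by (intro tendsto_intros)
  qed
  have bm: "bdq s \<gamma> (\<lambda>x. w x - v j x) \<in> borel_measurable plane" for j
    by (rule bdq_measurable[OF \<gamma>]) measurable
  have bsq: "sq_integrable plane (bdq s \<gamma> (\<lambda>x. v (k + j) x - v j x))" for j k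
    by (rule Hs_bdq[OF s \<gamma> H0_Hs[OF d]])
  have bb: "(\<integral>p. (bdq s \<gamma> (\<lambda>x. v (k + j) x - v j x) p)\<^sup>2 \<partial>plane) \<le> 4 * (1/8)^j" for j k
    using c[of j "k + j"] by (simp add: Bform_eq[OF s \<gamma>] power2_eq_square)
  have F: "sq_integrable plane (bdq s \<gamma> (\<lambda>x. w x - v j x))"
      "(\<integral>p. (bdq s \<gamma> (\<lambda>x. w x - v j x) p)\<^sup>2 \<partial>plane) \<le> 4 * (1/8)^j" for j
    using sq_integrable_Fatou[OF bsq bm dqlim bb] by blast+
  have wL0: "sq_integrable lborel (\<lambda>x. w x - v 0 x)"
  proof (rule sq_integrable_Fatou(1))
    show "sq_integrable lborel (\<lambda>x. v k x - v 0 x)" for k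
      using H0_Hs[OF d] by (auto simp: Hs_iff)
    show "AE x in lborel. (\<lambda>k. v k x - v 0 x) \<longlonglongrightarrow> w x - v 0 x"
      using ae by eventually_elim (intro tendsto_intros)
    show "(\<integral>x. (v k x - v 0 x)\<^sup>2 \<partial>lborel) \<le> P * 4 * (1/8)^0" for k by (rule L2) simp
  qed measurable
  have "sq_integrable plane (dq s (\<lambda>x. w x - v 0 x))"
    using F(1)[of 0] by (subst (asm) sq_integrable_bdq[OF s \<gamma>]) auto
  then have "(\<lambda>x. w x - v 0 x) \<in> Hs s" using wL0 by (simp add: Hs_iff)
  from Hs_lin[OF this H0_Hs[OF v[of 0]], of 1 1] have "w \<in> Hs s" by simp
  then have "w \<in> H0 s" by (simp add: H0_def w_def)
  moreover have "Bform s \<gamma> (\<lambda>x. w x - v j x) (\<lambda>x. w x - v j x) \<le> 4 * (1/8)^j" for j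
    using F(2)[of j] by (simp add: Bform_eq[OF s \<gamma>] power2_eq_square)
  ultimately show ?thesis by blast
qed

section \<open>Weak solutions with bounded right-hand side\<close>

definition load :: "'n::finite fn \<Rightarrow> 'n fn \<Rightarrow> 'n fn \<Rightarrow> real" where
  "load \<gamma> F \<phi> = (\<integral>x. sqrt (\<gamma> x) * F x * \<phi> x \<partial>lborel)"

lemma load_sq_integrable:
  assumes "adm \<gamma>" and [measurable]: "F \<in> borel_measurable borel" and b: "\<And>x. norm x \<le> 1 \<Longrightarrow> \<bar>F x\<bar> \<le> b"
  shows "sq_integrable lborel (\<lambda>x::real^'n::finite. indicator (cball 0 1) x * (sqrt (\<gamma> x) * F x))"
    and "(\<integral>x. (indicator (cball 0 1) x * (sqrt (\<gamma> x) * F x))\<^sup>2 \<partial>lborel) \<le> (2 * b)\<^sup>2 * measure lborel (cball (0::real^'n) 1)"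
proof -
  note adm_measurable[OF assms(1), measurable]
  have b0: "0 \<le> b" using b[of 0] by simp
  have le: "(indicator (cball 0 1) x * (sqrt (\<gamma> x) * F x))\<^sup>2 \<le> (2 * b)\<^sup>2 * indicator (cball 0 1) x" for x
  proof (cases "norm x \<le> 1")
    case True
    have "\<bar>sqrt (\<gamma> x) * F x\<bar> \<le> 2 * b"
      unfolding abs_mult using adm_sqrt[OF assms(1), of x] b[OF True] by (intro mult_mono) auto
    then have "(sqrt (\<gamma> x) * F x)\<^sup>2 \<le> (2 * b)\<^sup>2" using abs_le_square_iff b0 by (metis abs_of_nonneg mult_nonneg_nonneg zero_le_numeral)
    then show ?thesis using True by simp
  qed simp
  have iI: "integrable lborel (\<lambda>x. (2 * b)\<^sup>2 * indicator (cball (0::real^'n) 1) x)"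
    by (intro integrable_mult_right integrable_real_indicator) (auto intro!: emeasure_bounded_finite[unfolded infinity_ennreal_def])
  have "(\<lambda>x. sqrt (\<gamma> x) * F x) \<in> borel_measurable borel" by measurable
  then have m: "(\<lambda>x. indicator (cball 0 1) x * (sqrt (\<gamma> x) * F x)) \<in> borel_measurable lborel"
    by (intro borel_measurable_times borel_measurable_indicator) auto
  have i: "integrable lborel (\<lambda>x. (indicator (cball 0 1) x * (sqrt (\<gamma> x) * F x))\<^sup>2)"
    by (rule Bochner_Integration.integrable_bound[OF iI borel_measurable_power[OF m]])
      (use le in \<open>auto intro!: AE_I2\<close>)
  then show "sq_integrable lborel (\<lambda>x. indicator (cball 0 1) x * (sqrt (\<gamma> x) * F x))"
    using m by (simp only: sq_integrable_def)
  have "(\<integral>x. (indicator (cball 0 1) x * (sqrt (\<gamma> x) * F x))\<^sup>2 \<partial>lborel) \<le> (\<integral>x. (2 * b)\<^sup>2 * indicator (cball (0::real^'n) 1) x \<partial>lborel)"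
    by (rule integral_mono[OF i iI le])
  then show "(\<integral>x. (indicator (cball 0 1) x * (sqrt (\<gamma> x) * F x))\<^sup>2 \<partial>lborel) \<le> (2 * b)\<^sup>2 * measure lborel (cball (0::real^'n) 1)"
    by simp
qed

lemma load_eq:
  assumes "\<phi> \<in> H0 s"
  shows "sqrt (\<gamma> x) * F x * \<phi> x = indicator (cball 0 1) x * (sqrt (\<gamma> x) * F x) * \<phi> x"
  using assms by (auto simp: H0_def indicator_def)

lemma load_integrable:
  assumes "adm \<gamma>" "F \<in> borel_measurable borel" "\<And>x. norm x \<le> 1 \<Longrightarrow> \<bar>F x\<bar> \<le> b" "\<phi> \<in> H0 s"
  shows "integrable lborel (\<lambda>x. sqrt (\<gamma> x) * F x * \<phi> x)"
  unfolding load_eq[OF assms(4)]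
  by (rule sq_integrable_mult[OF load_sq_integrable(1)[OF assms(1-3)]]) (use assms(4) in \<open>auto simp: H0_def Hs_iff\<close>)

text \<open>Cauchy-Schwarz followed by the Poincare inequality. It matters that \<open>K\<close> is
  chosen before \<open>\<gamma>\<close>: all conductivities are compared with the same constant. The
  summand 1 in \<open>K\<close> only makes it positive.\<close>

lemma load_bound:
  assumes s: "0 < s" "s < 1"
  shows "\<exists>K>0. \<forall>\<gamma> F b \<phi>. adm \<gamma> \<longrightarrow> F \<in> borel_measurable borel \<longrightarrow> (\<forall>x. norm x \<le> 1 \<longrightarrow> \<bar>F x\<bar> \<le> b) \<longrightarrow>
    \<phi> \<in> H0 s \<longrightarrow> \<bar>load \<gamma> F (\<phi>::'n::finite fn)\<bar> \<le> K * b * sqrt (Bform s \<gamma> \<phi> \<phi>)"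
proof -
  obtain P where P: "0 < P" "\<And>\<gamma> v. adm \<gamma> \<Longrightarrow> v \<in> H0 s \<Longrightarrow> (\<integral>x. (v x)\<^sup>2 \<partial>lborel) \<le> P * Bform s \<gamma> v (v::'n fn)"
    using Poincare_Bform[OF s] by blast
  let ?\<mu> = "measure lborel (cball (0::real^'n) 1)"
  define K where "K = 2 * sqrt ?\<mu> * sqrt P + 1"
  have "\<bar>load \<gamma> F \<phi>\<bar> \<le> K * b * sqrt (Bform s \<gamma> \<phi> \<phi>)"
    if a: "adm \<gamma>" "F \<in> borel_measurable borel" "\<And>x. norm x \<le> 1 \<Longrightarrow> \<bar>F x\<bar> \<le> b" "\<phi> \<in> H0 s" for \<gamma> F \<phi> :: "'n fn" and b
  proof -
    have b0: "0 \<le> b" using a(3)[of 0] by simp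
    have "\<bar>load \<gamma> F \<phi>\<bar> \<le> sqrt (\<integral>x. (indicator (cball 0 1) x * (sqrt (\<gamma> x) * F x))\<^sup>2 \<partial>lborel) * sqrt (\<integral>x. (\<phi> x)\<^sup>2 \<partial>lborel)"
      unfolding load_def load_eq[OF a(4)]
      by (rule integral_Cauchy_Schwarz_abs[OF load_sq_integrable(1)[OF a(1-3)]]) (use a(4) in \<open>auto simp: H0_def Hs_iff\<close>)
    also have "\<dots> \<le> sqrt ((2 * b)\<^sup>2 * ?\<mu>) * sqrt (P * Bform s \<gamma> \<phi> \<phi>)"
      by (intro mult_mono real_sqrt_le_mono load_sq_integrable(2)[OF a(1-3)] P(2)[OF a(1,4)]) auto
    also have "\<dots> = 2 * sqrt ?\<mu> * sqrt P * (b * sqrt (Bform s \<gamma> \<phi> \<phi>))"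
      using b0 by (simp add: real_sqrt_mult)
    also have "\<dots> \<le> K * (b * sqrt (Bform s \<gamma> \<phi> \<phi>))"
      using b0 Bform_nonneg[OF s a(1)] by (intro mult_right_mono) (auto simp: K_def)
    finally show ?thesis by (simp add: mult.assoc)
  qed
  moreover have "0 < K" using P(1) by (auto simp: K_def intro!: add_nonneg_pos)
  ultimately show ?thesis by blast
qed

lemma load_lin_right:
  assumes "adm \<gamma>" "F \<in> borel_measurable borel" "\<And>x. norm x \<le> 1 \<Longrightarrow> \<bar>F x\<bar> \<le> b" "u \<in> H0 s" "v \<in> H0 s"
  shows "load \<gamma> F (\<lambda>x. a * u x + c * v x) = a * load \<gamma> F u + c * load \<gamma> F v"
proof -
  have "load \<gamma> F (\<lambda>x. a * u x + c * v x) = (\<integral>x. a * (sqrt (\<gamma> x) * F x * u x) + c * (sqrt (\<gamma> x) * F x * v x) \<partial>lborel)"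
    unfolding load_def by (simp add: algebra_simps)
  also have "\<dots> = a * load \<gamma> F u + c * load \<gamma> F v"
    using load_integrable[OF assms(1-3) assms(4)] load_integrable[OF assms(1-3) assms(5)] by (simp add: load_def)
  finally show ?thesis .
qed

lemma weak_solution_exists:
  fixes \<gamma> F :: "'n::finite fn"
  assumes s: "0 < s" "s < 1" and "adm \<gamma>" "F \<in> borel_measurable borel" "\<And>x. norm x \<le> 1 \<Longrightarrow> \<bar>F x\<bar> \<le> b"
  shows "\<exists>v\<in>H0 s. \<forall>\<phi>\<in>H0 s. Bform s \<gamma> v \<phi> = load \<gamma> F \<phi>"
proof -
  obtain K where K: "\<And>\<phi>. \<phi> \<in> H0 s \<Longrightarrow> \<bar>load \<gamma> F \<phi>\<bar> \<le> K * b * sqrt (Bform s \<gamma> \<phi> \<phi>)"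
    using load_bound[OF s] assms(3-5) by blast
  show ?thesis
  proof (rule Riesz_representation_seminorm[where K="K * b"])
    show "load \<gamma> F (\<lambda>x. a * u x + c * v x) = a * load \<gamma> F u + c * load \<gamma> F v"
      if "u \<in> H0 s" "v \<in> H0 s" for u v a c
      by (rule load_lin_right[OF assms(3-5) that])
    show "Bform s \<gamma> (\<lambda>x. a * u x + c * v x) w = a * Bform s \<gamma> u w + c * Bform s \<gamma> v w"
      if "u \<in> H0 s" "v \<in> H0 s" "w \<in> H0 s" for u v w a c
      using that by (intro Bform_lin[OF s assms(3)] H0_Hs)
  qed (fact zero_in_H0 H0_lin Bform_sym[OF s] Bform_nonneg[OF s assms(3)] K H0_complete[OF s assms(3)])+
qed

section \<open>Density of test functions\<close>

lemma nn_integral_lborel_affine: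
  fixes f :: "'a::euclidean_space \<Rightarrow> ennreal"
  assumes [measurable]: "f \<in> borel_measurable borel" and "c \<noteq> 0"
  shows "(\<integral>\<^sup>+x. f x \<partial>lborel) = ennreal (\<bar>c\<bar> ^ DIM('a)) * (\<integral>\<^sup>+x. f (t + c *\<^sub>R x) \<partial>lborel)"
  by (subst lborel_affine[OF assms(2), of t])
    (simp add: nn_integral_density nn_integral_distr nn_integral_cmult)

lemma integral_lborel_affine:
  fixes f :: "'a::euclidean_space \<Rightarrow> real"
  assumes [measurable]: "f \<in> borel_measurable borel" and "c \<noteq> 0"
  shows "(\<integral>x. f x \<partial>lborel) = \<bar>c\<bar> ^ DIM('a) * (\<integral>x. f (t + c *\<^sub>R x) \<partial>lborel)"
  by (subst lborel_affine[OF assms(2), of t])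
    (simp add: integral_density integral_distr)

lemma integrable_lborel_affine:
  fixes f :: "'a::euclidean_space \<Rightarrow> real"
  assumes "integrable lborel f" and "c \<noteq> 0"
  shows "integrable lborel (\<lambda>x. f (t + c *\<^sub>R x))"
proof -
  have [measurable]: "f \<in> borel_measurable borel" using assms(1) by auto
  have "ennreal (\<bar>c\<bar> ^ DIM('a)) * (\<integral>\<^sup>+x. ennreal (norm (f (t + c *\<^sub>R x))) \<partial>lborel) < \<infinity>"
    using assms(1) unfolding integrable_iff_bounded
    by (subst nn_integral_lborel_affine[OF _ assms(2), symmetric]) auto
  then have "(\<integral>\<^sup>+x. ennreal (norm (f (t + c *\<^sub>R x))) \<partial>lborel) < \<infinity>"
    using assms(2) by (auto simp: ennreal_mult_less_top ennreal_mult_eq_top_iff less_top)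
  then show ?thesis by (simp add: integrable_iff_bounded)
qed

lemma ennreal_mult_inverse_eq:
  assumes "E = ennreal K * I" "0 < K" shows "I = ennreal (inverse K) * E"
proof -
  have "ennreal (inverse K) * E = ennreal (inverse K * K) * I"
    unfolding assms(1) using assms(2) by (subst ennreal_mult) (auto simp: mult.assoc)
  then show ?thesis using assms(2) by simp
qed

text \<open>The variance under the probability density \<open>\<rho>\<close> is nonnegative. The
  right-hand side is an \<open>ennreal\<close> because the second moment may be infinite.\<close>

lemma Jensen_square:
  assumes \<rho>: "integrable M \<rho>" "\<And>w. 0 \<le> \<rho> w" "(\<integral>w. \<rho> w \<partial>M) = (1::real)"
    and [measurable]: "g \<in> borel_measurable M" and i: "integrable M (\<lambda>w. \<rho> w * g w)"
  shows "ennreal ((\<integral>w. \<rho> w * g w \<partial>M)\<^sup>2) \<le> (\<integral>\<^sup>+w. ennreal (\<rho> w * (g w)\<^sup>2) \<partial>M)"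
proof (cases "(\<integral>\<^sup>+w. ennreal (\<rho> w * (g w)\<^sup>2) \<partial>M) = \<infinity>")
  case False
  have [measurable]: "\<rho> \<in> borel_measurable M" using \<rho>(1) by auto
  have i2: "integrable M (\<lambda>w. \<rho> w * (g w)\<^sup>2)"
    by (rule integrableI_nonneg) (use False \<rho>(2) in \<open>auto simp: less_top\<close>)
  define m where "m = (\<integral>w. \<rho> w * g w \<partial>M)"
  have "0 \<le> (\<integral>w. \<rho> w * (g w - m)\<^sup>2 \<partial>M)" using \<rho>(2) by (intro Bochner_Integration.integral_nonneg) auto
  also have "\<dots> = (\<integral>w. \<rho> w * (g w)\<^sup>2 - (2 * m) * (\<rho> w * g w) + m\<^sup>2 * \<rho> w \<partial>M)"
    by (intro Bochner_Integration.integral_cong refl) (simp add: power2_eq_square algebra_simps)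
  also have "\<dots> = (\<integral>w. \<rho> w * (g w)\<^sup>2 \<partial>M) - 2 * m * m + m\<^sup>2 * 1"
    using i i2 \<rho>(1) by (simp add: m_def \<rho>(3))
  finally have "m\<^sup>2 \<le> (\<integral>w. \<rho> w * (g w)\<^sup>2 \<partial>M)" by (simp add: power2_eq_square)
  then show ?thesis using i2 \<rho>(2) by (simp add: m_def nn_integral_eq_integral)
qed simp

lemma H0_integrable:
  assumes "v \<in> H0 s" shows "integrable lborel v"
proof -
  have "sq_integrable lborel (indicator (cball (0::real^'a) 1))"
    by (auto simp: sq_integrable_def power2_eq_square intro!: borel_measurable_indicator
      integrable_real_indicator emeasure_bounded_finite[unfolded infinity_ennreal_def] simp flip: indicator_inter_arith)
  then have "integrable lborel (\<lambda>x. indicator (cball 0 1) x * v x)"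
    using assms by (intro sq_integrable_mult) (auto simp: H0_def Hs_iff)
  moreover have "(\<lambda>x. indicator (cball 0 1) x * v x) = v"
  proof
    fix x show "indicator (cball 0 1) x * v x = v x"
      using assms by (cases "norm x \<le> 1") (auto simp: H0_def)
  qed
  ultimately show ?thesis by simp
qed

text \<open>The dilation by \<open>1 + 2t\<close> makes room for the convolution at scale \<open>t\<close>, so that the support of the
  result stays inside the open unit ball.\<close>

definition mollify :: "'n::finite fn \<Rightarrow> real \<Rightarrow> 'n fn \<Rightarrow> 'n fn" where
  "mollify \<rho> t v x = (\<integral>w. \<rho> w * v ((1 + 2 * t) *\<^sub>R x - t *\<^sub>R w) \<partial>lborel)"

lemma dq_affine:
  fixes v :: "'n::finite fn"
  assumes "0 < c"
  shows "(v (a + c *\<^sub>R x) - v (a + c *\<^sub>R y)) / norm (x - y) powr ((real CARD('n) + 2 * s) / 2)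
    = c powr ((real CARD('n) + 2 * s) / 2) * dq s v ((a, a) + c *\<^sub>R (x, y))"
proof -
  have "norm (a + c *\<^sub>R x - (a + c *\<^sub>R y)) = c * norm (x - y)"
    using assms by (simp flip: scaleR_right_diff_distrib)
  then show ?thesis using assms by (simp add: dq_def powr_mult)
qed

lemma sq_diff_eq_dq:
  fixes v :: "'n::finite fn"
  shows "(v x - v y)\<^sup>2 = norm (x - y) powr (real CARD('n) + 2 * s) * (dq s v (x, y))\<^sup>2"
proof (cases "x = y")
  case False
  have "(norm (x - y) powr ((real CARD('n) + 2 * s) / 2))\<^sup>2 = norm (x - y) powr (real CARD('n) + 2 * s)"
    by (simp add: power2_eq_square flip: powr_add)
  then show ?thesis using False by (simp add: dq_def power_divide)
qed simp

locale mollifier =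
  fixes \<rho> :: "'n::finite fn" and R s :: real and v :: "'n fn"
  assumes \<rho>m [measurable]: "\<rho> \<in> borel_measurable borel" and \<rho>0: "\<And>w. 0 \<le> \<rho> w" and \<rho>R: "\<And>w. \<rho> w \<le> R"
    and \<rho>supp: "\<And>w. 1 < norm w \<Longrightarrow> \<rho> w = 0" and \<rho>i: "integrable lborel \<rho>" and \<rho>1: "(\<integral>w. \<rho> w \<partial>lborel) = 1"
    and s: "0 < s" "2 * s < real CARD('n)" and v: "v \<in> H0 s"
begin

lemma vm [measurable]: "v \<in> borel_measurable borel" using v by (auto simp: H0_def Hs_iff)

definition E where "E = (\<integral>\<^sup>+p. ennreal ((dq s v p)\<^sup>2) \<partial>plane)"

lemma E_eq: "E = ennreal (\<integral>p. (dq s v p)\<^sup>2 \<partial>plane)"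
  unfolding E_def using v by (intro nn_integral_eq_integral) (auto simp: H0_def Hs_iff sq_integrable_def)

lemma integrable_shift:
  assumes "t \<noteq> 0"
  shows "integrable lborel (\<lambda>w. \<rho> w * v (a - t *\<^sub>R w))"
proof (rule Bochner_Integration.integrable_bound)
  show "integrable lborel (\<lambda>w. R * v (a - t *\<^sub>R w))"
    using integrable_lborel_affine[OF H0_integrable[OF v], of "- t" a] assms by simp
  show "AE w in lborel. norm (\<rho> w * v (a - t *\<^sub>R w)) \<le> norm (R * v (a - t *\<^sub>R w))"
  proof (intro AE_I2)
    fix w
    have "\<bar>\<rho> w\<bar> \<le> \<bar>R\<bar>" using \<rho>0[of w] \<rho>R[of w] by linarith
    then show "norm (\<rho> w * v (a - t *\<^sub>R w)) \<le> norm (R * v (a - t *\<^sub>R w))"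
      by (simp add: abs_mult mult_right_mono)
  qed
qed measurable

lemma mollify_measurable [measurable]: "mollify \<rho> t v \<in> borel_measurable borel"
  unfolding mollify_def by measurable

lemma mollify_support:
  assumes "0 < t" "(1 + t) / (1 + 2 * t) < norm x" shows "mollify \<rho> t v x = 0"
proof -
  have "\<rho> w * v ((1 + 2 * t) *\<^sub>R x - t *\<^sub>R w) = 0" for w
  proof (cases "norm w \<le> 1")
    case True
    have "1 + t < (1 + 2 * t) * norm x" using assms by (simp add: divide_less_eq mult.commute)
    also have "\<dots> = norm ((1 + 2 * t) *\<^sub>R x)" using assms by simp
    also have "\<dots> \<le> norm ((1 + 2 * t) *\<^sub>R x - t *\<^sub>R w) + norm (t *\<^sub>R w)" by (metis diff_add_cancel norm_triangle_ineq)
    also have "norm (t *\<^sub>R w) \<le> t" using True assms(1) by (simp add: mult_le_cancel_left1)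
    finally have "1 < norm ((1 + 2 * t) *\<^sub>R x - t *\<^sub>R w)" by simp
    then show ?thesis using v by (simp add: H0_def)
  qed (simp add: \<rho>supp)
  then show ?thesis unfolding mollify_def by (simp only: integral_zero)
qed

text \<open>Jensen's inequality in w, Tonelli, and then the same affine map applied to both points
  of the pair: the energy is multiplied by c^(q-2n). A bound by \<open>E\<close> itself, without a
  constant, is required because \<open>sq_integrable_strong_limit\<close> needs norms that do not
  exceed that of the limit.\<close>

lemma mollify_energy:
  assumes t: "0 < t"
  shows "(\<integral>\<^sup>+p. ennreal ((dq s (mollify \<rho> t v) p)\<^sup>2) \<partial>plane) \<le> E"
proof -
  define q where "q = real CARD('n) + 2 * s"
  define c where "c = 1 + 2 * t"
  have c: "1 < c" "0 < c" using t by (auto simp: c_def)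
  have pt: "ennreal ((dq s (mollify \<rho> t v) p)\<^sup>2) \<le> (\<integral>\<^sup>+w. ennreal (\<rho> w * c powr q * (dq s v ((- t *\<^sub>R w, - t *\<^sub>R w) + c *\<^sub>R p))\<^sup>2) \<partial>lborel)" for p
  proof -
    obtain x y where p: "p = (x, y)" by force
    define d where "d = norm (x - y) powr (q / 2)"
    define g where "g w = (v (c *\<^sub>R x - t *\<^sub>R w) - v (c *\<^sub>R y - t *\<^sub>R w)) / d" for w
    have [measurable]: "g \<in> borel_measurable borel" unfolding g_def by measurable
    have i: "integrable lborel (\<lambda>w. \<rho> w * v (c *\<^sub>R x - t *\<^sub>R w))" "integrable lborel (\<lambda>w. \<rho> w * v (c *\<^sub>R y - t *\<^sub>R w))"
      using t by (auto intro: integrable_shift)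
    have "dq s (mollify \<rho> t v) p = ((\<integral>w. \<rho> w * v (c *\<^sub>R x - t *\<^sub>R w) \<partial>lborel) - (\<integral>w. \<rho> w * v (c *\<^sub>R y - t *\<^sub>R w) \<partial>lborel)) / d"
      by (simp add: dq_def p mollify_def d_def q_def c_def)
    also have "\<dots> = (\<integral>w. (\<rho> w * v (c *\<^sub>R x - t *\<^sub>R w) - \<rho> w * v (c *\<^sub>R y - t *\<^sub>R w)) / d \<partial>lborel)"
      using i by simp
    also have "\<dots> = (\<integral>w. \<rho> w * g w \<partial>lborel)"
      by (intro Bochner_Integration.integral_cong refl) (simp add: g_def diff_divide_distrib right_diff_distrib)
    finally have D: "dq s (mollify \<rho> t v) p = (\<integral>w. \<rho> w * g w \<partial>lborel)" .
    have "integrable lborel (\<lambda>w. (\<rho> w * v (c *\<^sub>R x - t *\<^sub>R w) - \<rho> w * v (c *\<^sub>R y - t *\<^sub>R w)) / d)"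
      using i by (intro integrable_divide Bochner_Integration.integrable_diff) auto
    then have "integrable lborel (\<lambda>w. \<rho> w * g w)"
      by (simp add: g_def diff_divide_distrib right_diff_distrib)
    then have "ennreal ((dq s (mollify \<rho> t v) p)\<^sup>2) \<le> (\<integral>\<^sup>+w. ennreal (\<rho> w * (g w)\<^sup>2) \<partial>lborel)"
      unfolding D by (intro Jensen_square) (use \<rho>i \<rho>0 \<rho>1 in auto)
    also have "\<dots> = (\<integral>\<^sup>+w. ennreal (\<rho> w * c powr q * (dq s v ((- t *\<^sub>R w, - t *\<^sub>R w) + c *\<^sub>R p))\<^sup>2) \<partial>lborel)"
    proof (intro nn_integral_cong arg_cong[where f=ennreal])
      fix w
      have "g w = c powr (q / 2) * dq s v ((- t *\<^sub>R w, - t *\<^sub>R w) + c *\<^sub>R p)"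
        using dq_affine[OF c(2), of v "- t *\<^sub>R w" x y s] by (simp add: g_def d_def q_def p add.commute[of _ "c *\<^sub>R _"])
      moreover have "(c powr (q / 2))\<^sup>2 = c powr q" by (simp add: power2_eq_square flip: powr_add)
      ultimately show "\<rho> w * (g w)\<^sup>2 = \<rho> w * c powr q * (dq s v ((- t *\<^sub>R w, - t *\<^sub>R w) + c *\<^sub>R p))\<^sup>2"
        by (simp add: power_mult_distrib)
    qed
    finally show ?thesis .
  qed
  have dqb [measurable]: "dq s v \<in> borel_measurable borel"
    using dq_measurable[OF vm, of s] by (simp add: lborel_prod)
  have "(\<integral>\<^sup>+p. ennreal ((dq s (mollify \<rho> t v) p)\<^sup>2) \<partial>plane) \<le>
    (\<integral>\<^sup>+p. \<integral>\<^sup>+w. ennreal (\<rho> w * c powr q * (dq s v ((- t *\<^sub>R w, - t *\<^sub>R w) + c *\<^sub>R p))\<^sup>2) \<partial>lborel \<partial>lborel)"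
    unfolding lborel_prod by (intro nn_integral_mono pt)
  also have "\<dots> = (\<integral>\<^sup>+w. \<integral>\<^sup>+p. ennreal (\<rho> w * c powr q * (dq s v ((- t *\<^sub>R w, - t *\<^sub>R w) + c *\<^sub>R p))\<^sup>2) \<partial>lborel \<partial>lborel)"
    by (rule lborel_pair.Fubini') measurable
  also have "\<dots> = (\<integral>\<^sup>+w. ennreal (\<rho> w) * (ennreal (c powr q) * (ennreal (inverse (c ^ (2 * CARD('n)))) * E)) \<partial>lborel)"
  proof (intro nn_integral_cong)
    fix w
    have "E = ennreal (c ^ (2 * CARD('n))) * (\<integral>\<^sup>+p. ennreal ((dq s v ((- t *\<^sub>R w, - t *\<^sub>R w) + c *\<^sub>R p))\<^sup>2) \<partial>lborel)"
      unfolding E_def lborel_prod using c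
      by (subst nn_integral_lborel_affine[where c=c and t="(- t *\<^sub>R w, - t *\<^sub>R w)"]) (auto simp: mult_2)
    then have e: "(\<integral>\<^sup>+p. ennreal ((dq s v ((- t *\<^sub>R w, - t *\<^sub>R w) + c *\<^sub>R p))\<^sup>2) \<partial>lborel) = ennreal (inverse (c ^ (2 * CARD('n)))) * E"
      using c by (intro ennreal_mult_inverse_eq) auto
    have "(\<integral>\<^sup>+p. ennreal (\<rho> w * c powr q * (dq s v ((- t *\<^sub>R w, - t *\<^sub>R w) + c *\<^sub>R p))\<^sup>2) \<partial>lborel)
       = ennreal (\<rho> w) * (ennreal (c powr q) * (\<integral>\<^sup>+p. ennreal ((dq s v ((- t *\<^sub>R w, - t *\<^sub>R w) + c *\<^sub>R p))\<^sup>2) \<partial>lborel))"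
      using \<rho>0 by (simp add: ennreal_mult nn_integral_cmult mult.assoc)
    then show "(\<integral>\<^sup>+p. ennreal (\<rho> w * c powr q * (dq s v ((- t *\<^sub>R w, - t *\<^sub>R w) + c *\<^sub>R p))\<^sup>2) \<partial>lborel)
      = ennreal (\<rho> w) * (ennreal (c powr q) * (ennreal (inverse (c ^ (2 * CARD('n)))) * E))"
      unfolding e .
  qed
  also have "\<dots> = (\<integral>\<^sup>+w. ennreal (\<rho> w) \<partial>lborel) * (ennreal (c powr q) * (ennreal (inverse (c ^ (2 * CARD('n)))) * E))"
    by (rule nn_integral_multc) measurable
  also have "(\<integral>\<^sup>+w. ennreal (\<rho> w) \<partial>lborel) = 1"
    using \<rho>i \<rho>0 \<rho>1 by (simp add: nn_integral_eq_integral)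
  also have "1 * (ennreal (c powr q) * (ennreal (inverse (c ^ (2 * CARD('n)))) * E)) = ennreal (c powr q * inverse (c ^ (2 * CARD('n)))) * E"
    using c by (simp add: ennreal_mult mult.assoc)
  also have "\<dots> \<le> ennreal 1 * E"
  proof (intro mult_right_mono ennreal_leI)
    \<comment> \<open>The kernel contributes c^(n+2s) and the Jacobian of the dilation in both
      variables c^(-2n); here 2s < n is used.\<close>
    have "c powr q \<le> c powr real (2 * CARD('n))" using c s by (intro powr_mono) (auto simp: q_def)
    also have "\<dots> = c ^ (2 * CARD('n))" using c by (rule_tac powr_realpow)
    finally show "c powr q * inverse (c ^ (2 * CARD('n))) \<le> 1" using c by (simp add: field_simps)
  qed simp
  finally show ?thesis by simp
qed

text \<open>No density of continuous functions is needed: finiteness of the Gagliardo seminorm already gives the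
  rate \<open>t\<^bsup>2s\<^esup>\<close>.\<close>

lemma mollify_L2:
  assumes t: "0 < t"
  shows "(\<integral>\<^sup>+x. ennreal ((mollify \<rho> t v x - v x)\<^sup>2) \<partial>lborel) \<le> ennreal (R * 3 powr (real CARD('n) + 2 * s) * t powr (2 * s)) * E"
proof -
  define q where "q = real CARD('n) + 2 * s"
  define c where "c = 1 + 2 * t"
  have c: "1 < c" "0 < c" using t by (auto simp: c_def)
  have R0: "0 \<le> R" using \<rho>0[of 0] \<rho>R[of 0] by simp
  have dqb [measurable]: "dq s v \<in> borel_measurable borel"
    using dq_measurable[OF vm, of s] by (simp add: lborel_prod)
  have pt: "ennreal ((mollify \<rho> t v x - v x)\<^sup>2) \<le> (\<integral>\<^sup>+w. ennreal (R * (3 * t) powr q * (dq s v (x, c *\<^sub>R x + (- t) *\<^sub>R w))\<^sup>2) \<partial>lborel)" for x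
  proof (cases "norm x \<le> 1")
    case False
    have "(1 + t) / (1 + 2 * t) < 1" using t by simp
    then have "(1 + t) / (1 + 2 * t) < norm x" using False by linarith
    then have "mollify \<rho> t v x = 0" by (rule mollify_support[OF t])
    then show ?thesis using False v by (simp add: H0_def)
  next
    case True
    have i: "integrable lborel (\<lambda>w. \<rho> w * v (c *\<^sub>R x - t *\<^sub>R w))" using t by (auto intro: integrable_shift)
    have "mollify \<rho> t v x - v x = (\<integral>w. \<rho> w * v (c *\<^sub>R x - t *\<^sub>R w) \<partial>lborel) - (\<integral>w. \<rho> w * v x \<partial>lborel)"
      using \<rho>1 by (simp add: mollify_def c_def)
    also have "\<dots> = (\<integral>w. \<rho> w * (v (c *\<^sub>R x - t *\<^sub>R w) - v x) \<partial>lborel)"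
      using i \<rho>i by (simp add: right_diff_distrib)
    finally have D: "mollify \<rho> t v x - v x = (\<integral>w. \<rho> w * (v (c *\<^sub>R x - t *\<^sub>R w) - v x) \<partial>lborel)" .
    have "ennreal ((mollify \<rho> t v x - v x)\<^sup>2) \<le> (\<integral>\<^sup>+w. ennreal (\<rho> w * (v (c *\<^sub>R x - t *\<^sub>R w) - v x)\<^sup>2) \<partial>lborel)"
      unfolding D using i \<rho>i \<rho>0 \<rho>1 by (intro Jensen_square) (auto simp: right_diff_distrib)
    also have "\<dots> \<le> (\<integral>\<^sup>+w. ennreal (R * (3 * t) powr q * (dq s v (x, c *\<^sub>R x + (- t) *\<^sub>R w))\<^sup>2) \<partial>lborel)"
    proof (intro nn_integral_mono ennreal_leI)
      fix w
      show "\<rho> w * (v (c *\<^sub>R x - t *\<^sub>R w) - v x)\<^sup>2 \<le> R * (3 * t) powr q * (dq s v (x, c *\<^sub>R x + (- t) *\<^sub>R w))\<^sup>2"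
      proof (cases "norm w \<le> 1")
        case w: True
        let ?y = "c *\<^sub>R x - t *\<^sub>R w"
        \<comment> \<open>The distance 3t is made up of t from the convolution and 2t from the
          dilation.\<close>
        have "x - ?y = t *\<^sub>R w - (2 * t) *\<^sub>R x" by (simp add: c_def algebra_simps)
        then have "norm (x - ?y) \<le> norm (t *\<^sub>R w) + norm ((2 * t) *\<^sub>R x)"
          by (simp only: norm_triangle_ineq4)
        moreover have "norm (t *\<^sub>R w) \<le> t" "norm ((2 * t) *\<^sub>R x) \<le> 2 * t"
          using t w True by (simp_all add: mult_left_le)
        ultimately have "norm (x - ?y) \<le> 3 * t" by linarith
        then have "norm (x - ?y) powr q \<le> (3 * t) powr q" using s by (intro powr_mono2) (auto simp: q_def)
        then have "(v ?y - v x)\<^sup>2 \<le> (3 * t) powr q * (dq s v (x, ?y))\<^sup>2"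
          using sq_diff_eq_dq[of v x ?y s] by (simp add: power2_commute[of "v x"] q_def mult_right_mono)
        then have "\<rho> w * (v ?y - v x)\<^sup>2 \<le> R * ((3 * t) powr q * (dq s v (x, ?y))\<^sup>2)"
          using \<rho>0 \<rho>R R0 by (intro mult_mono) auto
        then show ?thesis by (simp add: mult.assoc)
      qed (use R0 in \<open>simp add: \<rho>supp\<close>)
    qed
    finally show ?thesis .
  qed
  have "(\<integral>\<^sup>+x. ennreal ((mollify \<rho> t v x - v x)\<^sup>2) \<partial>lborel) 
    \<le> (\<integral>\<^sup>+x. \<integral>\<^sup>+w. ennreal (R * (3 * t) powr q * (dq s v (x, c *\<^sub>R x + (- t) *\<^sub>R w))\<^sup>2) \<partial>lborel \<partial>lborel)"
    by (intro nn_integral_mono pt)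
  also have "\<dots> = (\<integral>\<^sup>+x. ennreal (R * (3 * t) powr q * inverse (t ^ CARD('n))) * (\<integral>\<^sup>+y. ennreal ((dq s v (x, y))\<^sup>2) \<partial>lborel) \<partial>lborel)"
  proof (intro nn_integral_cong)
    fix x
    have "(\<integral>\<^sup>+y. ennreal ((dq s v (x, y))\<^sup>2) \<partial>lborel) = ennreal (t ^ CARD('n)) * (\<integral>\<^sup>+w. ennreal ((dq s v (x, c *\<^sub>R x + (- t) *\<^sub>R w))\<^sup>2) \<partial>lborel)"
      using t by (subst nn_integral_lborel_affine[where c="- t" and t="c *\<^sub>R x"]) auto
    then have e: "(\<integral>\<^sup>+w. ennreal ((dq s v (x, c *\<^sub>R x + (- t) *\<^sub>R w))\<^sup>2) \<partial>lborel)
       = ennreal (inverse (t ^ CARD('n))) * (\<integral>\<^sup>+y. ennreal ((dq s v (x, y))\<^sup>2) \<partial>lborel)"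
      using t by (intro ennreal_mult_inverse_eq) auto
    have "(\<integral>\<^sup>+w. ennreal (R * (3 * t) powr q * (dq s v (x, c *\<^sub>R x + (- t) *\<^sub>R w))\<^sup>2) \<partial>lborel)
       = ennreal (R * (3 * t) powr q) * (\<integral>\<^sup>+w. ennreal ((dq s v (x, c *\<^sub>R x + (- t) *\<^sub>R w))\<^sup>2) \<partial>lborel)"
      using R0 by (subst nn_integral_cmult[symmetric]) (auto simp: ennreal_mult)
    also have "\<dots> = ennreal (R * (3 * t) powr q) * ennreal (inverse (t ^ CARD('n))) * (\<integral>\<^sup>+y. ennreal ((dq s v (x, y))\<^sup>2) \<partial>lborel)"
      unfolding e by (simp add: mult.assoc)
    also have "ennreal (R * (3 * t) powr q) * ennreal (inverse (t ^ CARD('n))) = ennreal (R * (3 * t) powr q * inverse (t ^ CARD('n)))"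
      using t R0 by (intro ennreal_mult[symmetric]) auto
    finally show "(\<integral>\<^sup>+w. ennreal (R * (3 * t) powr q * (dq s v (x, c *\<^sub>R x + (- t) *\<^sub>R w))\<^sup>2) \<partial>lborel)
       = ennreal (R * (3 * t) powr q * inverse (t ^ CARD('n))) * (\<integral>\<^sup>+y. ennreal ((dq s v (x, y))\<^sup>2) \<partial>lborel)"
      .
  qed
  also have "\<dots> = ennreal (R * (3 * t) powr q * inverse (t ^ CARD('n))) * E"
    unfolding E_def
    by (subst nn_integral_cmult, simp) (subst lborel.nn_integral_fst, auto)
  \<comment> \<open>The power t^(n+2s) from the kernel loses t^n to the Jacobian of y = c x - t
    w.\<close>
  also have "R * (3 * t) powr q * inverse (t ^ CARD('n)) = R * 3 powr q * t powr (2 * s)"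
    using t by (simp add: powr_mult q_def powr_add powr_realpow field_simps)
  finally show ?thesis by (simp add: q_def)
qed

end

section \<open>Smoothness of the mollified functions\<close>

definition psi_conv :: "('n::finite \<Rightarrow> nat) \<Rightarrow> real \<Rightarrow> real \<Rightarrow> 'n fn \<Rightarrow> 'n fn" where
  "psi_conv \<kappa> a b v x = (\<integral>y. psi \<kappa> (a *\<^sub>R x - b *\<^sub>R y) * v y \<partial>lborel)"

lemma psi_Lipschitz:
  obtains L where "0 < L" "\<And>x. \<bar>psi \<kappa> x\<bar> \<le> L" "\<And>x y. \<bar>psi \<kappa> x - psi \<kappa> (y::real^'n::finite)\<bar> \<le> L * dist x y"
proof -
  obtain A where A: "1 \<le> A" "\<And>k t. k \<le> Suc (Max (range \<kappa>)) \<Longrightarrow> \<bar>dbump k t\<bar> \<le> A"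
    using dbump_bounded by blast
  have \<kappa>: "\<kappa> i \<le> Max (range \<kappa>)" for i by (rule Max_ge) auto
  note b = psi_bounds[where \<kappa>=\<kappa>, OF A \<kappa>]
  have An: "1 \<le> A ^ CARD('n)" using A(1) by (rule one_le_power)
  have n: "1 \<le> real CARD('n)" by (simp add: Suc_leI)
  have "\<bar>psi \<kappa> x\<bar> \<le> A ^ CARD('n) * real CARD('n)" for x :: "real^'n"
    using b(1)[where x=x] mult_left_mono[OF n, of "A ^ CARD('n)"] An by linarith
  moreover have "0 < A ^ CARD('n) * real CARD('n)" using An n by simp
  ultimately show ?thesis using that[of "A ^ CARD('n) * real CARD('n)"] b(2) by blast
qed

lemma psi_measurable [measurable]: "psi \<kappa> \<in> borel_measurable borel"
  by (rule borel_measurable_continuous_onI) (rule continuous_psi)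

lemma psi_conv_integrable:
  assumes "integrable lborel v"
  shows "integrable lborel (\<lambda>y. psi \<kappa> (a *\<^sub>R x - b *\<^sub>R y) * v (y::real^'n::finite))"
proof -
  have [measurable]: "v \<in> borel_measurable borel" using assms by auto
  obtain L where L: "0 < L" "\<And>x. \<bar>psi \<kappa> (x::real^'n)\<bar> \<le> L" using psi_Lipschitz by metis
  show ?thesis
  proof (rule Bochner_Integration.integrable_bound)
    show "integrable lborel (\<lambda>y. L * v y)" using assms by simp
    show "AE y in lborel. norm (psi \<kappa> (a *\<^sub>R x - b *\<^sub>R y) * v y) \<le> norm (L * v y)"
      using L by (intro AE_I2) (auto simp: abs_mult intro!: mult_right_mono)
  qed measurable
qed

lemma psi_conv_continuous:
  assumes "integrable lborel v"
  shows "continuous_on UNIV (psi_conv \<kappa> a b (v::'n::finite fn))"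
proof -
  obtain L where L: "0 < L" "\<And>x y. \<bar>psi \<kappa> x - psi \<kappa> (y::real^'n)\<bar> \<le> L * dist x y" using psi_Lipschitz by metis
  have "dist (psi_conv \<kappa> a b v x) (psi_conv \<kappa> a b v x') \<le> (L * \<bar>a\<bar> * (\<integral>y. \<bar>v y\<bar> \<partial>lborel)) * dist x x'" for x x'
  proof -
    note i = psi_conv_integrable[OF assms, of \<kappa> a _ b]
    have "\<bar>psi_conv \<kappa> a b v x - psi_conv \<kappa> a b v x'\<bar>
      = \<bar>\<integral>y. (psi \<kappa> (a *\<^sub>R x - b *\<^sub>R y) - psi \<kappa> (a *\<^sub>R x' - b *\<^sub>R y)) * v y \<partial>lborel\<bar>"
      unfolding psi_conv_def using i[of x] i[of x'] by (simp add: left_diff_distrib)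
    also have "\<dots> \<le> (\<integral>y. L * \<bar>a\<bar> * dist x x' * \<bar>v y\<bar> \<partial>lborel)"
      unfolding real_norm_def[symmetric]
    proof (rule Bochner_Integration.integral_norm_bound_integral)
      show "integrable lborel (\<lambda>y. (psi \<kappa> (a *\<^sub>R x - b *\<^sub>R y) - psi \<kappa> (a *\<^sub>R x' - b *\<^sub>R y)) * v y)"
        using i[of x] i[of x'] by (simp add: left_diff_distrib)
      fix y
      have "\<bar>psi \<kappa> (a *\<^sub>R x - b *\<^sub>R y) - psi \<kappa> (a *\<^sub>R x' - b *\<^sub>R y)\<bar> \<le> L * dist (a *\<^sub>R x - b *\<^sub>R y) (a *\<^sub>R x' - b *\<^sub>R y)" by (rule L)
      also have "dist (a *\<^sub>R x - b *\<^sub>R y) (a *\<^sub>R x' - b *\<^sub>R y) = \<bar>a\<bar> * dist x x'"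
        by (simp add: dist_norm flip: scaleR_right_diff_distrib)
      finally show "norm ((psi \<kappa> (a *\<^sub>R x - b *\<^sub>R y) - psi \<kappa> (a *\<^sub>R x' - b *\<^sub>R y)) * v y) \<le> L * norm a * dist x x' * norm (v y)"
        using mult_right_mono[of "\<bar>psi \<kappa> (a *\<^sub>R x - b *\<^sub>R y) - psi \<kappa> (a *\<^sub>R x' - b *\<^sub>R y)\<bar>" "L * (\<bar>a\<bar> * dist x x')" "\<bar>v y\<bar>"]
        by (simp add: abs_mult mult.assoc)
    qed (use assms in auto)
    finally show ?thesis by (simp add: dist_real_def mult_ac)
  qed
  then have "(L * \<bar>a\<bar> * (\<integral>y. \<bar>v y\<bar> \<partial>lborel))-lipschitz_on UNIV (psi_conv \<kappa> a b v)"
    using L(1) by (intro lipschitz_onI) auto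
  then show ?thesis by (rule lipschitz_on_continuous_on)
qed

text \<open>Differentiation under the integral: the Lipschitz constant of \<open>psi\<close>
  dominates the difference quotients by L |a| |v|, which is integrable.\<close>

lemma psi_conv_DERIV:
  assumes "integrable lborel v"
  shows "((\<lambda>h. psi_conv \<kappa> a b v (x + h *\<^sub>R axis i 1)) has_real_derivative 
     a * psi_conv (\<kappa>(i := Suc (\<kappa> i))) a b (v::'n::finite fn) x) (at 0)"
  unfolding DERIV_def LIMSEQ_SEQ_conv[symmetric]
proof (intro allI impI, elim conjE)
  fix h :: "nat \<Rightarrow> real" assume h0: "\<forall>k. h k \<noteq> 0" and h: "h \<longlonglongrightarrow> 0"
  have [measurable]: "v \<in> borel_measurable borel" using assms by auto
  obtain L where L: "0 < L" "\<And>x y. \<bar>psi \<kappa> x - psi \<kappa> (y::real^'n)\<bar> \<le> L * dist x y" using psi_Lipschitz by metis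
  let ?e = "axis i 1 :: real^'n"
  let ?\<kappa>' = "\<kappa>(i := Suc (\<kappa> i))"
  define z where "z y = a *\<^sub>R x - b *\<^sub>R y" for y
  define f where "f k y = (psi \<kappa> (z y + (a * h k) *\<^sub>R ?e) - psi \<kappa> (z y)) / h k * v y" for k y
  have zeq: "a *\<^sub>R (x + h k *\<^sub>R ?e) - b *\<^sub>R y = z y + (a * h k) *\<^sub>R ?e" for k y
    by (simp add: z_def algebra_simps)
  note i0 = psi_conv_integrable[OF assms, of \<kappa> a _ b]
  have q: "(psi_conv \<kappa> a b v (x + (0 + h k) *\<^sub>R ?e) - psi_conv \<kappa> a b v (x + 0 *\<^sub>R ?e)) / h k = (\<integral>y. f k y \<partial>lborel)" for k
  proof -
    have "(psi_conv \<kappa> a b v (x + h k *\<^sub>R ?e) - psi_conv \<kappa> a b v x) / h k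
       = (\<integral>y. (psi \<kappa> (z y + (a * h k) *\<^sub>R ?e) * v y - psi \<kappa> (z y) * v y) / h k \<partial>lborel)"
      unfolding psi_conv_def using i0[of "x + h k *\<^sub>R ?e"] i0[of x] unfolding zeq by (simp add: z_def)
    also have "\<dots> = (\<integral>y. f k y \<partial>lborel)"
      by (intro Bochner_Integration.integral_cong refl) (simp add: f_def diff_divide_distrib left_diff_distrib)
    finally show ?thesis by simp
  qed
  have "(\<lambda>k. \<integral>y. f k y \<partial>lborel) \<longlonglongrightarrow> (\<integral>y. a * (psi ?\<kappa>' (z y) * v y) \<partial>lborel)"
  proof (rule integral_dominated_convergence[where w="\<lambda>y. L * \<bar>a\<bar> * \<bar>v y\<bar>"])
    show "(\<lambda>y. a * (psi ?\<kappa>' (z y) * v y)) \<in> borel_measurable lborel" unfolding z_def by measurable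
    show "f k \<in> borel_measurable lborel" for k unfolding f_def z_def by measurable
    show "integrable lborel (\<lambda>y. L * \<bar>a\<bar> * \<bar>v y\<bar>)" using assms by auto
    show "AE y in lborel. (\<lambda>k. f k y) \<longlonglongrightarrow> a * (psi ?\<kappa>' (z y) * v y)"
    proof (intro AE_I2)
      fix y
      have "((\<lambda>h. psi \<kappa> (z y + (a * h) *\<^sub>R ?e)) has_real_derivative psi ?\<kappa>' (z y) * a) (at 0)"
        by (rule DERIV_chain2[where f="\<lambda>t. psi \<kappa> (z y + t *\<^sub>R ?e)"]) 
          (use psi_DERIV[of \<kappa> "z y" i] in \<open>auto intro!: derivative_eq_intros\<close>)
      then have "(\<lambda>k. (psi \<kappa> (z y + (a * (0 + h k)) *\<^sub>R ?e) - psi \<kappa> (z y + (a * 0) *\<^sub>R ?e)) / h k) \<longlonglongrightarrow> psi ?\<kappa>' (z y) * a"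
        unfolding DERIV_def LIMSEQ_SEQ_conv[symmetric] using h h0 by blast
      from tendsto_mult_right[OF this, of "v y"]
      show "(\<lambda>k. f k y) \<longlonglongrightarrow> a * (psi ?\<kappa>' (z y) * v y)" by (simp add: f_def mult_ac)
    qed
    show "AE y in lborel. norm (f k y) \<le> L * \<bar>a\<bar> * \<bar>v y\<bar>" for k
    proof (intro AE_I2)
      fix y
      have "\<bar>psi \<kappa> (z y + (a * h k) *\<^sub>R ?e) - psi \<kappa> (z y)\<bar> \<le> L * dist (z y + (a * h k) *\<^sub>R ?e) (z y)" by (rule L)
      also have "\<dots> = L * \<bar>a\<bar> * \<bar>h k\<bar>" by (simp add: dist_norm norm_axis_1 abs_mult)
      finally have "\<bar>psi \<kappa> (z y + (a * h k) *\<^sub>R ?e) - psi \<kappa> (z y)\<bar> / \<bar>h k\<bar> \<le> L * \<bar>a\<bar>"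
        using h0 by (simp add: divide_le_eq)
      then show "norm (f k y) \<le> L * \<bar>a\<bar> * \<bar>v y\<bar>" 
        using mult_right_mono[of "\<bar>psi \<kappa> (z y + (a * h k) *\<^sub>R ?e) - psi \<kappa> (z y)\<bar> / \<bar>h k\<bar>" "L * \<bar>a\<bar>" "\<bar>v y\<bar>"]
        by (simp add: f_def abs_mult)
    qed
  qed
  then show "(\<lambda>k. (psi_conv \<kappa> a b v (x + (0 + h k) *\<^sub>R ?e) - psi_conv \<kappa> a b v (x + 0 *\<^sub>R ?e)) / h k) \<longlonglongrightarrow> a * psi_conv ?\<kappa>' a b v x"
    unfolding q by (simp add: psi_conv_def z_def)
qed

text \<open>All regularity comes from the factor \<open>psi\<close>, so an integrable
  \<open>v\<close> is enough. A partial derivative raises one entry of \<open>\<kappa>\<close> and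
  multiplies the constant by \<open>a\<close>, hence the class over all constants and all
  \<open>\<kappa>\<close> is closed.\<close>

lemma Ck_on_psi_conv:
  assumes "integrable lborel v"
  shows "Ck_on k U (\<lambda>x. C * psi_conv \<kappa> a b (v::'n::finite fn) x)"
proof (rule Ck_onI[where S="{g. \<exists>C \<kappa>. g = (\<lambda>x. C * psi_conv \<kappa> a b v x)}"])
  have D: "((\<lambda>h. C * psi_conv \<kappa> a b v (x + h *\<^sub>R axis i 1)) has_real_derivative 
     (C * a) * psi_conv (\<kappa>(i := Suc (\<kappa> i))) a b v x) (at 0)" for C \<kappa> x i
    using DERIV_cmult[OF psi_conv_DERIV[OF assms, of \<kappa> a b x i], of C] by (simp add: mult.assoc)
  fix g i assume g: "g \<in> {g. \<exists>C \<kappa>. g = (\<lambda>x. C * psi_conv \<kappa> a b v x)}"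
  then obtain C \<kappa> where g: "g = (\<lambda>x. C * psi_conv \<kappa> a b v x)" by blast
  have "pd i g = (\<lambda>x. (C * a) * psi_conv (\<kappa>(i := Suc (\<kappa> i))) a b v x)"
    unfolding g pd_def using DERIV_imp_deriv[OF D] by auto
  then show "pd i g \<in> {g. \<exists>C \<kappa>. g = (\<lambda>x. C * psi_conv \<kappa> a b v x)}" by blast
  show "(\<lambda>t. g (x + t *\<^sub>R axis i 1)) differentiable (at 0)" for x
    unfolding g using D real_differentiable_def by blast
  show "continuous_on UNIV g"
    unfolding g by (intro continuous_on_mult continuous_on_const psi_conv_continuous assms)
qed blast

text \<open>The mollifications converge in L2, so a subsequence converges a.e. and its quotients
  \<open>dq\<close> converge a.e. on the plane. Since their energies stay below that of
  \<open>v\<close>, the convergence is strong in energy.\<close>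

lemma test_fun_dense:
  fixes v :: "'n::finite fn"
  assumes s: "0 < s" "2 * s < real CARD('n)" and v: "v \<in> H0 s" and e: "0 < e"
  shows "\<exists>\<phi>. test_fun (ball 0 1) \<phi> \<and> \<phi> \<in> Hs s \<and> (\<integral>p. (dq s (\<lambda>x. \<phi> x - v x) p)\<^sup>2 \<partial>plane) < e"
proof -
  \<comment> \<open>\<open>psi\<close> lives on the cube of half-side 1, where the l1 norm is at
    most n; scaling by n moves the support into the unit ball.\<close>
  define m where "m = real CARD('n)"
  have m: "0 < m" by (simp add: m_def)
  obtain L where L: "0 < L" "\<And>x. \<bar>psi (\<lambda>_. 0) (x::real^'n)\<bar> \<le> L" using psi_Lipschitz by metis
  have psupp: "psi (\<lambda>_. 0) (m *\<^sub>R w) = 0" if "1 < norm w" for w :: "real^'n"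
  proof (rule ccontr)
    assume "psi (\<lambda>_. 0) (m *\<^sub>R w) \<noteq> 0"
    then have "\<bar>(m *\<^sub>R w) $ i\<bar> \<le> 1" for i by (rule psi_support)
    then have "(\<Sum>i\<in>UNIV. \<bar>(m *\<^sub>R w) $ i\<bar>) \<le> (\<Sum>i\<in>(UNIV::'n set). 1)" by (intro sum_mono)
    then have "norm (m *\<^sub>R w) \<le> m"
      using order_trans[OF norm_le_l1_cart[of "m *\<^sub>R w"], of m] by (simp only: m_def sum_constant mult_1_right)
    then show False using that m by simp
  qed
  have pi: "integrable lborel (\<lambda>w::real^'n. psi (\<lambda>_. 0) (m *\<^sub>R w))"
  proof (rule Bochner_Integration.integrable_bound)
    show "integrable lborel (\<lambda>w. L * indicator (cball (0::real^'n) 1) w)"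
      by (intro integrable_mult_right integrable_real_indicator) (auto intro!: emeasure_bounded_finite[unfolded infinity_ennreal_def])
    show "AE w in lborel. norm (psi (\<lambda>_. 0) (m *\<^sub>R w)) \<le> norm (L * indicator (cball (0::real^'n) 1) w)"
      using L psupp by (intro AE_I2) (auto simp: indicator_def)
  qed measurable
  define Z where "Z = (\<integral>w. psi (\<lambda>_. 0) (m *\<^sub>R (w::real^'n)) \<partial>lborel)"
  have "Z \<noteq> 0"
  proof
    assume "Z = 0"
    then have ae: "AE w in lborel. psi (\<lambda>_. 0) (m *\<^sub>R (w::real^'n)) = 0"
      using integral_nonneg_eq_0_iff_AE[OF pi] psi_nonneg by (auto simp: Z_def)
    let ?O = "{w::real^'n. 0 < psi (\<lambda>_. 0) (m *\<^sub>R w)}"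
    have c: "continuous_on UNIV (\<lambda>w::real^'n. psi (\<lambda>_. 0) (m *\<^sub>R w))"
      by (rule continuous_on_compose2[OF continuous_psi[of UNIV]]) (auto intro!: continuous_intros)
    have "open ?O" by (rule open_Collect_less[OF continuous_on_const c])
    moreover have "0 \<in> ?O" using psi_0_pos by simp
    ultimately have "\<not> negligible ?O" using open_not_negligible by blast
    moreover have "?O \<in> null_sets lborel"
      using ae \<open>open ?O\<close> by (subst AE_iff_null_sets) (auto elim: eventually_mono)
    ultimately show False using negligible_iff_null_sets null_sets_completionI by blast
  qed
  moreover have "0 \<le> Z" unfolding Z_def by (rule Bochner_Integration.integral_nonneg) (rule psi_nonneg)
  ultimately have Z: "0 < Z" by (simp add: order_less_le)
  define \<rho> where "\<rho> w = psi (\<lambda>_. 0) (m *\<^sub>R w) / Z" for w :: "real^'n"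
  interpret mollifier \<rho> "L / Z" s v
  proof
    show "\<rho> \<in> borel_measurable borel" unfolding \<rho>_def by measurable
    show "0 \<le> \<rho> w" for w unfolding \<rho>_def by (rule divide_nonneg_pos[OF psi_nonneg Z])
    show "\<rho> w \<le> L / Z" for w unfolding \<rho>_def using L(2)[of "m *\<^sub>R w"] Z by (simp add: divide_right_mono)
    show "1 < norm w \<Longrightarrow> \<rho> w = 0" for w by (simp add: \<rho>_def psupp)
    show "integrable lborel \<rho>" unfolding \<rho>_def using pi by simp
    show "(\<integral>w. \<rho> w \<partial>lborel) = 1" unfolding \<rho>_def using Z by (simp add: Z_def)
  qed fact+
  define t where "t k = 1 / real (Suc k)" for k
  have t: "0 < t k" for k by (simp add: t_def)
  define \<phi> where "\<phi> k = mollify \<rho> (t k) v" for k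
  \<comment> \<open>Substituting y = (1 + 2t) x - t w moves the variable x from \<open>v\<close>
    into the smooth factor.\<close>
  have \<phi>eq: "\<phi> k = (\<lambda>x. (1 / (Z * t k ^ CARD('n))) * psi_conv (\<lambda>_. 0) (m * (1 + 2 * t k) / t k) (m / t k) v x)" for k
  proof
    fix x
    let ?c = "1 + 2 * t k"
    have lin: "(m * c / t k) *\<^sub>R x - (m / t k) *\<^sub>R (c *\<^sub>R x + (- t k) *\<^sub>R w) = m *\<^sub>R w" for c and w :: "real^'n"
      using t[of k] by (simp add: scaleR_right_diff_distrib)
    have "(\<integral>y. psi (\<lambda>_. 0) ((m * ?c / t k) *\<^sub>R x - (m / t k) *\<^sub>R y) * v y \<partial>lborel)
      = \<bar>- t k\<bar> ^ CARD('n) * (\<integral>w. psi (\<lambda>_. 0) ((m * ?c / t k) *\<^sub>R x - (m / t k) *\<^sub>R (?c *\<^sub>R x + (- t k) *\<^sub>R w)) * v (?c *\<^sub>R x + (- t k) *\<^sub>R w) \<partial>lborel)"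
      using t[of k] by (subst integral_lborel_affine[where c="- t k" and t="?c *\<^sub>R x"]) auto
    also have "(\<lambda>w. psi (\<lambda>_. 0) ((m * ?c / t k) *\<^sub>R x - (m / t k) *\<^sub>R (?c *\<^sub>R x + (- t k) *\<^sub>R w)) * v (?c *\<^sub>R x + (- t k) *\<^sub>R w))
       = (\<lambda>w. Z * (\<rho> w * v (?c *\<^sub>R x - t k *\<^sub>R w)))"
      unfolding lin using Z by (intro ext) (simp add: \<rho>_def)
    finally show "\<phi> k x = (1 / (Z * t k ^ CARD('n))) * psi_conv (\<lambda>_. 0) (m * ?c / t k) (m / t k) v x"
      using t[of k] Z by (simp add: \<phi>_def mollify_def psi_conv_def)
  qed
  have \<phi>test: "test_fun (ball 0 1) (\<phi> k)" for k
    unfolding test_fun_def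
  proof (intro conjI allI exI[of _ "cball 0 ((1 + t k) / (1 + 2 * t k))"] impI)
    show "Ck_on j UNIV (\<phi> k)" for j unfolding \<phi>eq by (rule Ck_on_psi_conv[OF H0_integrable[OF v]])
    have "(1 + t k) / (1 + 2 * t k) < 1" using t[of k] by simp
    then show "cball 0 ((1 + t k) / (1 + 2 * t k)) \<subseteq> (ball 0 1 :: (real^'n) set)" by auto
    show "x \<notin> cball 0 ((1 + t k) / (1 + 2 * t k)) \<Longrightarrow> \<phi> k x = 0" for x
      unfolding \<phi>_def by (rule mollify_support[OF t]) (simp add: not_le)
  qed simp
  have [measurable]: "\<phi> k \<in> borel_measurable borel" for k unfolding \<phi>_def by measurable
  let ?E = "\<integral>p. (dq s v p)\<^sup>2 \<partial>plane"
  have en: "(\<integral>\<^sup>+p. ennreal ((dq s (\<phi> k) p)\<^sup>2) \<partial>plane) \<le> ennreal ?E" for k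
    using mollify_energy[OF t[of k]] by (simp add: \<phi>_def E_eq)
  have i1: "integrable plane (\<lambda>p. (dq s (\<phi> k) p)\<^sup>2)" for k
    by (rule integrableI_nonneg) (auto intro: le_less_trans[OF en])
  have en': "(\<integral>p. (dq s (\<phi> k) p)\<^sup>2 \<partial>plane) \<le> ?E" for k
    using en[of k] by (simp add: nn_integral_eq_integral[OF i1])
  define c where "c k = (L / Z) * 3 powr (real CARD('n) + 2 * s) * t k powr (2 * s) * ?E" for k
  have L2: "(\<integral>\<^sup>+x. ennreal ((\<phi> k x - v x)\<^sup>2) \<partial>lborel) \<le> ennreal (c k)" for k
  proof -
    have "ennreal (c k) = ennreal ((L / Z) * 3 powr (real CARD('n) + 2 * s) * t k powr (2 * s)) * ennreal ?E"
      unfolding c_def using L(1) Z by (intro ennreal_mult) auto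
    then show ?thesis using mollify_L2[OF t[of k]] by (simp only: \<phi>_def E_eq)
  qed
  have i2: "integrable lborel (\<lambda>x. (\<phi> k x - v x)\<^sup>2)" for k
    by (rule integrableI_nonneg) (auto intro: le_less_trans[OF L2])
  have c0: "0 \<le> c k" for k unfolding c_def using L(1) Z by simp
  have L2': "(\<integral>x. (\<phi> k x - v x)\<^sup>2 \<partial>lborel) \<le> c k" for k
    using L2[of k] c0[of k] by (simp add: nn_integral_eq_integral[OF i2])
  have \<phi>H: "\<phi> k \<in> Hs s" for k
  proof -
    have "sq_integrable lborel (\<lambda>x. 1 * (\<phi> k x - v x) + 1 * v x)"
      by (rule sq_integrable_lin) (use i2 v in \<open>auto simp: sq_integrable_def H0_def Hs_iff\<close>)
    then show ?thesis using i1 by (simp add: Hs_iff sq_integrable_def)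
  qed
  have "(\<lambda>k. t k powr (2 * s)) \<longlonglongrightarrow> 0"
  proof -
    have "t \<longlonglongrightarrow> 0" unfolding t_def by (rule LIMSEQ_Suc[OF lim_1_over_n])
    then show ?thesis using s t by (intro tendsto_zero_powrI[where b="2 * s"]) (auto intro!: always_eventually less_imp_le)
  qed
  then have "c \<longlonglongrightarrow> (L / Z) * 3 powr (real CARD('n) + 2 * s) * 0 * ?E"
    unfolding c_def by (intro tendsto_intros)
  then have "c \<longlonglongrightarrow> 0" by simp
  then have "(\<lambda>k. \<integral>x. norm ((\<phi> k x - v x)\<^sup>2) \<partial>lborel) \<longlonglongrightarrow> 0"
    by (rule tendsto_sandwich[OF _ _ tendsto_const, rotated 2]) (use L2' in auto)
  from tendsto_L1_AE_subseq[OF i2 this] obtain r where r: "strict_mono r"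
     and "AE x in lborel. (\<lambda>k. (\<phi> (r k) x - v x)\<^sup>2) \<longlonglongrightarrow> 0" by blast
  then have ae: "AE x in lborel. (\<lambda>k. \<phi> (r k) x) \<longlonglongrightarrow> v x"
    by (auto simp: power_tendsto_0_iff elim!: eventually_mono simp flip: LIM_zero_iff[of _ "v _"])
  have "AE p in plane. (\<lambda>k. dq s (\<phi> (r k)) p) \<longlonglongrightarrow> dq s v p"
    using AE_plane[OF ae] by eventually_elim (unfold dq_def divide_inverse, intro tendsto_intros, auto)
  then obtain k where k: "(\<integral>p. (dq s (\<phi> (r k)) p - dq s v p)\<^sup>2 \<partial>plane) < e"
    using sq_integrable_strong_limit[of plane "\<lambda>k. dq s (\<phi> (r k))" "dq s v" e] \<phi>H v en' e
    by (auto simp: Hs_iff H0_def)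
  have "dq s (\<lambda>x. \<phi> (r k) x - v x) p = dq s (\<phi> (r k)) p - dq s v p" for p
    using dq_lin[of s 1 "\<phi> (r k)" "-1" v p] by simp
  then have "(\<integral>p. (dq s (\<lambda>x. \<phi> (r k) x - v x) p)\<^sup>2 \<partial>plane) < e" using k by (simp only:)
  then show ?thesis using \<phi>test[of "r k"] \<phi>H[of "r k"] by blast
qed

lemma Bform_H0_eq_0:
  fixes u :: "'n::finite fn"
  assumes s: "0 < s" "s < 1" "2 * s < real CARD('n)" and \<gamma>: "adm \<gamma>" and u: "u \<in> Hs s"
    and 0: "\<And>\<phi>. test_fun (ball 0 1) \<phi> \<Longrightarrow> Bform s \<gamma> u \<phi> = 0" and v: "v \<in> H0 s"
  shows "Bform s \<gamma> u v = 0"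
proof (rule ccontr)
  assume nz: "Bform s \<gamma> u v \<noteq> 0"
  let ?C = "C_ns CARD('n) s"
  have C: "0 < ?C" by (rule C_ns_pos[OF s(1,2)])
  \<comment> \<open>The summand 1 keeps the divisor positive even if \<open>u\<close> has zero
    energy.\<close>
  define b where "b = Bform s \<gamma> u u + 1"
  have b: "0 < b" using Bform_nonneg[OF s(1,2) \<gamma>, of u] by (simp add: b_def)
  have B0: "0 < (Bform s \<gamma> u v)\<^sup>2" using nz by simp
  obtain \<phi> where \<phi>: "test_fun (ball 0 1) \<phi>" "\<phi> \<in> Hs s" "(\<integral>p. (dq s (\<lambda>x. \<phi> x - v x) p)\<^sup>2 \<partial>plane) < (Bform s \<gamma> u v)\<^sup>2 / (b * ?C)"
    using test_fun_dense[OF s(1,3) v, of "(Bform s \<gamma> u v)\<^sup>2 / (b * ?C)"] b C B0 by auto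
  have d: "(\<lambda>x. \<phi> x - v x) \<in> Hs s" using Hs_lin[OF \<phi>(2) H0_Hs[OF v], of 1 "-1"] by simp
  have "Bform s \<gamma> u (\<lambda>x. \<phi> x - v x) = - Bform s \<gamma> u v"
    using Bform_lin[OF s(1,2) \<gamma> \<phi>(2) H0_Hs[OF v] u, of 1 "-1"] 0[OF \<phi>(1)]
    by (simp add: Bform_sym[OF s(1,2), of \<gamma> _ u])
  then have "(Bform s \<gamma> u v)\<^sup>2 = \<bar>Bform s \<gamma> u (\<lambda>x. \<phi> x - v x)\<bar>\<^sup>2" by simp
  also have "\<dots> \<le> (sqrt (Bform s \<gamma> u u) * sqrt (Bform s \<gamma> (\<lambda>x. \<phi> x - v x) (\<lambda>x. \<phi> x - v x)))\<^sup>2"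
    by (rule power_mono[OF Bform_CS[OF s(1,2) \<gamma> u d]]) simp
  also have "\<dots> = Bform s \<gamma> u u * Bform s \<gamma> (\<lambda>x. \<phi> x - v x) (\<lambda>x. \<phi> x - v x)"
    using Bform_nonneg[OF s(1,2) \<gamma>] by (simp add: power_mult_distrib)
  also have "\<dots> \<le> b * (?C * (\<integral>p. (dq s (\<lambda>x. \<phi> x - v x) p)\<^sup>2 \<partial>plane))"
    using Bform_ge_dq(2)[OF s(1,2) \<gamma> d] Bform_nonneg[OF s(1,2) \<gamma>] b by (intro mult_mono) (auto simp: b_def)
  also have "\<dots> < (Bform s \<gamma> u v)\<^sup>2" using \<phi>(3) b C by (simp add: field_simps)
  finally show False by simp
qed

section \<open>Finite energy of test functions\<close>

lemma nn_integral_dyadic: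
  fixes f :: "real^'n::finite \<Rightarrow> ennreal"
  assumes f: "\<And>z. f z \<noteq> 0 \<Longrightarrow> \<exists>k. norm z \<le> r k \<and> f z \<le> ennreal (c k)"
    and r: "\<And>k. 0 \<le> r k" and c: "\<And>k::nat. 0 \<le> c k" and sm: "summable (\<lambda>k. c k * r k ^ CARD('n))"
  shows "(\<integral>\<^sup>+z. f z \<partial>lborel) < \<infinity>"
proof -
  let ?V = "unit_ball_vol (real CARD('n))"
  \<comment> \<open>Dyadic substitute for polar coordinates: each point at which \<open>f\<close> is
    nonzero lies in one of the balls whose weight already bounds \<open>f\<close> there, so the sum
    over all balls dominates \<open>f\<close>.\<close>
  have "(\<integral>\<^sup>+z. f z \<partial>lborel) \<le> (\<integral>\<^sup>+z. (\<Sum>k. ennreal (c k) * indicator (cball (0::real^'n) (r k)) z) \<partial>lborel)"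
  proof (intro nn_integral_mono)
    fix z :: "real^'n"
    show "f z \<le> (\<Sum>k. ennreal (c k) * indicator (cball 0 (r k)) z)"
    proof (cases "f z = 0")
      case False
      then obtain k where k: "norm z \<le> r k" "f z \<le> ennreal (c k)" using f by blast
      have "(\<Sum>j\<in>{k}. ennreal (c j) * indicator (cball 0 (r j)) z) \<le> (\<Sum>k. ennreal (c k) * indicator (cball 0 (r k)) z)"
        by (rule sum_le_suminf) auto
      then have "ennreal (c k) \<le> (\<Sum>k. ennreal (c k) * indicator (cball 0 (r k)) z)" using k(1) by simp
      then show ?thesis by (rule order_trans[OF k(2)])
    qed simp
  qed
  also have "\<dots> = (\<Sum>k. \<integral>\<^sup>+z. ennreal (c k) * indicator (cball (0::real^'n) (r k)) z \<partial>lborel)"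
    by (rule nn_integral_suminf) (intro borel_measurable_times_ennreal borel_measurable_const borel_measurable_indicator, simp)
  also have "\<dots> = (\<Sum>k. ennreal (?V * (c k * r k ^ CARD('n))))"
  proof (rule suminf_cong)
    fix k
    have "(\<integral>\<^sup>+z. ennreal (c k) * indicator (cball (0::real^'n) (r k)) z \<partial>lborel) = ennreal (c k) * ennreal (?V * r k ^ CARD('n))"
      using r[of k] by (simp add: nn_integral_cmult_indicator emeasure_cball)
    also have "\<dots> = ennreal (?V * (c k * r k ^ CARD('n)))"
      using r[of k] c[of k] by (subst ennreal_mult[symmetric]) (auto simp: mult_ac)
    finally show "(\<integral>\<^sup>+z. ennreal (c k) * indicator (cball (0::real^'n) (r k)) z \<partial>lborel) = ennreal (?V * (c k * r k ^ CARD('n)))" .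
  qed
  also have "\<dots> < \<infinity>"
    using r c by (subst suminf_ennreal2[OF _ summable_mult[OF sm]]) auto
  finally show ?thesis .
qed

text \<open>The shell at radius 2^-k contributes about 2^(-ka), which is summable since a >
  0.\<close>

lemma near_kernel_finite:
  assumes "0 < a"
  shows "(\<integral>\<^sup>+z. ennreal (indicator (cball 0 1) z * norm z powr (a - real CARD('n))) \<partial>(lborel :: (real^'n::finite) measure)) < \<infinity>"
proof -
  define b where "b = a - real CARD('n)"
  \<comment> \<open>On the shell between 2^-(k+1) and 2^-k the power of the norm varies by at most
    2^|b|, whatever the sign of \<open>b\<close>.\<close>
  define D where "D = (2::real) powr \<bar>b\<bar>"
  have D: "1 \<le> D" unfolding D_def by (rule ge_one_powr_ge_zero) auto
  define c where "c k = D * ((1/2) ^ k) powr b" for k :: nat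
  show ?thesis
  proof (rule nn_integral_dyadic[where r="\<lambda>k. (1/2)^k" and c=c])
    have "c k * ((1/2) ^ k) ^ CARD('n) = D * ((1/2) powr a) ^ k" for k
    proof -
      have "((1/2::real) ^ k) ^ CARD('n) = ((1/2) ^ k) powr (real CARD('n))" by (simp add: powr_realpow)
      then have "c k * ((1/2) ^ k) ^ CARD('n) = D * ((1/2) ^ k) powr (b + real CARD('n))"
        by (simp add: c_def powr_add)
      also have "((1/2::real) ^ k) powr (b + real CARD('n)) = ((1/2) powr a) ^ k"
        by (simp add: b_def powr_powr mult.commute flip: powr_realpow)
      finally show ?thesis .
    qed
    moreover have "norm ((1/2::real) powr a) < 1" using assms powr_less_mono2[of a "1/2" 1] by simp
    ultimately show "summable (\<lambda>k. c k * ((1/2) ^ k) ^ CARD('n))"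
      by (simp add: summable_mult summable_geometric)
    fix z :: "real^'n" assume "ennreal (indicator (cball 0 1) z * norm z powr (a - real CARD('n))) \<noteq> 0"
    then have z: "z \<noteq> 0" "norm z \<le> 1" by (auto simp: indicator_def split: if_splits)
    obtain k0 where "(1/2::real) ^ k0 < norm z" using real_arch_pow_inv[of "norm z" "1/2"] z by auto
    moreover have "(1/2::real) ^ Suc k0 \<le> (1/2) ^ k0" by simp
    ultimately have ex: "(1/2::real) ^ Suc k0 < norm z" by linarith
    define k where "k = (LEAST k. (1/2::real) ^ Suc k < norm z)"
    have k: "(1/2::real) ^ Suc k < norm z" unfolding k_def by (rule LeastI[where P="\<lambda>k. (1/2::real) ^ Suc k < norm z", OF ex])
    have k': "norm z \<le> (1/2) ^ k"
    proof (cases k)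
      case 0 then show ?thesis using z by simp
    next
      case (Suc j)
      then have "\<not> (1/2::real) ^ Suc j < norm z" using not_less_Least[of j "\<lambda>k. (1/2::real) ^ Suc k < norm z"] by (simp add: k_def)
      then show ?thesis using Suc by simp
    qed
    have "norm z powr b \<le> c k"
    proof (cases "0 \<le> b")
      case True
      have "norm z powr b \<le> ((1/2) ^ k) powr b" using k' True z by (intro powr_mono2) auto
      also have "\<dots> \<le> D * ((1/2) ^ k) powr b" using mult_right_mono[OF D, of "((1/2) ^ k) powr b"] by simp
      finally show ?thesis by (simp add: c_def)
    next
      case False
      have "norm z powr b \<le> ((1/2) ^ Suc k) powr b" using k False by (intro powr_mono2') auto
      also have "\<dots> = (1/2) powr b * ((1/2) ^ k) powr b" by (simp only: power_Suc powr_mult)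
      also have "(1/2::real) powr b = D" 
        using False by (simp add: D_def powr_divide powr_minus_divide)
      finally show ?thesis by (simp add: c_def)
    qed
    then show "\<exists>k. norm z \<le> (1/2) ^ k \<and> ennreal (indicator (cball 0 1) z * norm z powr (a - real CARD('n))) \<le> ennreal (c k)"
      using k' z by (intro exI[of _ k]) (auto simp: b_def intro!: ennreal_leI)
  qed (use D in \<open>auto simp: c_def\<close>)
qed

text \<open>The same argument on growing shells: radius 2^k contributes about 2^(-kb).\<close>

lemma far_kernel_finite:
  assumes "0 < b"
  shows "(\<integral>\<^sup>+z. ennreal (indicator (- cball 0 1) z * norm z powr (- (real CARD('n) + b))) \<partial>(lborel :: (real^'n::finite) measure)) < \<infinity>"
proof -
  define c where "c k = (2 ^ k) powr (- (real CARD('n) + b))" for k :: nat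
  show ?thesis
  proof (rule nn_integral_dyadic[where r="\<lambda>k. 2 ^ Suc k" and c=c])
    have "c k * (2 ^ Suc k) ^ CARD('n) = 2 ^ CARD('n) * (2 powr (- b)) ^ k" for k
    proof -
      have "(2 ^ Suc k) ^ CARD('n) = (2::real) ^ CARD('n) * (2 ^ k) powr (real CARD('n))"
        by (simp add: powr_realpow power_mult_distrib)
      then have "c k * (2 ^ Suc k) ^ CARD('n) = 2 ^ CARD('n) * (2 ^ k) powr (- (real CARD('n) + b) + real CARD('n))"
        by (simp only: c_def powr_add) simp
      also have "((2::real) ^ k) powr (- (real CARD('n) + b) + real CARD('n)) = (2 powr (- b)) ^ k"
        by (simp add: powr_powr mult.commute flip: powr_realpow)
      finally show ?thesis .
    qed
    moreover have "norm ((2::real) powr (- b)) < 1" using assms powr_less_mono[of "- b" 0 2] by simp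
    ultimately show "summable (\<lambda>k. c k * (2 ^ Suc k) ^ CARD('n))"
      by (simp only:) (intro summable_mult summable_geometric)
    fix z :: "real^'n" assume "ennreal (indicator (- cball 0 1) z * norm z powr (- (real CARD('n) + b))) \<noteq> 0"
    then have z: "1 < norm z" by (auto simp: indicator_def split: if_splits)
    obtain k0 where "norm z < (2::real) ^ k0" using real_arch_pow[of 2 "norm z"] by auto
    moreover have "(2::real) ^ k0 \<le> 2 ^ Suc k0" by simp
    ultimately have ex: "norm z \<le> 2 ^ Suc k0" by linarith
    define k where "k = (LEAST k. norm z \<le> 2 ^ Suc k)"
    have k: "norm z \<le> 2 ^ Suc k" unfolding k_def by (rule LeastI[where P="\<lambda>k. norm z \<le> 2 ^ Suc k", OF ex])
    have k': "2 ^ k \<le> norm z"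
    proof (cases k)
      case 0 then show ?thesis using z by simp
    next
      case (Suc j)
      then have "\<not> norm z \<le> 2 ^ Suc j" using not_less_Least[of j "\<lambda>k. norm z \<le> 2 ^ Suc k"] by (simp add: k_def)
      then show ?thesis using Suc by simp
    qed
    have "norm z powr (- (real CARD('n) + b)) \<le> c k"
      unfolding c_def using k' assms by (intro powr_mono2') auto
    then show "\<exists>k. norm z \<le> 2 ^ Suc k \<and> ennreal (indicator (- cball 0 1) z * norm z powr (- (real CARD('n) + b))) \<le> ennreal (c k)"
      using k z by (intro exI[of _ k]) (auto intro!: ennreal_leI)
  qed (auto simp: c_def)
qed

text \<open>The path from \<open>y\<close> to \<open>x\<close> changes one coordinate at a time.
  Derivatives at 0 along an axis through every base point give, by translation, derivatives along
  whole axis-parallel lines.\<close>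

lemma Lipschitz_of_axis_derivatives:
  fixes g :: "'n::finite fn"
  assumes D: "\<And>i x. ((\<lambda>t. g (x + t *\<^sub>R axis i 1)) has_real_derivative D i x) (at 0)" and A: "\<And>i x. \<bar>D i x\<bar> \<le> A"
  shows "\<bar>g x - g y\<bar> \<le> A * real CARD('n) * norm (x - y)"
proof -
  have A0: "0 \<le> A" using A[of undefined undefined] by linarith
  have one: "\<bar>g (z + t *\<^sub>R axis j 1) - g z\<bar> \<le> A * \<bar>t\<bar>" for z t j
  proof -
    have "((\<lambda>t. g (z + t *\<^sub>R axis j 1)) has_real_derivative D j (z + t *\<^sub>R axis j 1)) (at t)" for t
    proof -
      have "((\<lambda>\<tau>. g (z + (\<tau> + t) *\<^sub>R axis j 1)) has_real_derivative D j (z + t *\<^sub>R axis j 1)) (at 0)"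
        using D[where x="z + t *\<^sub>R axis j 1" and i=j] by (simp add: scaleR_add_left add_ac)
      then show ?thesis using DERIV_shift[of "\<lambda>t. g (z + t *\<^sub>R axis j 1)" _ 0 t] by simp
    qed
    then have "norm (g (z + t *\<^sub>R axis j 1) - g (z + 0 *\<^sub>R axis j 1)) \<le> A * norm (t - 0)"
      by (intro field_differentiable_bound[where S=UNIV and f'="\<lambda>t. D j (z + t *\<^sub>R axis j 1)"]) (use A in auto)
    then show ?thesis by simp
  qed
  define h where "h = x - y"
  have "\<bar>g (y + (\<Sum>i\<in>S. (h $ i) *\<^sub>R axis i 1)) - g y\<bar> \<le> (\<Sum>i\<in>S. A * \<bar>h $ i\<bar>)" if "finite S" for S
    using that
  proof (induction S rule: finite_induct)
    case (insert j S)
    let ?z = "y + (\<Sum>i\<in>S. (h $ i) *\<^sub>R axis i 1)"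
    have "\<bar>g (?z + (h $ j) *\<^sub>R axis j 1) - g ?z\<bar> \<le> A * \<bar>h $ j\<bar>" by (rule one)
    moreover have eq: "y + (\<Sum>i\<in>insert j S. (h $ i) *\<^sub>R axis i 1) = ?z + (h $ j) *\<^sub>R axis j 1"
      using insert by simp
    moreover have "(\<Sum>i\<in>insert j S. A * \<bar>h $ i\<bar>) = A * \<bar>h $ j\<bar> + (\<Sum>i\<in>S. A * \<bar>h $ i\<bar>)"
      using insert by simp
    ultimately show ?case unfolding eq using insert.IH by linarith
  qed simp
  from this[of UNIV] have "\<bar>g (y + (\<Sum>i\<in>UNIV. (h $ i) *\<^sub>R axis i 1)) - g y\<bar> \<le> (\<Sum>i\<in>(UNIV::'n set). A * \<bar>h $ i\<bar>)" by simp
  also have "(\<Sum>i\<in>UNIV. (h $ i) *\<^sub>R axis i 1) = h"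
    using basis_expansion[of h] by (simp add: scalar_mult_eq_scaleR)
  also have "(\<Sum>i\<in>(UNIV::'n set). A * \<bar>h $ i\<bar>) \<le> (\<Sum>i\<in>(UNIV::'n set). A * norm h)"
    using A0 component_le_norm_cart[of h] by (intro sum_mono mult_left_mono) auto
  finally show ?thesis by (simp add: mult_ac h_def)
qed

lemma compact_support_bounded:
  fixes g :: "'n::finite fn"
  assumes "continuous_on UNIV g" "compact K" "\<And>x. x \<notin> K \<Longrightarrow> g x = 0"
  obtains A where "0 < A" "\<And>x. \<bar>g x\<bar> \<le> A"
proof -
  have "compact (g ` K)" using assms by (intro compact_continuous_image) (auto intro: continuous_on_subset)
  then obtain B where B: "\<And>x. x \<in> K \<Longrightarrow> \<bar>g x\<bar> \<le> B"
    using compact_imp_bounded bounded_iff by (metis imageI real_norm_def)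
  have "\<bar>g x\<bar> \<le> \<bar>B\<bar> + 1" for x using B[of x] assms(3)[of x] by (cases "x \<in> K") auto
  then show ?thesis using that[of "\<bar>B\<bar> + 1"] by auto
qed

text \<open>The squared quotient is dominated by a function \<open>W\<close> of x - y: near the
  diagonal the Lipschitz bound gives |z|^(2-2s-n), integrable as s < 1, and far away boundedness
  gives |z|^(-n-2s), integrable as s > 0. One of the two points must lie in the ball, so the energy
  is at most twice the volume of the ball times the integral of \<open>W\<close>.\<close>

lemma test_fun_in_H0:
  fixes \<phi> :: "'n::finite fn"
  assumes s: "0 < s" "s < 1" and \<phi>: "test_fun (ball 0 1) \<phi>"
  shows "\<phi> \<in> H0 s"
proof -
  obtain K where K: "compact K" "K \<subseteq> ball 0 1" "\<And>x. x \<notin> K \<Longrightarrow> \<phi> x = 0" using \<phi> by (auto simp: test_fun_def)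
  have ck: "Ck_on 1 UNIV \<phi>" using \<phi> by (simp add: test_fun_def)
  have c0: "continuous_on UNIV \<phi>" using ck unfolding Ck_on_def by (auto dest!: spec[of _ "[]"])
  have c1: "continuous_on UNIV (pd i \<phi>)" for i
    using ck unfolding Ck_on_def by (auto dest!: spec[of _ "[i]"])
  have "(\<lambda>t. \<phi> (x + t *\<^sub>R axis i 1)) differentiable (at 0)" for x i
    using ck unfolding Ck_on_def by (auto dest!: spec[of _ "[]"])
  then have D: "((\<lambda>t. \<phi> (x + t *\<^sub>R axis i 1)) has_real_derivative pd i \<phi> x) (at 0)" for x i
    unfolding pd_def by (metis DERIV_imp_deriv real_differentiable_def)
  have pd0: "pd i \<phi> x = 0" if "x \<notin> K" for i x
  proof -
    have "open ((\<lambda>t. x + t *\<^sub>R axis i 1) -` (- K))"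
      by (intro open_vimage continuous_intros) (use K(1) in \<open>auto simp: compact_imp_closed open_Compl\<close>)
    then have "((\<lambda>t. \<phi> (x + t *\<^sub>R axis i 1)) has_real_derivative 0) (at 0)"
      by (rule has_field_derivative_transform_within_open[of "\<lambda>_. 0", rotated]) (use that K(3) in auto)
    then show ?thesis using D DERIV_unique by blast
  qed
  have "\<exists>A>0. \<forall>x. \<bar>pd i \<phi> x\<bar> \<le> A" for i using compact_support_bounded[OF c1 K(1) pd0] by metis
  then obtain A where A: "\<And>i. 0 < A i" "\<And>i x. \<bar>pd i \<phi> x\<bar> \<le> A i" by metis
  have "\<bar>pd i \<phi> x\<bar> \<le> (\<Sum>i\<in>UNIV. A i)" for i x
    using member_le_sum[of i UNIV A] A by (auto intro: order_trans less_imp_le)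
  note lip = Lipschitz_of_axis_derivatives[OF D this]
  define L where "L = (\<Sum>i\<in>UNIV. A i) * real CARD('n)"
  obtain B where B: "0 < B" "\<And>x. \<bar>\<phi> x\<bar> \<le> B" using compact_support_bounded[OF c0 K(1,3)] by metis
  have [measurable]: "\<phi> \<in> borel_measurable borel" by (rule borel_measurable_continuous_onI[OF c0])
  have z: "\<phi> x = 0" if "1 < norm x" for x using K that by force
  have fin: "emeasure lborel (cball (0::real^'n) 1) < top" by (rule emeasure_bounded_finite[unfolded infinity_ennreal_def]) simp
  have iI: "integrable lborel (indicator (cball (0::real^'n) 1) :: _ \<Rightarrow> real)"
    by (rule integrable_real_indicator) (use fin in auto)
  have "integrable lborel (\<lambda>x. (\<phi> x)\<^sup>2)"
  proof (rule Bochner_Integration.integrable_bound)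
    show "integrable lborel (\<lambda>x. B\<^sup>2 * indicator (cball (0::real^'n) 1) x)" using iI by simp
    have "(\<phi> x)\<^sup>2 \<le> B\<^sup>2" for x using B(2)[of x] B(1) by (metis abs_le_square_iff abs_of_pos)
    then show "AE x in lborel. norm ((\<phi> x)\<^sup>2) \<le> norm (B\<^sup>2 * indicator (cball (0::real^'n) 1) x)"
      using z by (intro AE_I2) (auto simp: indicator_def)
  qed measurable
  then have L2: "sq_integrable lborel \<phi>" by (simp add: sq_integrable_def)
  define q where "q = real CARD('n) + 2 * s"
  define Q where "Q = L\<^sup>2 + 4 * B\<^sup>2"
  define W where "W z = Q * (indicator (cball 0 1) z * norm z powr (2 - 2 * s - real CARD('n)) 
       + indicator (- cball 0 1) z * norm z powr (- q))" for z :: "real^'n"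
  have Q0: "0 \<le> Q" by (simp add: Q_def)
  have [measurable]: "cball (0::real^'n) 1 \<in> sets borel" by simp
  have [measurable]: "W \<in> borel_measurable borel" unfolding W_def by measurable
  have W0: "0 \<le> W z" for z unfolding W_def using Q0 by (intro mult_nonneg_nonneg add_nonneg_nonneg) auto
  have "(\<integral>\<^sup>+z. ennreal (W z) \<partial>lborel) = ennreal Q * ((\<integral>\<^sup>+z. ennreal (indicator (cball (0::real^'n) 1) z * norm z powr (2 - 2 * s - real CARD('n))) \<partial>lborel)
      + (\<integral>\<^sup>+z. ennreal (indicator (- cball (0::real^'n) 1) z * norm z powr (- q)) \<partial>lborel))"
    unfolding W_def using Q0 by (simp add: ennreal_mult ennreal_plus nn_integral_cmult nn_integral_add del: ennreal_plus[symmetric])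
  also have "\<dots> < \<infinity>"
    using near_kernel_finite[of "2 - 2 * s", where 'n='n] far_kernel_finite[of "2 * s", where 'n='n] s
    by (simp add: q_def ennreal_mult_less_top)
  finally have Wfin: "(\<integral>\<^sup>+z. ennreal (W z) \<partial>lborel) < \<infinity>" .
  let ?I = "indicator (cball (0::real^'n) 1) :: _ \<Rightarrow> ennreal"
  have pt: "ennreal ((dq s \<phi> (x, y))\<^sup>2) \<le> ?I x * ennreal (W (x - y)) + ?I y * ennreal (W (x - y))" for x y
  proof (cases "norm x \<le> 1 \<or> norm y \<le> 1")
    case False
    then have "\<phi> x = 0" "\<phi> y = 0" using z by auto
    then show ?thesis by (simp add: dq_def)
  next
    case True
    have sq: "(dq s \<phi> (x, y))\<^sup>2 = (\<phi> x - \<phi> y)\<^sup>2 * norm (x - y) powr (- q)"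
    proof -
      have h: "(norm (x - y) powr (q / 2))\<^sup>2 = norm (x - y) powr q"
        by (simp add: power2_eq_square flip: powr_add)
      show ?thesis
        unfolding dq_def fst_conv snd_conv q_def[symmetric] power_divide powr_minus h by (rule divide_inverse)
    qed
    have "(dq s \<phi> (x, y))\<^sup>2 \<le> W (x - y)"
    proof (cases "norm (x - y) \<le> 1")
      case T: True
      have "\<bar>\<phi> x - \<phi> y\<bar> \<le> L * norm (x - y)" using lip[of x y] by (simp add: L_def)
      then have "(\<phi> x - \<phi> y)\<^sup>2 \<le> (L * norm (x - y))\<^sup>2" by (meson abs_ge_self abs_le_square_iff order_trans)
      also have "\<dots> \<le> Q * (norm (x - y))\<^sup>2" by (simp add: power_mult_distrib Q_def mult_right_mono)
      finally have "(dq s \<phi> (x, y))\<^sup>2 \<le> Q * (norm (x - y))\<^sup>2 * norm (x - y) powr (- q)"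
        unfolding sq by (intro mult_right_mono) auto
      also have "\<dots> = W (x - y)"
      proof (cases "x = y")
        case False
        then have "(norm (x - y))\<^sup>2 = norm (x - y) powr 2" by simp
        then have "(norm (x - y))\<^sup>2 * norm (x - y) powr (- q) = norm (x - y) powr (2 - 2 * s - real CARD('n))"
          by (simp only: flip: powr_add) (simp add: q_def algebra_simps)
        then show ?thesis using T by (simp add: W_def mult.assoc)
      qed (simp add: W_def)
      finally show ?thesis .
    next
      case F: False
      have "\<bar>\<phi> x - \<phi> y\<bar> \<le> 2 * B" using B(2)[of x] B(2)[of y] by linarith
      then have "(\<phi> x - \<phi> y)\<^sup>2 \<le> (2 * B)\<^sup>2" by (meson abs_ge_self abs_le_square_iff order_trans)
      also have "\<dots> \<le> Q" by (simp add: power_mult_distrib Q_def)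
      finally show ?thesis unfolding sq using F by (simp add: W_def mult_right_mono)
    qed
    then have "ennreal ((dq s \<phi> (x, y))\<^sup>2) \<le> ennreal (W (x - y))" by (rule ennreal_leI)
    then show ?thesis using True by (auto simp: indicator_def intro: order_trans)
  qed
  have tr: "(\<integral>\<^sup>+y. ennreal (W (x - y)) \<partial>lborel) = (\<integral>\<^sup>+z. ennreal (W z) \<partial>lborel)" for x
    by (subst (2) lborel_affine[of "-1" x]) (simp_all add: nn_integral_density nn_integral_distr)
  have tr': "(\<integral>\<^sup>+x. ennreal (W (x - y)) \<partial>lborel) = (\<integral>\<^sup>+z. ennreal (W z) \<partial>lborel)" for y
    by (subst (2) lborel_affine[of "1" "- y"]) (simp_all add: nn_integral_density nn_integral_distr)
  have "(\<integral>\<^sup>+p. ennreal ((dq s \<phi> p)\<^sup>2) \<partial>plane) = (\<integral>\<^sup>+x. \<integral>\<^sup>+y. ennreal ((dq s \<phi> (x, y))\<^sup>2) \<partial>lborel \<partial>lborel)"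
    by (subst lborel.nn_integral_fst) auto
  also have "\<dots> \<le> (\<integral>\<^sup>+x. \<integral>\<^sup>+y. ?I x * ennreal (W (x - y)) + ?I y * ennreal (W (x - y)) \<partial>lborel \<partial>lborel)"
    by (intro nn_integral_mono pt)
  also have "\<dots> = (\<integral>\<^sup>+x. \<integral>\<^sup>+y. ?I x * ennreal (W (x - y)) \<partial>lborel \<partial>lborel) + (\<integral>\<^sup>+x. \<integral>\<^sup>+y. ?I y * ennreal (W (x - y)) \<partial>lborel \<partial>lborel)"
    by (simp add: nn_integral_add)
  also have "(\<integral>\<^sup>+x. \<integral>\<^sup>+y. ?I y * ennreal (W (x - y)) \<partial>lborel \<partial>lborel) = (\<integral>\<^sup>+y. \<integral>\<^sup>+x. ?I y * ennreal (W (x - y)) \<partial>lborel \<partial>lborel)"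
    by (rule lborel_pair.Fubini') measurable
  also have "(\<integral>\<^sup>+x. \<integral>\<^sup>+y. ?I x * ennreal (W (x - y)) \<partial>lborel \<partial>lborel) + \<dots> 
     = 2 * (emeasure lborel (cball (0::real^'n) 1) * (\<integral>\<^sup>+z. ennreal (W z) \<partial>lborel))"
    by (simp add: nn_integral_cmult tr tr' nn_integral_multc mult_2)
  also have "\<dots> < \<infinity>" using fin Wfin by (simp add: ennreal_mult_less_top)
  finally have "integrable plane (\<lambda>p. (dq s \<phi> p)\<^sup>2)"
    by (intro integrableI_nonneg) auto
  then show ?thesis using L2 z by (auto simp: H0_def Hs_iff sq_integrable_def)
qed

section \<open>Separable approximation of the kernel\<close>

definition midx :: "nat \<Rightarrow> ('n::finite \<Rightarrow> nat) set" where
  "midx d = {\<alpha>. \<forall>i. \<alpha> i \<le> d}"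

lemma midx_PiE: "midx d = (\<Pi>\<^sub>E i\<in>(UNIV::'n::finite set). {..d})"
  by (auto simp: midx_def PiE_def)

lemma finite_midx [simp]: "finite (midx d :: ('n::finite \<Rightarrow> nat) set)"
  by (simp add: midx_PiE finite_PiE)

lemma card_midx: "card (midx d :: ('n::finite \<Rightarrow> nat) set) = (d + 1) ^ CARD('n)"
  by (simp add: midx_PiE card_PiE)

definition monom_at :: "('n::finite \<Rightarrow> nat) \<Rightarrow> real^'n \<Rightarrow> real" where
  "monom_at \<alpha> x = (\<Prod>i\<in>UNIV. (x $ i) ^ \<alpha> i)"

lemma monom_at_add: "monom_at (\<lambda>i. \<alpha> i + \<beta> i) x = monom_at \<alpha> x * monom_at \<beta> x"
  by (simp add: monom_at_def power_add prod.distrib)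

lemma monom_at_bound: "norm x \<le> 1 \<Longrightarrow> \<bar>monom_at \<alpha> x\<bar> \<le> 1"
proof -
  assume x: "norm x \<le> 1"
  have "\<bar>x $ i\<bar> \<le> 1" for i using component_le_norm_cart[of x i] x by simp
  then show ?thesis unfolding monom_at_def abs_prod power_abs
    by (intro prod_le_1) (auto simp: power_le_one)
qed

lemma monom_at_measurable [measurable]: "monom_at \<alpha> \<in> borel_measurable borel"
  unfolding monom_at_def
  by (intro borel_measurable_continuous_onI continuous_intros)

text \<open>Polynomials in x whose coefficients depend on y, together with a bound on the l1 norm of
  the coefficients. That norm is submultiplicative, which keeps powers under control; norm at most 3
  covers the annulus.\<close>

definition poly_rep :: "nat \<Rightarrow> real \<Rightarrow> (real^'n::finite \<Rightarrow> real^'n \<Rightarrow> real) \<Rightarrow> bool" where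
  "poly_rep d M F \<longleftrightarrow> (\<exists>a. (\<forall>\<alpha>. a \<alpha> \<in> borel_measurable borel) \<and>
     (\<forall>x y. F x y = (\<Sum>\<alpha>\<in>midx d. monom_at \<alpha> x * a \<alpha> y)) \<and>
     (\<forall>y. norm y \<le> 3 \<longrightarrow> (\<Sum>\<alpha>\<in>midx d. \<bar>a \<alpha> y\<bar>) \<le> M))"

lemma poly_rep_mono:
  assumes "poly_rep d M F" "d \<le> d'" "M \<le> M'"
  shows "poly_rep d' M' F"
proof -
  from assms(1) obtain a where a: "\<And>\<alpha>. a \<alpha> \<in> borel_measurable borel"
    "\<And>x y. F x y = (\<Sum>\<alpha>\<in>midx d. monom_at \<alpha> x * a \<alpha> y)" "\<And>y. norm y \<le> 3 \<Longrightarrow> (\<Sum>\<alpha>\<in>midx d. \<bar>a \<alpha> y\<bar>) \<le> M"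
    unfolding poly_rep_def by blast
  let ?b = "\<lambda>\<alpha> y. if \<alpha> \<in> midx d then a \<alpha> y else 0"
  have sub: "midx d \<subseteq> midx d'" using assms(2) by (auto simp: midx_def intro: order_trans)
  have 1: "(\<Sum>\<alpha>\<in>midx d'. monom_at \<alpha> x * ?b \<alpha> y) = F x y" for x y
    unfolding a(2) using sub by (intro sum.mono_neutral_cong_right) auto
  have 2: "(\<Sum>\<alpha>\<in>midx d'. \<bar>?b \<alpha> y\<bar>) = (\<Sum>\<alpha>\<in>midx d. \<bar>a \<alpha> y\<bar>)" for y
    using sub by (intro sum.mono_neutral_cong_right) auto
  show ?thesis unfolding poly_rep_def
  proof (intro exI[of _ ?b] conjI allI impI)
    show "?b \<alpha> \<in> borel_measurable borel" for \<alpha> using a(1)[of \<alpha>] by (cases "\<alpha> \<in> midx d") auto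
    show "(\<Sum>\<alpha>\<in>midx d'. \<bar>?b \<alpha> y\<bar>) \<le> M'" if "norm y \<le> 3" for y
      unfolding 2 using a(3)[OF that] assms(3) by simp
  qed (use 1 in auto)
qed

lemma poly_rep_add:
  assumes "poly_rep d M F" "poly_rep d K G"
  shows "poly_rep d (M + K) (\<lambda>x y. F x y + G x y)"
proof -
  from assms(1) obtain a where a: "\<And>\<alpha>. a \<alpha> \<in> borel_measurable borel"
    "\<And>x y. F x y = (\<Sum>\<alpha>\<in>midx d. monom_at \<alpha> x * a \<alpha> y)" "\<And>y. norm y \<le> 3 \<Longrightarrow> (\<Sum>\<alpha>\<in>midx d. \<bar>a \<alpha> y\<bar>) \<le> M"
    unfolding poly_rep_def by blast
  from assms(2) obtain b where b: "\<And>\<alpha>. b \<alpha> \<in> borel_measurable borel"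
    "\<And>x y. G x y = (\<Sum>\<alpha>\<in>midx d. monom_at \<alpha> x * b \<alpha> y)" "\<And>y. norm y \<le> 3 \<Longrightarrow> (\<Sum>\<alpha>\<in>midx d. \<bar>b \<alpha> y\<bar>) \<le> K"
    unfolding poly_rep_def by blast
  have "(\<Sum>\<alpha>\<in>midx d. \<bar>a \<alpha> y + b \<alpha> y\<bar>) \<le> M + K" if "norm y \<le> 3" for y
  proof -
    have "(\<Sum>\<alpha>\<in>midx d. \<bar>a \<alpha> y + b \<alpha> y\<bar>) \<le> (\<Sum>\<alpha>\<in>midx d. \<bar>a \<alpha> y\<bar> + \<bar>b \<alpha> y\<bar>)" by (intro sum_mono abs_triangle_ineq)
    also have "\<dots> \<le> M + K" unfolding sum.distrib using a(3)[OF that] b(3)[OF that] by simp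
    finally show ?thesis .
  qed
  then show ?thesis unfolding poly_rep_def
    by (intro exI[of _ "\<lambda>\<alpha> y. a \<alpha> y + b \<alpha> y"]) (auto simp: a b distrib_left sum.distrib intro!: borel_measurable_add)
qed

lemma poly_rep_const: "poly_rep 0 \<bar>c\<bar> (\<lambda>(x::real^'n::finite) (y::real^'n). c)"
proof -
  have "(midx 0 :: ('n \<Rightarrow> nat) set) = {\<lambda>_. 0}" by (auto simp: midx_def)
  then show ?thesis unfolding poly_rep_def by (intro exI[of _ "\<lambda>_ _. c"]) (auto simp: monom_at_def)
qed

text \<open>The pairs of exponents are grouped by their sum; the triangle inequality within each
  group makes the l1 norm submultiplicative.\<close>

lemma poly_rep_mult:
  fixes F G :: "real^'n::finite \<Rightarrow> real^'n \<Rightarrow> real"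
  assumes "poly_rep d M F" "poly_rep e K G" "0 \<le> M"
  shows "poly_rep (d + e) (M * K) (\<lambda>x y. F x y * G x y)"
proof -
  from assms(1) obtain a where a: "\<And>\<alpha>. a \<alpha> \<in> borel_measurable borel"
    "\<And>x y. F x y = (\<Sum>\<alpha>\<in>midx d. monom_at \<alpha> x * a \<alpha> y)" "\<And>y. norm y \<le> 3 \<Longrightarrow> (\<Sum>\<alpha>\<in>midx d. \<bar>a \<alpha> y\<bar>) \<le> M"
    unfolding poly_rep_def by blast
  from assms(2) obtain b where b: "\<And>\<alpha>. b \<alpha> \<in> borel_measurable borel"
    "\<And>x y. G x y = (\<Sum>\<alpha>\<in>midx e. monom_at \<alpha> x * b \<alpha> y)" "\<And>y. norm y \<le> 3 \<Longrightarrow> (\<Sum>\<alpha>\<in>midx e. \<bar>b \<alpha> y\<bar>) \<le> K"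
    unfolding poly_rep_def by blast
  let ?S = "midx d \<times> (midx e :: ('n \<Rightarrow> nat) set)"
  let ?g = "\<lambda>p::('n \<Rightarrow> nat) \<times> ('n \<Rightarrow> nat). (\<lambda>i. fst p i + snd p i)"
  define c where "c \<gamma> y = (\<Sum>p\<in>{p\<in>?S. ?g p = \<gamma>}. a (fst p) y * b (snd p) y)" for \<gamma> y
  have g: "?g ` ?S \<subseteq> midx (d + e)" by (auto simp: midx_def intro: add_mono)
  have 1: "F x y * G x y = (\<Sum>\<gamma>\<in>midx (d + e). monom_at \<gamma> x * c \<gamma> y)" for x y
  proof -
    have "F x y * G x y = (\<Sum>p\<in>?S. (monom_at (fst p) x * a (fst p) y) * (monom_at (snd p) x * b (snd p) y))"
      unfolding a(2) b(2) sum_product sum.cartesian_product by (simp add: case_prod_unfold)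
    also have "\<dots> = (\<Sum>p\<in>?S. monom_at (?g p) x * (a (fst p) y * b (snd p) y))"
      by (intro sum.cong refl) (simp add: monom_at_add)
    also have "\<dots> = (\<Sum>\<gamma>\<in>midx (d + e). \<Sum>p\<in>{p\<in>?S. ?g p = \<gamma>}. monom_at (?g p) x * (a (fst p) y * b (snd p) y))"
      using g by (intro sum.group[symmetric]) auto
    also have "\<dots> = (\<Sum>\<gamma>\<in>midx (d + e). monom_at \<gamma> x * c \<gamma> y)"
      unfolding c_def sum_distrib_left by (intro sum.cong refl) auto
    finally show ?thesis .
  qed
  have 2: "(\<Sum>\<gamma>\<in>midx (d + e). \<bar>c \<gamma> y\<bar>) \<le> M * K" if "norm y \<le> 3" for y
  proof -
    have "(\<Sum>\<gamma>\<in>midx (d + e). \<bar>c \<gamma> y\<bar>) \<le> (\<Sum>\<gamma>\<in>midx (d + e). \<Sum>p\<in>{p\<in>?S. ?g p = \<gamma>}. \<bar>a (fst p) y\<bar> * \<bar>b (snd p) y\<bar>)"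
      unfolding c_def by (intro sum_mono order_trans[OF sum_abs]) (simp add: abs_mult)
    also have "\<dots> = (\<Sum>p\<in>?S. \<bar>a (fst p) y\<bar> * \<bar>b (snd p) y\<bar>)"
      using g by (intro sum.group) auto
    also have "\<dots> = (\<Sum>\<alpha>\<in>midx d. \<bar>a \<alpha> y\<bar>) * (\<Sum>\<beta>\<in>midx e. \<bar>b \<beta> y\<bar>)"
      unfolding sum_product sum.cartesian_product by (simp add: case_prod_unfold)
    also have "\<dots> \<le> M * K"
      using a(3)[OF that] b(3)[OF that] assms(3) by (intro mult_mono) (auto intro: sum_nonneg)
    finally show ?thesis .
  qed
  have 3: "c \<gamma> \<in> borel_measurable borel" for \<gamma>
    unfolding c_def using a(1) b(1) by (intro borel_measurable_sum borel_measurable_times) auto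
  show ?thesis unfolding poly_rep_def using 1 2 3 by (intro exI[of _ c]) auto
qed

lemma poly_rep_power:
  assumes "poly_rep d M F" "0 \<le> M"
  shows "poly_rep (k * d) (M ^ k) (\<lambda>x y. F x y ^ k)"
proof (induction k)
  case 0
  then show ?case using poly_rep_const[of 1] by simp
next
  case (Suc k)
  from poly_rep_mult[OF assms(1) Suc assms(2)] show ?case by simp
qed

lemma poly_rep_sum:
  assumes "finite I" "\<And>i. i \<in> I \<Longrightarrow> poly_rep d (M i) (F i)"
  shows "poly_rep d (\<Sum>i\<in>I. M i) (\<lambda>x y. \<Sum>i\<in>I. F i x y)"
  using assms
proof (induction I rule: finite_induct)
  case empty
  then show ?case using poly_rep_mono[OF poly_rep_const[of 0], of d 0] by simp
next
  case (insert i I)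
  then show ?case using poly_rep_add[of d "M i" "F i" "\<Sum>i\<in>I. M i"] by simp
qed

lemma poly_rep_coord: "poly_rep 1 4 (\<lambda>x y. x $ i - y $ i)"
proof -
  let ?e = "\<lambda>j. if j = i then 1 else (0::nat)"
  let ?a = "\<lambda>\<alpha> y. if \<alpha> = ?e then 1 else if \<alpha> = (\<lambda>_. 0) then - (y $ i) else (0::real)"
  have ne: "?e \<noteq> (\<lambda>_. 0)" by (auto dest: fun_cong[of _ _ i])
  have sub: "{?e, \<lambda>_. 0} \<subseteq> midx 1" by (auto simp: midx_def)
  have me: "monom_at ?e x = x $ i" for x :: "real^'a"
    unfolding monom_at_def by (subst prod.remove[of _ i]) (auto intro!: prod.neutral)
  have 1: "(\<Sum>\<alpha>\<in>midx 1. monom_at \<alpha> x * ?a \<alpha> y) = x $ i - y $ i" for x y :: "real^'a"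
  proof -
    have "(\<Sum>\<alpha>\<in>midx 1. monom_at \<alpha> x * ?a \<alpha> y) = (\<Sum>\<alpha>\<in>{?e, \<lambda>_. 0}. monom_at \<alpha> x * ?a \<alpha> y)"
      using sub by (intro sum.mono_neutral_right) auto
    also have "\<dots> = x $ i - y $ i" using ne me[of x] by (simp add: monom_at_def)
    finally show ?thesis .
  qed
  have 2: "(\<Sum>\<alpha>\<in>midx 1. \<bar>?a \<alpha> y\<bar>) \<le> 4" if "norm y \<le> 3" for y :: "real^'a"
  proof -
    have "(\<Sum>\<alpha>\<in>midx 1. \<bar>?a \<alpha> y\<bar>) = (\<Sum>\<alpha>\<in>{?e, \<lambda>_. 0}. \<bar>?a \<alpha> y\<bar>)"
      using sub by (intro sum.mono_neutral_right) auto
    also have "\<dots> = 1 + \<bar>y $ i\<bar>" using ne by simp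
    also have "\<dots> \<le> 4" using component_le_norm_cart[of y i] that by simp
    finally show ?thesis .
  qed
  show ?thesis unfolding poly_rep_def
    by (intro exI[of _ ?a] conjI allI impI) (use 1 2 in auto)
qed

text \<open>For x in the ball and y in the annulus, |x - y|^2 lies in [1, 16]. Writing it as A (1 +
  z) with the midpoint A = 17/2 gives |z| <= 15/17, so the binomial series for (1 + z)^(-q/2)
  converges geometrically. Since z is quadratic in x, the partial sum up to N has degree at most 2N
  in each coordinate.\<close>

lemma kernel_approx:
  fixes q :: real
  shows "\<exists>M C r. 1 \<le> M \<and> 1 \<le> C \<and> 0 < r \<and> r < 1 \<and> (\<forall>N. \<exists>a :: ('n::finite \<Rightarrow> nat) \<Rightarrow> real^'n \<Rightarrow> real.
     (\<forall>\<alpha>. a \<alpha> \<in> borel_measurable borel) \<and>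
     (\<forall>y. norm y \<le> 3 \<longrightarrow> (\<Sum>\<alpha>\<in>midx (2 * N). \<bar>a \<alpha> y\<bar>) \<le> C * M ^ N) \<and>
     (\<forall>x y. norm x \<le> 1 \<longrightarrow> 2 \<le> norm y \<longrightarrow> norm y \<le> 3 \<longrightarrow>
        \<bar>norm (x - y) powr (- q) - (\<Sum>\<alpha>\<in>midx (2 * N). monom_at \<alpha> x * a \<alpha> y)\<bar> \<le> C * r ^ N))"
proof -
  define A where "A = 17 / (2::real)"
  define b where "b k = A powr (- q / 2) * ((- q / 2) gchoose k)" for k
  define z where "z x y = (norm (x - y))\<^sup>2 / A - 1" for x y :: "real^'n"
  have ser: "(\<lambda>k. b k * z x y ^ k) sums (norm (x - y) powr (- q))"
    and zle: "\<bar>z x y\<bar> \<le> 15/17" if "norm x \<le> 1" "2 \<le> norm y" "norm y \<le> 3" for x y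
  proof -
    have n: "1 \<le> norm (x - y)" "norm (x - y) \<le> 4"
      using that norm_triangle_ineq4[of x y] norm_triangle_ineq2[of y x] by (auto simp: norm_minus_commute)
    have n2: "1 \<le> (norm (x - y))\<^sup>2" "(norm (x - y))\<^sup>2 \<le> 16"
      using power_mono[of 1 "norm (x - y)" 2] power_mono[of "norm (x - y)" 4 2] n by auto
    then show z: "\<bar>z x y\<bar> \<le> 15/17" by (auto simp: z_def A_def abs_le_iff field_simps)
    then have "(\<lambda>k. A powr (- q / 2) * (((- q / 2) gchoose k) * z x y ^ k)) sums (A powr (- q / 2) * (1 + z x y) powr (- q / 2))"
      by (intro sums_mult gen_binomial_real) auto
    moreover have "A powr (- q / 2) * (1 + z x y) powr (- q / 2) = norm (x - y) powr (- q)"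
    proof -
      have "A powr (- q / 2) * (1 + z x y) powr (- q / 2) = ((norm (x - y))\<^sup>2) powr (- q / 2)"
        using n by (subst powr_mult[symmetric]) (auto simp: A_def z_def)
      also have "(norm (x - y))\<^sup>2 = norm (x - y) powr 2" using n by simp
      finally show ?thesis using n by (simp only: powr_powr) simp
    qed
    ultimately show "(\<lambda>k. b k * z x y ^ k) sums (norm (x - y) powr (- q))" by (simp add: b_def mult.assoc)
  qed
  \<comment> \<open>A radius strictly between 15/17 and 1: boundedness of b_k w^k yields |b_k| <= B
    (17/16)^k, and the ratio of the tail becomes (17/16)(15/17) = 15/16.\<close>
  define w where "w = (16/17::real)"
  have "summable (\<lambda>k. ((- q / 2) gchoose k) * w ^ k)"
    using gen_binomial_real[of w "- q / 2"] by (auto simp: w_def intro: sums_summable)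
  then have "summable (\<lambda>k. b k * w ^ k)" unfolding b_def mult.assoc by (rule summable_mult)
  then have "Bseq (\<lambda>k. b k * w ^ k)" by (intro convergent_imp_Bseq convergentI[OF summable_LIMSEQ_zero])
  then obtain B where B: "0 < B" "\<And>k. \<bar>b k * w ^ k\<bar> \<le> B" by (auto elim: BseqE)
  have bb: "\<bar>b k\<bar> \<le> B * (17/16) ^ k" for k
    using B(2)[of k] by (simp add: w_def abs_mult power_divide field_simps)
  define Z where "Z = 16 * real CARD('n) / A + 1"
  have Z: "1 \<le> Z" by (simp add: Z_def A_def)
  have zrep: "poly_rep 2 Z (z :: real^'n \<Rightarrow> real^'n \<Rightarrow> real)"
  proof -
    have sq: "poly_rep 2 16 (\<lambda>x y. (x $ i - y $ i)\<^sup>2)" for i :: 'n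
      using poly_rep_power[OF poly_rep_coord, of 2 i] by simp
    have "poly_rep 2 (\<Sum>i\<in>(UNIV::'n set). 16) (\<lambda>x y. \<Sum>i\<in>(UNIV::'n set). (x $ i - y $ i)\<^sup>2)"
      by (rule poly_rep_sum[where M="\<lambda>_. 16" and F="\<lambda>i x y. (x $ i - y $ i)\<^sup>2"]) (auto intro: sq)
    from poly_rep_mult[OF poly_rep_const[of "1/A"] this]
    have "poly_rep 2 (16 * real CARD('n) / A) (\<lambda>x y. (\<Sum>i\<in>(UNIV::'n set). (x $ i - y $ i)\<^sup>2) / A)"
      by (simp add: A_def mult.commute numeral_2_eq_2)
    from poly_rep_add[OF this poly_rep_mono[OF poly_rep_const[of "-1"], of 2 1]]
    show ?thesis unfolding Z_def z_def by (simp add: norm_vec_def L2_set_def sum_nonneg)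
  qed
  \<comment> \<open>The factor 2 pays for the N + 1 summands, as N + 1 <= 2^N.\<close>
  define M where "M = 2 * (Z * (17/16))"
  have M: "1 \<le> Z * (17/16)" "1 \<le> M" using Z by (auto simp: M_def)
  \<comment> \<open>The geometric tail sums to 16 times its first term; adding 1 ensures
    \<open>1 \<le> C\<close>.\<close>
  define C where "C = 16 * B + 1"
  have rep: "poly_rep (2 * N) (C * M ^ N) (\<lambda>x y. \<Sum>k\<le>N. b k * (z x y :: real) ^ k)" for N
  proof -
    have rk: "poly_rep (2 * N) (B * (Z * (17/16)) ^ N) (\<lambda>x y. b k * z x y ^ k)" if "k \<in> {..N}" for k
    proof -
      have rk0: "poly_rep (k * 2) (\<bar>b k\<bar> * Z ^ k) (\<lambda>x y. b k * (z x y :: real) ^ k)"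
        using poly_rep_mult[OF poly_rep_const[of "b k"] poly_rep_power[OF zrep, of k]] Z by simp
      have "\<bar>b k\<bar> * Z ^ k \<le> B * (17/16) ^ k * Z ^ k" using bb[of k] Z by (intro mult_right_mono) auto
      moreover have "B * (17/16) ^ k * Z ^ k = B * (Z * (17/16)) ^ k" by (simp only: power_mult_distrib mult_ac)
      moreover have "B * (Z * (17/16)) ^ k \<le> B * (Z * (17/16)) ^ N"
        using B(1) M(1) that by (intro mult_left_mono power_increasing) auto
      ultimately have le: "\<bar>b k\<bar> * Z ^ k \<le> B * (Z * (17/16)) ^ N" by linarith
      show ?thesis by (rule poly_rep_mono[OF rk0 _ le]) (use that in auto)
    qed
    have r: "poly_rep (2 * N) (\<Sum>k\<le>N. B * (Z * (17/16)) ^ N) (\<lambda>x y. \<Sum>k\<le>N. b k * (z x y :: real) ^ k)"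
      by (rule poly_rep_sum[OF finite_atMost rk])
    have "real (N + 1) \<le> 2 ^ N"
    proof -
      have "N + 1 \<le> 2 ^ N" by (metis Suc_eq_plus1 Suc_leI less_exp)
      then have "real (N + 1) \<le> real (2 ^ N)" by (rule of_nat_mono)
      then show ?thesis by simp
    qed
    then have "real (N + 1) * (B * (Z * (17/16)) ^ N) \<le> 2 ^ N * (B * (Z * (17/16)) ^ N)"
      using B(1) M(1) by (intro mult_right_mono) auto
    also have "\<dots> = B * M ^ N" by (simp only: M_def power_mult_distrib mult_ac)
    also have "\<dots> \<le> C * M ^ N" using B(1) M(2) by (intro mult_right_mono) (auto simp: C_def)
    finally have "(\<Sum>k\<le>N. B * (Z * (17/16)) ^ N) \<le> C * M ^ N" by simp
    from poly_rep_mono[OF r order_refl this] show ?thesis .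
  qed
  have tail: "\<bar>norm (x - y) powr (- q) - (\<Sum>k\<le>N. b k * z x y ^ k)\<bar> \<le> C * (15/16) ^ N"
    if "norm x \<le> 1" "2 \<le> norm y" "norm y \<le> 3" for x y :: "real^'n" and N
  proof -
    have g: "(\<lambda>k. B * (15/16) ^ (N + 1) * (15/16) ^ k) sums (B * (15/16) ^ (N + 1) * (1 / (1 - 15/16)))"
      by (intro sums_mult geometric_sums) auto
    have "(\<lambda>k. b (k + (N + 1)) * z x y ^ (k + (N + 1))) sums (norm (x - y) powr (- q) - (\<Sum>k<N + 1. b k * z x y ^ k))"
      by (subst sums_iff_shift) (simp only: diff_add_cancel ser[OF that])
    then have s: "(\<lambda>k. b (k + (N + 1)) * z x y ^ (k + (N + 1))) sums (norm (x - y) powr (- q) - (\<Sum>k\<le>N. b k * z x y ^ k))"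
      by (simp add: lessThan_Suc_atMost)
    have le: "\<bar>b j * z x y ^ j\<bar> \<le> B * (15/16) ^ j" for j
    proof -
      have "\<bar>b j\<bar> * \<bar>z x y\<bar> ^ j \<le> (B * (17/16) ^ j) * (15/17) ^ j"
        using bb[of j] zle[OF that] B(1) by (intro mult_mono power_mono) auto
      also have "\<dots> = B * ((17/16) * (15/17)) ^ j" by (simp only: power_mult_distrib mult_ac)
      finally show ?thesis by (simp add: abs_mult power_abs)
    qed
    have le': "norm (b (k + (N + 1)) * z x y ^ (k + (N + 1))) \<le> B * (15/16) ^ (N + 1) * (15/16) ^ k" for k
      using le[of "k + (N + 1)"] by (simp add: power_add mult_ac)
    have "norm (\<Sum>k. b (k + (N + 1)) * z x y ^ (k + (N + 1))) \<le> (\<Sum>k. B * (15/16) ^ (N + 1) * (15/16) ^ k)"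
      by (rule norm_suminf_le[OF le' sums_summable[OF g]])
    then have "\<bar>norm (x - y) powr (- q) - (\<Sum>k\<le>N. b k * z x y ^ k)\<bar> \<le> B * (15/16) ^ (N + 1) * (1 / (1 - 15/16))"
      using sums_unique[OF s] sums_unique[OF g] by simp
    also have "\<dots> \<le> C * (15/16) ^ N" using B(1) by (simp add: C_def algebra_simps)
    finally show ?thesis .
  qed
  have "\<exists>a :: ('n \<Rightarrow> nat) \<Rightarrow> real^'n \<Rightarrow> real.
     (\<forall>\<alpha>. a \<alpha> \<in> borel_measurable borel) \<and>
     (\<forall>y. norm y \<le> 3 \<longrightarrow> (\<Sum>\<alpha>\<in>midx (2 * N). \<bar>a \<alpha> y\<bar>) \<le> C * M ^ N) \<and>
     (\<forall>x y. norm x \<le> 1 \<longrightarrow> 2 \<le> norm y \<longrightarrow> norm y \<le> 3 \<longrightarrow>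
        \<bar>norm (x - y) powr (- q) - (\<Sum>\<alpha>\<in>midx (2 * N). monom_at \<alpha> x * a \<alpha> y)\<bar> \<le> C * (15/16) ^ N)" for N
  proof -
    obtain a :: "('n \<Rightarrow> nat) \<Rightarrow> real^'n \<Rightarrow> real" where a: "\<forall>\<alpha>. a \<alpha> \<in> borel_measurable borel"
      "\<And>x y. (\<Sum>k\<le>N. b k * z x y ^ k) = (\<Sum>\<alpha>\<in>midx (2 * N). monom_at \<alpha> x * a \<alpha> y)"
      "\<forall>y. norm y \<le> 3 \<longrightarrow> (\<Sum>\<alpha>\<in>midx (2 * N). \<bar>a \<alpha> y\<bar>) \<le> C * M ^ N"
      using rep[of N] unfolding poly_rep_def by blast
    show ?thesis using a(1,3) tail[of _ _ N] unfolding a(2) by blast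
  qed
  moreover have "1 \<le> C" using B(1) by (simp add: C_def)
  moreover have "0 < (15/16::real)" "(15/16::real) < 1" by auto
  ultimately show ?thesis using M(2) by blast
qed

section \<open>The Dirichlet-to-Neumann pairing\<close>

text \<open>On separated supports the kernel is at most 1, so the product of two integrable
  functions dominates and Fubini applies. The swapped integrand is included because the form
  produces every cross term twice.\<close>

lemma kernel_pair:
  fixes A B :: "'n::finite fn" and q :: real
  assumes A: "integrable lborel A" and B: "integrable lborel B" and q: "0 \<le> q"
    and sep: "\<forall>x y. A x \<noteq> 0 \<longrightarrow> B y \<noteq> 0 \<longrightarrow> 1 \<le> norm (x - y)"
  defines "T \<equiv> \<lambda>p. A (fst p) * B (snd p) * norm (fst p - snd p) powr (- q)"
  shows "integrable plane T" "integrable plane (\<lambda>p. T (snd p, fst p))"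
    "(\<integral>p. T p \<partial>plane) = (\<integral>x. A x * (\<integral>y. B y * norm (x - y) powr (- q) \<partial>lborel) \<partial>lborel)"
    "(\<integral>p. T (snd p, fst p) \<partial>plane) = (\<integral>p. T p \<partial>plane)"
proof -
  have [measurable]: "A \<in> borel_measurable borel" "B \<in> borel_measurable borel" using A B by auto
  have Tm [measurable]: "T \<in> borel_measurable plane" unfolding T_def by measurable
  have AB: "integrable plane (\<lambda>p. A (fst p) * B (snd p))"
  proof (rule lborel_pair.Fubini_integrable)
    show "(\<lambda>p. A (fst p) * B (snd p)) \<in> borel_measurable plane" by measurable
    show "integrable lborel (\<lambda>x. \<integral>y. norm (A (fst (x, y)) * B (snd (x, y))) \<partial>lborel)"
      using A B by (simp add: abs_mult)
    show "AE x in lborel. integrable lborel (\<lambda>y. A (fst (x, y)) * B (snd (x, y)))" using B by simp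
  qed
  show iT: "integrable plane T"
  proof (rule Bochner_Integration.integrable_bound[OF AB Tm], intro AE_I2)
    fix p
    have le1: "norm (fst p - snd p) powr (- q) \<le> 1" if "A (fst p) \<noteq> 0" "B (snd p) \<noteq> 0"
      using sep that q powr_mono2'[of "- q" 1 "norm (fst p - snd p)"] by simp
    have "\<bar>A (fst p)\<bar> * \<bar>B (snd p)\<bar> * norm (fst p - snd p) powr (- q) \<le> \<bar>A (fst p)\<bar> * \<bar>B (snd p)\<bar> * 1"
    proof (cases "A (fst p) = 0 \<or> B (snd p) = 0")
      case False
      with le1 show ?thesis by (intro mult_left_mono) auto
    qed auto
    then show "norm (T p) \<le> norm (A (fst p) * B (snd p))" by (simp add: T_def abs_mult)
  qed
  show "integrable plane (\<lambda>p. T (snd p, fst p))"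
    using lborel_pair.integrable_product_swap[OF iT] by (simp add: case_prod_unfold)
  show "(\<integral>p. T (snd p, fst p) \<partial>plane) = (\<integral>p. T p \<partial>plane)"
    using lborel_pair.integral_product_swap[OF Tm] by (simp add: case_prod_unfold)
  have "(\<integral>p. T p \<partial>plane) = (\<integral>x. \<integral>y. T (x, y) \<partial>lborel \<partial>lborel)"
    by (rule lborel_pair.integral_fst'[OF iT, symmetric])
  also have "\<dots> = (\<integral>x. A x * (\<integral>y. B y * norm (x - y) powr (- q) \<partial>lborel) \<partial>lborel)"
    by (simp add: T_def mult.assoc)
  finally show "(\<integral>p. T p \<partial>plane) = (\<integral>x. A x * (\<integral>y. B y * norm (x - y) powr (- q) \<partial>lborel) \<partial>lborel)" .
qed

section \<open>Exterior data and their potentials\<close>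

definition Ann :: "(real^'n::finite) set" where "Ann = ball 0 3 - cball 0 2"

lemma mem_Ann: "x \<in> Ann \<longleftrightarrow> 2 < norm x \<and> norm x < 3" by (auto simp: Ann_def)

text \<open>Pointwise counterpart of \<open>Hs_annulus\<close>; restricting data to
  \<open>Ann\<close> alters them on a null set only.\<close>

definition Hann :: "real \<Rightarrow> ('n::finite fn) set" where
  "Hann s = {f \<in> Hs s. \<forall>x. x \<notin> Ann \<longrightarrow> f x = 0}"

text \<open>At points away from the support of \<open>f\<close> this is minus the fractional
  Laplacian of \<open>f\<close>.\<close>

definition pot :: "real \<Rightarrow> 'n::finite fn \<Rightarrow> 'n fn" where
  "pot s f x = C_ns CARD('n) s * (\<integral>y. f y * norm (x - y) powr (- (real CARD('n) + 2 * s)) \<partial>lborel)"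

lemma gagliardo_kernel:
  fixes u v :: "'n::finite fn"
  shows "gagliardo s u v p = (u (fst p) - u (snd p)) * (v (fst p) - v (snd p)) * norm (fst p - snd p) powr (- (real CARD('n) + 2 * s))"
  unfolding gagliardo_def divide_inverse powr_minus by simp

lemma sq_integrable_indicator_cball: "sq_integrable lborel (indicator (cball (0::real^'n::finite) r))"
proof -
  have "(\<lambda>x::real^'n. (indicator (cball 0 r) x :: real)\<^sup>2) = indicator (cball 0 r)" by (auto simp: indicator_def)
  then show ?thesis by (auto simp: sq_integrable_def intro!: borel_measurable_indicator
      integrable_real_indicator emeasure_bounded_finite[unfolded infinity_ennreal_def])
qed

lemma Hann_L1:
  fixes f :: "'n::finite fn"
  assumes "f \<in> Hann s"
  shows "integrable lborel f"
    "(\<integral>x. \<bar>f x\<bar> \<partial>lborel) \<le> sqrt (measure lborel (cball (0::real^'n) 3)) * sqrt (\<integral>x. (f x)\<^sup>2 \<partial>lborel)"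
proof -
  have f: "sq_integrable lborel f" and z: "\<And>x. 3 \<le> norm x \<Longrightarrow> f x = 0"
    using assms by (auto simp: Hann_def Hs_iff mem_Ann)
  have af: "sq_integrable lborel (\<lambda>x. \<bar>f x\<bar>)" using f by (auto simp: sq_integrable_def)
  have eq: "indicator (cball 0 3) x * f x = f x" "indicator (cball 0 3) x * \<bar>f x\<bar> = \<bar>f x\<bar>" for x
    using z[of x] by (auto simp: indicator_def)
  show "integrable lborel f"
    using sq_integrable_mult[OF sq_integrable_indicator_cball[of 3] f] by (simp add: eq)
  have "(indicator (cball (0::real^'n) 3) x :: real)\<^sup>2 = indicator (cball 0 3) x" for x by (auto simp: indicator_def)
  then show "(\<integral>x. \<bar>f x\<bar> \<partial>lborel) \<le> sqrt (measure lborel (cball (0::real^'n) 3)) * sqrt (\<integral>x. (f x)\<^sup>2 \<partial>lborel)"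
    using integral_Cauchy_Schwarz_abs[OF sq_integrable_indicator_cball[of 3] af] by (simp add: eq)
qed

lemma norm_diff_ge_1: "norm x \<le> 1 \<Longrightarrow> 2 < norm y \<Longrightarrow> 1 \<le> norm (x - y)"
  using norm_triangle_ineq2[of y x] by (simp add: norm_minus_commute)

lemma pot_measurable [measurable]:
  assumes [measurable]: "f \<in> borel_measurable borel"
  shows "pot s f \<in> borel_measurable borel"
  unfolding pot_def by measurable

section \<open>The reduced problem and its linearity\<close>

definition weak :: "real \<Rightarrow> 'n::finite fn \<Rightarrow> 'n fn \<Rightarrow> 'n fn \<Rightarrow> bool" where
  "weak s \<gamma> F v \<longleftrightarrow> v \<in> H0 s \<and> (\<forall>\<phi>\<in>H0 s. Bform s \<gamma> v \<phi> = load \<gamma> F \<phi>)"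

definition bdd_fn :: "'n::finite fn \<Rightarrow> real \<Rightarrow> bool" where
  "bdd_fn F b \<longleftrightarrow> F \<in> borel_measurable borel \<and> (\<forall>x. norm x \<le> 1 \<longrightarrow> \<bar>F x\<bar> \<le> b)"

lemma bdd_fnD: "bdd_fn F b \<Longrightarrow> F \<in> borel_measurable borel" "bdd_fn F b \<Longrightarrow> norm x \<le> 1 \<Longrightarrow> \<bar>F x\<bar> \<le> b"
  by (auto simp: bdd_fn_def)

lemma load_lin_left:
  assumes \<gamma>: "adm \<gamma>" and F: "bdd_fn F b" and G: "bdd_fn G c" and \<phi>: "\<phi> \<in> H0 s"
  shows "load \<gamma> (\<lambda>x. k * F x + m * G x) \<phi> = k * load \<gamma> F \<phi> + m * load \<gamma> G \<phi>"
proof -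
  have "load \<gamma> (\<lambda>x. k * F x + m * G x) \<phi> = (\<integral>x. k * (sqrt (\<gamma> x) * F x * \<phi> x) + m * (sqrt (\<gamma> x) * G x * \<phi> x) \<partial>lborel)"
    unfolding load_def by (simp add: algebra_simps)
  also have "\<dots> = k * load \<gamma> F \<phi> + m * load \<gamma> G \<phi>"
    using load_integrable[OF \<gamma> bdd_fnD[OF F] \<phi>] load_integrable[OF \<gamma> bdd_fnD[OF G] \<phi>] by (simp add: load_def)
  finally show ?thesis .
qed

lemma bdd_fn_lin: "bdd_fn F b \<Longrightarrow> bdd_fn G c \<Longrightarrow> bdd_fn (\<lambda>x. k * F x + m * G x) (\<bar>k\<bar> * b + \<bar>m\<bar> * c)"
  unfolding bdd_fn_def
  by (auto intro!: order_trans[OF abs_triangle_ineq] add_mono mult_left_mono simp: abs_mult)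

text \<open>The four statements are proved in one induction, since adding a summand uses the
  boundedness of the partial right-hand side and the membership of the partial solution in
  \<open>H0\<close>.\<close>

lemma weak_sum:
  assumes s: "0 < s" "s < 1" and \<gamma>: "adm \<gamma>" and "finite I"
    and F: "\<And>i. i \<in> I \<Longrightarrow> bdd_fn (F i) 1" and w: "\<And>i. i \<in> I \<Longrightarrow> weak s \<gamma> (F i) (w i)"
  shows "weak s \<gamma> (\<lambda>x. \<Sum>i\<in>I. d i * F i x) (\<lambda>x. \<Sum>i\<in>I. d i * w i x) \<and> bdd_fn (\<lambda>x. \<Sum>i\<in>I. d i * F i x) (\<Sum>i\<in>I. \<bar>d i\<bar>) \<and>
    (\<forall>\<phi>\<in>H0 s. load \<gamma> (\<lambda>x. \<Sum>i\<in>I. d i * F i x) \<phi> = (\<Sum>i\<in>I. d i * load \<gamma> (F i) \<phi>)) \<and>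
    (\<forall>G b. bdd_fn G b \<longrightarrow> load \<gamma> G (\<lambda>x. \<Sum>i\<in>I. d i * w i x) = (\<Sum>i\<in>I. d i * load \<gamma> G (w i)))"
  using assms(4-)
proof (induction I rule: finite_induct)
  case empty
  have "Bform s \<gamma> (\<lambda>x. 0) \<phi> = 0" for \<phi> by (simp add: Bform_def gagliardo_def)
  then show ?case using zero_in_H0[of s] by (auto simp: weak_def bdd_fn_def load_def)
next
  case (insert i I)
  let ?F = "\<lambda>x. \<Sum>i\<in>I. d i * F i x" and ?w = "\<lambda>x. \<Sum>i\<in>I. d i * w i x"
  have IH: "weak s \<gamma> ?F ?w" "bdd_fn ?F (\<Sum>i\<in>I. \<bar>d i\<bar>)" "\<And>\<phi>. \<phi> \<in> H0 s \<Longrightarrow> load \<gamma> ?F \<phi> = (\<Sum>i\<in>I. d i * load \<gamma> (F i) \<phi>)"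
    "\<And>G b. bdd_fn G b \<Longrightarrow> load \<gamma> G ?w = (\<Sum>i\<in>I. d i * load \<gamma> G (w i))"
    using insert by auto
  have i: "bdd_fn (F i) 1" "weak s \<gamma> (F i) (w i)" using insert by auto
  have wH: "w i \<in> H0 s" "?w \<in> H0 s" using i IH by (auto simp: weak_def)
  have eqF: "(\<lambda>x. \<Sum>i\<in>insert i I. d i * F i x) = (\<lambda>x. d i * F i x + 1 * ?F x)" using insert by auto
  have eqw: "(\<lambda>x. \<Sum>i\<in>insert i I. d i * w i x) = (\<lambda>x. d i * w i x + 1 * ?w x)" using insert by auto
  have l: "load \<gamma> (\<lambda>x. d i * F i x + 1 * ?F x) \<phi> = d i * load \<gamma> (F i) \<phi> + 1 * load \<gamma> ?F \<phi>" if "\<phi> \<in> H0 s" for \<phi>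
    by (rule load_lin_left[OF \<gamma> i(1) IH(2) that])
  have "weak s \<gamma> (\<lambda>x. d i * F i x + 1 * ?F x) (\<lambda>x. d i * w i x + 1 * ?w x)"
    unfolding weak_def
  proof (intro conjI ballI H0_lin wH)
    fix \<phi> :: "'a fn" assume \<phi>: "\<phi> \<in> H0 s"
    show "Bform s \<gamma> (\<lambda>x. d i * w i x + 1 * ?w x) \<phi> = load \<gamma> (\<lambda>x. d i * F i x + 1 * ?F x) \<phi>"
      unfolding l[OF \<phi>] Bform_lin[OF s \<gamma> H0_Hs[OF wH(1)] H0_Hs[OF wH(2)] H0_Hs[OF \<phi>]]
      using i(2) IH(1) \<phi> by (simp add: weak_def)
  qed
  moreover have "bdd_fn (\<lambda>x. d i * F i x + 1 * ?F x) (\<Sum>i\<in>insert i I. \<bar>d i\<bar>)"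
    using bdd_fn_lin[OF i(1) IH(2), of "d i" 1] insert(1,2) by simp
  moreover have "load \<gamma> (\<lambda>x. d i * F i x + 1 * ?F x) \<phi> = (\<Sum>i\<in>insert i I. d i * load \<gamma> (F i) \<phi>)" if "\<phi> \<in> H0 s" for \<phi>
    unfolding l[OF that] using IH(3)[OF that] insert(1,2) by simp
  moreover have "load \<gamma> G (\<lambda>x. d i * w i x + 1 * ?w x) = (\<Sum>i\<in>insert i I. d i * load \<gamma> G (w i))" if "bdd_fn G b" for G b
    using load_lin_right[OF \<gamma> bdd_fnD[OF that] wH, of "d i" 1] IH(4)[OF that] insert(1,2) by simp
  ultimately show ?case unfolding eqF eqw by blast
qed

text \<open>Both sides equal \<open>Bform s \<gamma> v w\<close>: the solution operator is
  symmetric.\<close>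

lemma weak_load_sym:
  assumes s: "0 < s" "s < 1" and "weak s \<gamma> F v" "weak s \<gamma> G w"
  shows "load \<gamma> G v = load \<gamma> F w"
  using assms(3,4) Bform_sym[OF s, of \<gamma> v w] by (simp add: weak_def)

context
  fixes s :: real
  assumes s: "0 < s" "s < 1"
begin

text \<open>Because v g = 0, only the cross terms -v(x)g(y) and -v(y)g(x) survive, and by symmetry
  they contribute equally, cancelling the factor 1/2. In the annulus \<open>\<gamma>\<close> is 1,
  which leaves a single factor \<open>sqrt \<gamma>\<close> at the point of the ball; this explains
  the weight in \<open>load\<close>.\<close>

lemma Bform_H0_Hann:
  fixes \<gamma> :: "'n::finite fn"
  assumes \<gamma>: "adm \<gamma>" and v: "v \<in> H0 s" and g: "g \<in> Hann s"
  shows "Bform s \<gamma> v g = - load \<gamma> (pot s g) v"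
proof -
  let ?q = "real CARD('n) + 2 * s" and ?C = "C_ns CARD('n) s"
  define A where "A x = sqrt (\<gamma> x) * v x" for x
  have [measurable]: "\<gamma> \<in> borel_measurable borel" by (rule adm_measurable[OF \<gamma>])
  have [measurable]: "v \<in> borel_measurable borel" using v by (auto simp: H0_def Hs_iff)
  have v0: "v x = 0" if "1 < norm x" for x using v that by (auto simp: H0_def)
  have g0: "g x = 0" if "x \<notin> Ann" for x using g that by (auto simp: Hann_def)
  have g1: "\<gamma> x = 1" if "1 < norm x" for x using \<gamma> that by (auto simp: adm_def)
  have A: "integrable lborel A"
  proof (rule Bochner_Integration.integrable_bound)
    show "integrable lborel (\<lambda>x. 2 * v x)" using H0_integrable[OF v] by simp
    show "A \<in> borel_measurable lborel" unfolding A_def by measurable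
    have "\<bar>sqrt (\<gamma> x)\<bar> \<le> 2" for x using adm_sqrt[OF \<gamma>, of x] by linarith
    then show "AE x in lborel. norm (A x) \<le> norm (2 * v x)"
      by (intro AE_I2) (simp only: A_def abs_mult real_norm_def, simp add: mult_right_mono)
  qed
  have sep: "\<forall>x y. A x \<noteq> 0 \<longrightarrow> g y \<noteq> 0 \<longrightarrow> 1 \<le> norm (x - y)"
  proof (intro allI impI norm_diff_ge_1)
    fix x y assume that: "A x \<noteq> 0" "g y \<noteq> 0"
    show "norm x \<le> 1" using that v0[of x] by (auto simp: A_def not_less[symmetric])
    show "2 < norm y" using that g0[of y] by (auto simp: mem_Ann)
  qed
  define T where "T = (\<lambda>p. A (fst p) * g (snd p) * norm (fst p - snd p) powr (- ?q))"
  have q0: "0 \<le> ?q" using s by simp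
  note kp = kernel_pair[OF A Hann_L1(1)[OF g] q0 sep, folded T_def]
  have kp2: "integrable plane (\<lambda>p. T (snd p, fst p))" "(\<integral>p. T (snd p, fst p) \<partial>plane) = (\<integral>p. T p \<partial>plane)"
    using kp(2,4) by (simp_all only: T_def fst_conv snd_conv)
  have eq: "sqrt (\<gamma> (fst p)) * sqrt (\<gamma> (snd p)) * gagliardo s v g p = - (T p + T (snd p, fst p))" for p
  proof -
    obtain x y where p: "p = (x, y)" by force
    have z: "v x * g x = 0" for x
      using v0[of x] g0[of x] by (cases "norm x \<le> 1") (auto simp: mem_Ann)
    have sg: "sqrt (\<gamma> x) * g x = g x" for x
      using g1[of x] g0[of x] by (cases "norm x \<le> 1") (auto simp: mem_Ann)
    have h: "sqrt (\<gamma> x) * sqrt (\<gamma> y) * (v x * g y) = sqrt (\<gamma> x) * v x * g y"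
        "sqrt (\<gamma> x) * sqrt (\<gamma> y) * (v y * g x) = sqrt (\<gamma> y) * v y * g x"
      using sg[of y] sg[of x] by (metis mult.commute mult.left_commute)+
    have "sqrt (\<gamma> x) * sqrt (\<gamma> y) * ((v x - v y) * (g x - g y)) 
       = sqrt (\<gamma> x) * sqrt (\<gamma> y) * (v x * g x + v y * g y) - (sqrt (\<gamma> x) * sqrt (\<gamma> y) * (v x * g y) + sqrt (\<gamma> x) * sqrt (\<gamma> y) * (v y * g x))"
      by (simp add: algebra_simps)
    also have "\<dots> = - (A x * g y + A y * g x)" unfolding h by (simp add: z A_def)
    finally have "sqrt (\<gamma> x) * sqrt (\<gamma> y) * ((v x - v y) * (g x - g y)) = - (A x * g y + A y * g x)" .
    then have "sqrt (\<gamma> x) * sqrt (\<gamma> y) * ((v x - v y) * (g x - g y)) * norm (x - y) powr (- ?q) = - (A x * g y + A y * g x) * norm (x - y) powr (- ?q)"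
      by (rule arg_cong)
    then show ?thesis unfolding gagliardo_kernel T_def p by (simp add: norm_minus_commute[of y x] algebra_simps)
  qed
  have "Bform s \<gamma> v g = ?C / 2 * (\<integral>p. - (T p + T (snd p, fst p)) \<partial>plane)"
    unfolding Bform_def eq ..
  also have "\<dots> = - ?C * (\<integral>p. T p \<partial>plane)" using kp(1) kp2 by simp
  also have "\<dots> = - (\<integral>x. ?C * (A x * (\<integral>y. g y * norm (x - y) powr (- ?q) \<partial>lborel)) \<partial>lborel)"
    unfolding kp(3) by simp
  also have "\<dots> = - load \<gamma> (pot s g) v"
    unfolding load_def pot_def A_def by (simp only: mult_ac)
  finally show ?thesis .
qed

text \<open>Compared with conductivity 1, pairs with both points in the ball contribute nothing as
  the data vanish there, and pairs with both points outside see no change. A pair with exactly one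
  point in the ball contributes f g at the outer point times \<open>sqrt \<gamma> - 1\<close> at the
  inner one, which is where the moments \<open>Pm\<close> come from.\<close>

lemma Bform_Hann:
  fixes \<gamma> :: "'n::finite fn"
  assumes \<gamma>: "adm \<gamma>" and f: "f \<in> Hann s" and g: "g \<in> Hann s"
  shows "Bform s \<gamma> f g = Bform s (\<lambda>_. 1) f g + (\<integral>x. f x * g x * pot s (\<lambda>y. sqrt (\<gamma> y) - 1) x \<partial>lborel)"
proof -
  let ?q = "real CARD('n) + 2 * s" and ?C = "C_ns CARD('n) s"
  have [measurable]: "\<gamma> \<in> borel_measurable borel" by (rule adm_measurable[OF \<gamma>])
  have f0: "f x = 0" if "x \<notin> Ann" for x using f that by (auto simp: Hann_def)
  have g0: "g x = 0" if "x \<notin> Ann" for x using g that by (auto simp: Hann_def)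
  have g1: "\<gamma> x = 1" if "1 < norm x" for x using \<gamma> that by (auto simp: adm_def)
  define B where "B x = sqrt (\<gamma> x) - 1" for x
  have Bi: "integrable lborel B"
  proof (rule Bochner_Integration.integrable_bound)
    show "integrable lborel (indicator (cball (0::real^'n) 1) :: _ \<Rightarrow> real)"
      by (intro integrable_real_indicator) (auto intro!: emeasure_bounded_finite[unfolded infinity_ennreal_def])
    show "B \<in> borel_measurable lborel" unfolding B_def by measurable
    show "AE x in lborel. norm (B x) \<le> norm (indicator (cball (0::real^'n) 1) x :: real)"
    proof (intro AE_I2)
      fix x show "norm (B x) \<le> norm (indicator (cball (0::real^'n) 1) x :: real)"
        using adm_sqrt[OF \<gamma>, of x] g1[of x] by (cases "norm x \<le> 1") (auto simp: B_def)
    qed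
  qed
  have fg: "integrable lborel (\<lambda>x. f x * g x)" using f g by (intro sq_integrable_mult) (auto simp: Hann_def Hs_iff)
  have sep: "\<forall>x y. f x * g x \<noteq> 0 \<longrightarrow> B y \<noteq> 0 \<longrightarrow> 1 \<le> norm (x - y)"
  proof (intro allI impI)
    fix x y assume that: "f x * g x \<noteq> 0" "B y \<noteq> 0"
    have "1 \<le> norm (y - x)"
    proof (rule norm_diff_ge_1)
      show "norm y \<le> 1" using that g1[of y] by (auto simp: B_def not_less[symmetric])
      show "2 < norm x" using that f0[of x] by (auto simp: mem_Ann)
    qed
    then show "1 \<le> norm (x - y)" by (simp only: norm_minus_commute)
  qed
  define T where "T = (\<lambda>p. f (fst p) * g (fst p) * B (snd p) * norm (fst p - snd p) powr (- ?q))"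
  have q0: "0 \<le> ?q" using s by simp
  note kp = kernel_pair[OF fg Bi q0 sep, folded T_def]
  have kp2: "integrable plane (\<lambda>p. T (snd p, fst p))" "(\<integral>p. T (snd p, fst p) \<partial>plane) = (\<integral>p. T p \<partial>plane)"
    using kp(2,4) by (simp_all only: T_def fst_conv snd_conv)
  have eq: "sqrt (\<gamma> (fst p)) * sqrt (\<gamma> (snd p)) * gagliardo s f g p = sqrt 1 * sqrt 1 * gagliardo s f g p + (T p + T (snd p, fst p))" for p
  proof -
    obtain x y where p: "p = (x, y)" by force
    let ?D = "(f x - f y) * (g x - g y)"
    have "sqrt (\<gamma> x) * sqrt (\<gamma> y) * ?D = ?D + (f x * g x * B y + f y * g y * B x)"
    proof (cases "norm x \<le> 1"; cases "norm y \<le> 1")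
      assume "norm x \<le> 1" "norm y \<le> 1"
      then have "f x = 0" "f y = 0" by (auto intro!: f0 simp: mem_Ann)
      then show ?thesis by simp
    next
      assume "norm x \<le> 1" "\<not> norm y \<le> 1"
      then have "f x = 0" "g x = 0" "\<gamma> y = 1" by (auto intro!: f0 g0 g1 simp: mem_Ann)
      then show ?thesis by (simp add: B_def algebra_simps)
    next
      assume "\<not> norm x \<le> 1" "norm y \<le> 1"
      then have "f y = 0" "g y = 0" "\<gamma> x = 1" by (auto intro!: f0 g0 g1 simp: mem_Ann)
      then show ?thesis by (simp add: B_def algebra_simps)
    next
      assume "\<not> norm x \<le> 1" "\<not> norm y \<le> 1"
      then show ?thesis using g1[of x] g1[of y] by (simp add: B_def)
    qed
    then have "sqrt (\<gamma> x) * sqrt (\<gamma> y) * ?D * norm (x - y) powr (- ?q) = (?D + (f x * g x * B y + f y * g y * B x)) * norm (x - y) powr (- ?q)"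
      by (rule arg_cong)
    then show ?thesis unfolding gagliardo_kernel T_def p by (simp add: norm_minus_commute[of y x] algebra_simps)
  qed
  have i1: "integrable plane (\<lambda>p. sqrt 1 * sqrt 1 * gagliardo s f g p)"
    unfolding gagliardo_eq using f g sq_integrable_mult[of plane "dq s f" "dq s g"] by (auto simp: Hann_def Hs_iff)
  have "Bform s \<gamma> f g = ?C / 2 * (\<integral>p. sqrt 1 * sqrt 1 * gagliardo s f g p + (T p + T (snd p, fst p)) \<partial>plane)"
    unfolding Bform_def eq ..
  also have "\<dots> = ?C / 2 * ((\<integral>p. sqrt 1 * sqrt 1 * gagliardo s f g p \<partial>plane) + 2 * (\<integral>p. T p \<partial>plane))"
    using kp(1) kp2 i1 by simp
  also have "\<dots> = Bform s (\<lambda>_. 1) f g + ?C * (\<integral>p. T p \<partial>plane)" unfolding Bform_def by (simp add: algebra_simps)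
  also have "?C * (\<integral>p. T p \<partial>plane) = (\<integral>x. f x * g x * pot s (\<lambda>y. sqrt (\<gamma> y) - 1) x \<partial>lborel)"
    unfolding kp(3) pot_def B_def integral_mult_right_zero[symmetric] by (simp add: mult_ac)
  finally show ?thesis .
qed

lemma pot_bound:
  fixes f :: "'n::finite fn"
  assumes f: "f \<in> Hann s" and x: "norm x \<le> 1"
  shows "integrable lborel (\<lambda>y. f y * norm (x - y) powr (- (real CARD('n) + 2 * s)))"
    "\<bar>pot s f x\<bar> \<le> C_ns CARD('n) s * (\<integral>y. \<bar>f y\<bar> \<partial>lborel)"
proof -
  let ?q = "real CARD('n) + 2 * s" and ?C = "C_ns CARD('n) s"
  have [measurable]: "f \<in> borel_measurable borel" using f by (auto simp: Hann_def Hs_iff)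
  note fi = Hann_L1(1)[OF f]
  have le: "\<bar>f y * norm (x - y) powr (- ?q)\<bar> \<le> \<bar>f y\<bar>" for y
  proof (cases "y \<in> Ann")
    case True
    then have "1 \<le> norm (x - y)" using x by (intro norm_diff_ge_1) (auto simp: mem_Ann)
    then have "norm (x - y) powr (- ?q) \<le> 1" using s powr_mono2'[of "- ?q" 1 "norm (x - y)"] by simp
    then show ?thesis by (simp add: abs_mult mult_left_le)
  next
    case False
    then have "f y = 0" using f by (auto simp: Hann_def)
    then show ?thesis by simp
  qed
  show i: "integrable lborel (\<lambda>y. f y * norm (x - y) powr (- ?q))"
    by (rule Bochner_Integration.integrable_bound[OF fi]) (use le in \<open>auto intro!: AE_I2\<close>)
  have "\<bar>\<integral>y. f y * norm (x - y) powr (- ?q) \<partial>lborel\<bar> \<le> (\<integral>y. \<bar>f y\<bar> \<partial>lborel)"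
    by (rule Bochner_Integration.integral_abs_bound_integral[OF i]) (use fi le in auto)
  then show "\<bar>pot s f x\<bar> \<le> ?C * (\<integral>y. \<bar>f y\<bar> \<partial>lborel)"
    using C_ns_pos[OF s, of "CARD('n)"] by (simp add: pot_def abs_mult)
qed

lemma pot_bdd_fn: "f \<in> Hann s \<Longrightarrow> bdd_fn (pot s (f::'n::finite fn)) (C_ns CARD('n) s * (\<integral>y. \<bar>f y\<bar> \<partial>lborel))"
  unfolding bdd_fn_def using pot_bound(2) by (auto simp: Hann_def Hs_iff intro!: pot_measurable)

lemma weak_exists: "adm \<gamma> \<Longrightarrow> bdd_fn F b \<Longrightarrow> \<exists>v. weak s \<gamma> F v"
  unfolding weak_def using weak_solution_exists[OF s, of \<gamma> F b] bdd_fnD[of F b] by blast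

lemma Hs_annulus_restrict:
  fixes f :: "'n::finite fn"
  assumes "f \<in> Hs_annulus s"
  defines "f' \<equiv> \<lambda>x. if x \<in> Ann then f x else 0"
  shows "f' \<in> Hann s" "AE x in lborel. f x = f' x" "f' \<in> borel_measurable borel"
proof -
  have [measurable]: "f \<in> borel_measurable borel" using assms by (auto simp: Hs_annulus_def Hs_iff)
  have [measurable]: "Ann \<in> sets (borel :: (real^'n) measure)" by (simp add: Ann_def)
  show m: "f' \<in> borel_measurable borel" unfolding f'_def by measurable
  have "AE x in lborel. x \<notin> Ann \<longrightarrow> f x = 0" using assms by (simp add: Hs_annulus_def Ann_def)
  then show ae: "AE x in lborel. f x = f' x" by eventually_elim (auto simp: f'_def)
  have "f' \<in> Hs s" using assms by (intro Hs_cong_AE[OF _ m ae]) (auto simp: Hs_annulus_def)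
  then show "f' \<in> Hann s" by (auto simp: Hann_def f'_def)
qed

text \<open>Ansatz u = f' + v: tested against \<open>H0\<close>, the data act as minus the load of
  \<open>pot s f'\<close>, so \<open>v\<close> has to be the weak solution for that load.\<close>

lemma solution_exists:
  fixes f :: "'n::finite fn"
  assumes n: "2 * s < real CARD('n)" and \<gamma>: "adm \<gamma>" and f: "f \<in> Hs_annulus s"
  shows "\<exists>u. is_solution s \<gamma> f u"
proof -
  define f' where "f' x = (if x \<in> Ann then f x else 0)" for x
  note f' = Hs_annulus_restrict[OF f, folded f'_def]
  obtain v where v: "weak s \<gamma> (pot s f') v" using weak_exists[OF \<gamma> pot_bdd_fn[OF f'(1)]] by blast
  have vH: "v \<in> H0 s" using v by (simp add: weak_def)
  have fH: "f' \<in> Hs s" using f'(1) by (simp add: Hann_def)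
  have "is_solution s \<gamma> f (\<lambda>x. 1 * f' x + 1 * v x)"
    unfolding is_solution_def
  proof (intro conjI allI impI)
    show "(\<lambda>x. 1 * f' x + 1 * v x) \<in> Hs s" by (rule Hs_lin[OF fH H0_Hs[OF vH]])
    show "AE x in lborel. x \<notin> cball 0 1 \<longrightarrow> 1 * f' x + 1 * v x = f x"
      using f'(2) by eventually_elim (use vH in \<open>auto simp: H0_def\<close>)
    fix \<phi> :: "'n fn" assume "test_fun (ball 0 1) \<phi>"
    then have \<phi>: "\<phi> \<in> H0 s" by (rule test_fun_in_H0[OF s])
    have "Bform s \<gamma> (\<lambda>x. 1 * f' x + 1 * v x) \<phi> = Bform s \<gamma> f' \<phi> + Bform s \<gamma> v \<phi>"
      by (subst Bform_lin[OF s \<gamma> fH H0_Hs[OF vH] H0_Hs[OF \<phi>]]) simp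
    also have "Bform s \<gamma> f' \<phi> = - load \<gamma> (pot s f') \<phi>"
      using Bform_H0_Hann[OF \<gamma> \<phi> f'(1)] by (simp add: Bform_sym[OF s])
    finally show "Bform s \<gamma> (\<lambda>x. 1 * f' x + 1 * v x) \<phi> = 0" using v \<phi> by (simp add: weak_def)
  qed
  then show ?thesis by blast
qed

text \<open>This holds for whichever solution \<open>SOME\<close> selects. The function
  \<open>v\<close> is only asserted to exist; the estimates that follow apply to every weak
  solution.\<close>

lemma DN_formula:
  fixes f g :: "'n::finite fn"
  assumes n: "2 * s < real CARD('n)" and \<gamma>: "adm \<gamma>" and f: "f \<in> Hs_annulus s" and g: "g \<in> Hs_annulus s"
  defines "f' \<equiv> \<lambda>x. if x \<in> Ann then f x else 0" and "g' \<equiv> \<lambda>x. if x \<in> Ann then g x else 0"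
  shows "\<exists>v. weak s \<gamma> (pot s f') v \<and> DN s \<gamma> f g = Bform s \<gamma> f' g' - load \<gamma> (pot s g') v"
proof -
  note f' = Hs_annulus_restrict[OF f, folded f'_def] and g' = Hs_annulus_restrict[OF g, folded g'_def]
  define u where "u = (SOME u. is_solution s \<gamma> f u)"
  have sol: "is_solution s \<gamma> f u" unfolding u_def by (rule someI_ex[OF solution_exists[OF n \<gamma> f]])
  then have uH: "u \<in> Hs s" and ue: "AE x in lborel. x \<notin> cball 0 1 \<longrightarrow> u x = f x"
    and u0: "\<And>\<phi>. test_fun (ball 0 1) \<phi> \<Longrightarrow> Bform s \<gamma> u \<phi> = 0" by (auto simp: is_solution_def)
  have [measurable]: "u \<in> borel_measurable borel" "f' \<in> borel_measurable borel" "g' \<in> borel_measurable borel" "g \<in> borel_measurable borel"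
    using uH f' g' g by (auto simp: Hs_iff Hs_annulus_def)
  have um: "u \<in> borel_measurable borel" using uH by (simp add: Hs_iff)
  have g2: "AE x in lborel. g x = g' x" using g'(2) by (simp only: g'_def)
  have gm: "g \<in> borel_measurable borel" using g by (simp add: Hs_annulus_def Hs_iff)
  have fH: "f' \<in> Hs s" using f'(1) by (simp add: Hann_def)
  \<comment> \<open>The cut-off agrees a.e. with u - f', since u = f a.e. off the closed ball, and
    it vanishes off the ball at every point.\<close>
  define v where "v x = (if norm x \<le> 1 then u x else 0)" for x
  have vm [measurable]: "v \<in> borel_measurable borel" unfolding v_def by measurable
  have ae: "AE x in lborel. u x = 1 * f' x + 1 * v x"
    using ue f'(2) by eventually_elim (auto simp: v_def f'_def mem_Ann)
  have vH: "v \<in> H0 s"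
  proof -
    have "(\<lambda>x. 1 * u x + (-1) * f' x) \<in> Hs s" by (rule Hs_lin[OF uH fH])
    moreover have "AE x in lborel. 1 * u x + (-1) * f' x = v x" using ae by eventually_elim simp
    ultimately have "v \<in> Hs s" by (rule Hs_cong_AE[OF _ vm])
    then show ?thesis by (auto simp: H0_def v_def)
  qed
  have \<gamma>m: "\<gamma> \<in> borel_measurable borel" by (rule adm_measurable[OF \<gamma>])
  have split: "Bform s \<gamma> u \<phi> = Bform s \<gamma> f' \<phi> + Bform s \<gamma> v \<phi>" if "\<phi> \<in> Hs s" for \<phi>
  proof -
    have "Bform s \<gamma> u \<phi> = Bform s \<gamma> (\<lambda>x. 1 * f' x + 1 * v x) \<phi>"
      using that by (intro Bform_cong_AE[OF \<gamma>m _ _ _ _ ae]) (auto simp: Hs_iff)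
    then show ?thesis using Bform_lin[OF s \<gamma> fH H0_Hs[OF vH] that, of 1 1] by simp
  qed
  have "weak s \<gamma> (pot s f') v"
    unfolding weak_def
  proof (intro conjI ballI vH)
    fix \<phi> :: "'n fn" assume \<phi>: "\<phi> \<in> H0 s"
    have "Bform s \<gamma> u \<phi> = 0" by (rule Bform_H0_eq_0[OF s n \<gamma> uH u0 \<phi>])
    moreover have "Bform s \<gamma> f' \<phi> = - load \<gamma> (pot s f') \<phi>"
      using Bform_H0_Hann[OF \<gamma> \<phi> f'(1)] by (simp add: Bform_sym[OF s])
    ultimately show "Bform s \<gamma> v \<phi> = load \<gamma> (pot s f') \<phi>" using split[OF H0_Hs[OF \<phi>]] by simp
  qed
  moreover have "DN s \<gamma> f g = Bform s \<gamma> f' g' - load \<gamma> (pot s g') v"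
  proof -
    have "DN s \<gamma> f g = Bform s \<gamma> u g'"
      unfolding DN_def u_def[symmetric] by (rule Bform_cong_AE[OF \<gamma>m um gm um g'(3) _ g2]) simp
    then show ?thesis using split[of g'] g'(1) Bform_H0_Hann[OF \<gamma> vH g'(1)] by (simp add: Hann_def)
  qed
  ultimately show ?thesis by blast
qed

end

section \<open>Finitely many numbers control the pairing\<close>

definition wsol :: "real \<Rightarrow> 'n::finite fn \<Rightarrow> ('n \<Rightarrow> nat) \<Rightarrow> 'n fn" where
  "wsol s \<gamma> \<alpha> = (SOME v. weak s \<gamma> (monom_at \<alpha>) v)"

definition Qm :: "real \<Rightarrow> 'n::finite fn \<Rightarrow> ('n \<Rightarrow> nat) \<Rightarrow> ('n \<Rightarrow> nat) \<Rightarrow> real" where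
  "Qm s \<gamma> \<alpha> \<beta> = load \<gamma> (monom_at \<alpha>) (wsol s \<gamma> \<beta>)"

definition Pm :: "'n::finite fn \<Rightarrow> ('n \<Rightarrow> nat) \<Rightarrow> real" where
  "Pm \<gamma> \<alpha> = (\<integral>x. (sqrt (\<gamma> x) - 1) * monom_at \<alpha> x \<partial>lborel)"

lemma bdd_fn_monom: "bdd_fn (monom_at \<alpha>) 1"
  by (auto simp: bdd_fn_def monom_at_bound)

lemma weak_wsol: "0 < s \<Longrightarrow> s < 1 \<Longrightarrow> adm \<gamma> \<Longrightarrow> weak s \<gamma> (monom_at \<alpha>) (wsol s \<gamma> \<alpha>)"
  unfolding wsol_def by (rule someI_ex[OF weak_exists[OF _ _ _ bdd_fn_monom]])

lemma adm_perturbation: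
  fixes \<gamma> :: "'n::finite fn"
  assumes "adm \<gamma>"
  shows "0 \<le> sqrt (\<gamma> x) - 1" "sqrt (\<gamma> x) - 1 \<le> indicator (cball 0 1) x"
    "integrable lborel (\<lambda>x. (sqrt (\<gamma> x) - 1) * monom_at \<alpha> x)" "integrable lborel (\<lambda>x. sqrt (\<gamma> x) - 1)"
proof -
  have iI: "integrable lborel (indicator (cball (0::real^'n) 1) :: _ \<Rightarrow> real)"
    by (intro integrable_real_indicator) (auto intro!: emeasure_bounded_finite[unfolded infinity_ennreal_def])
  have [measurable]: "\<gamma> \<in> borel_measurable borel" by (rule adm_measurable[OF assms])
  have b: "0 \<le> sqrt (\<gamma> x) - 1 \<and> sqrt (\<gamma> x) - 1 \<le> indicator (cball 0 1) x" for x
  proof (cases "norm x \<le> 1")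
    case True then show ?thesis using adm_sqrt[OF assms, of x] by auto
  next
    case False
    then have "\<gamma> x = 1" using assms by (simp add: adm_def)
    then show ?thesis using False by simp
  qed
  then show "0 \<le> sqrt (\<gamma> x) - 1" "sqrt (\<gamma> x) - 1 \<le> indicator (cball 0 1) x" by blast+
  show "integrable lborel (\<lambda>x. sqrt (\<gamma> x) - 1)"
    by (rule Bochner_Integration.integrable_bound[OF iI]) (use b in auto)
  show "integrable lborel (\<lambda>x. (sqrt (\<gamma> x) - 1) * monom_at \<alpha> x)"
  proof (rule Bochner_Integration.integrable_bound[OF iI], measurable, intro AE_I2)
    fix x
    show "norm ((sqrt (\<gamma> x) - 1) * monom_at \<alpha> x) \<le> norm (indicator (cball (0::real^'n) 1) x :: real)"
    proof (cases "norm x \<le> 1")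
      case True
      then have "\<bar>sqrt (\<gamma> x) - 1\<bar> * \<bar>monom_at \<alpha> x\<bar> \<le> 1 * 1"
        using b[of x] monom_at_bound[OF True, of \<alpha>] by (intro mult_mono) auto
      then show ?thesis using True by (simp add: abs_mult)
    next
      case False
      then have "\<gamma> x = 1" using assms by (simp add: adm_def)
      then show ?thesis by simp
    qed
  qed
qed

text \<open>The separable kernel is integrated against \<open>f\<close>, so c_alpha is the integral
  of f a_alpha up to the factor \<open>C_ns\<close>. Summing over alpha inside the integral uses the
  l1 bound of \<open>a\<close> and avoids a factor for the number of monomials.\<close>

lemma pot_expansion:
  fixes f :: "'n::finite fn" and a :: "('n \<Rightarrow> nat) \<Rightarrow> real^'n \<Rightarrow> real"
  assumes s: "0 < s" "s < 1" and f: "f \<in> Hann s" and L: "(\<integral>y. \<bar>f y\<bar> \<partial>lborel) \<le> L"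
    and am: "\<And>\<alpha>. a \<alpha> \<in> borel_measurable borel" and a: "\<And>y. norm y \<le> 3 \<Longrightarrow> (\<Sum>\<alpha>\<in>I. \<bar>a \<alpha> y\<bar>) \<le> A" and I: "finite I"
    and k: "\<And>x y. norm x \<le> 1 \<Longrightarrow> 2 \<le> norm y \<Longrightarrow> norm y \<le> 3 \<Longrightarrow>
       \<bar>norm (x - y) powr (- (real CARD('n) + 2 * s)) - (\<Sum>\<alpha>\<in>I. monom_at \<alpha> x * a \<alpha> y)\<bar> \<le> e"
  shows "\<exists>c. (\<Sum>\<alpha>\<in>I. \<bar>c \<alpha>\<bar>) \<le> C_ns CARD('n) s * A * L \<and>
     bdd_fn (\<lambda>x. pot s f x - (\<Sum>\<alpha>\<in>I. c \<alpha> * monom_at \<alpha> x)) (C_ns CARD('n) s * e * L)"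
proof -
  let ?C = "C_ns CARD('n) s" and ?q = "real CARD('n) + 2 * s"
  have C: "0 < ?C" by (rule C_ns_pos[OF s])
  have A0: "0 \<le> A" using a[of 0] by (auto intro: order_trans[OF sum_nonneg])
  \<comment> \<open>The sign of \<open>e\<close> is read off from the hypothesis at x = 0 and a
    point of norm 2.\<close>
  have e0: "0 \<le> e"
  proof -
    have "norm ((2::real) *\<^sub>R axis undefined (1::real) :: real^'n) = 2" by (simp add: norm_axis_1)
    then have "\<bar>norm (0 - (2::real) *\<^sub>R axis undefined (1::real) :: real^'n) powr (- ?q) - (\<Sum>\<alpha>\<in>I. monom_at \<alpha> 0 * a \<alpha> ((2::real) *\<^sub>R axis undefined 1))\<bar> \<le> e"
      by (intro k) auto
    then show ?thesis by linarith
  qed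
  have [measurable]: "f \<in> borel_measurable borel" using f by (auto simp: Hann_def Hs_iff)
  note am [measurable]
  note fi = Hann_L1(1)[OF f]
  have f0: "f y = 0" if "y \<notin> Ann" for y using f that by (auto simp: Hann_def)
  have absfi: "integrable lborel (\<lambda>y. \<bar>f y\<bar>)" using fi by simp
  have ale: "\<bar>a \<alpha> y\<bar> \<le> A" if "\<alpha> \<in> I" "norm y \<le> 3" for \<alpha> y
    using member_le_sum[of \<alpha> I "\<lambda>\<alpha>. \<bar>a \<alpha> y\<bar>"] a[OF that(2)] that(1) I by auto
  have fai: "integrable lborel (\<lambda>y. f y * a \<alpha> y)" if "\<alpha> \<in> I" for \<alpha>
  proof (rule Bochner_Integration.integrable_bound)
    show "integrable lborel (\<lambda>y. A * f y)" using fi by simp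
    show "AE y in lborel. norm (f y * a \<alpha> y) \<le> norm (A * f y)"
    proof (intro AE_I2)
      fix y show "norm (f y * a \<alpha> y) \<le> norm (A * f y)"
      proof (cases "y \<in> Ann")
        case True
        then have "\<bar>a \<alpha> y\<bar> \<le> \<bar>A\<bar>" using ale[OF that, of y] by (auto simp: mem_Ann)
        then show ?thesis
          unfolding real_norm_def abs_mult by (subst mult.commute) (rule mult_right_mono, auto)
      qed (simp add: f0)
    qed
  qed measurable
  define c where "c \<alpha> = ?C * (\<integral>y. f y * a \<alpha> y \<partial>lborel)" for \<alpha>
  have "(\<Sum>\<alpha>\<in>I. \<bar>c \<alpha>\<bar>) \<le> (\<Sum>\<alpha>\<in>I. ?C * (\<integral>y. \<bar>f y * a \<alpha> y\<bar> \<partial>lborel))"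
  proof (rule sum_mono)
    fix \<alpha>
    have "\<bar>\<integral>y. f y * a \<alpha> y \<partial>lborel\<bar> \<le> (\<integral>y. \<bar>f y * a \<alpha> y\<bar> \<partial>lborel)" by (rule integral_abs_bound)
    then show "\<bar>c \<alpha>\<bar> \<le> ?C * (\<integral>y. \<bar>f y * a \<alpha> y\<bar> \<partial>lborel)"
      unfolding c_def abs_mult[of ?C] abs_of_pos[OF C] using C by (intro mult_left_mono) auto
  qed
  also have "\<dots> = ?C * (\<integral>y. (\<Sum>\<alpha>\<in>I. \<bar>f y * a \<alpha> y\<bar>) \<partial>lborel)"
    using fai by (subst Bochner_Integration.integral_sum) (auto simp: sum_distrib_left)
  also have "\<dots> \<le> ?C * (\<integral>y. A * \<bar>f y\<bar> \<partial>lborel)"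
  proof (intro mult_left_mono integral_mono)
    show "integrable lborel (\<lambda>y. \<Sum>\<alpha>\<in>I. \<bar>f y * a \<alpha> y\<bar>)" using fai by (intro Bochner_Integration.integrable_sum integrable_abs)
    show "integrable lborel (\<lambda>y. A * \<bar>f y\<bar>)" using absfi by simp
    show "(\<Sum>\<alpha>\<in>I. \<bar>f y * a \<alpha> y\<bar>) \<le> A * \<bar>f y\<bar>" for y
    proof (cases "y \<in> Ann")
      case True
      then have "\<bar>f y\<bar> * (\<Sum>\<alpha>\<in>I. \<bar>a \<alpha> y\<bar>) \<le> \<bar>f y\<bar> * A" by (intro mult_left_mono a) (auto simp: mem_Ann)
      then show ?thesis by (simp add: abs_mult sum_distrib_left mult.commute)
    qed (simp add: f0)
  qed (use C in simp)
  also have "\<dots> \<le> ?C * (A * L)" using L A0 C by (simp add: mult_left_mono)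
  finally have 1: "(\<Sum>\<alpha>\<in>I. \<bar>c \<alpha>\<bar>) \<le> ?C * A * L" by (simp add: mult.assoc)
  have 2: "\<bar>pot s f x - (\<Sum>\<alpha>\<in>I. c \<alpha> * monom_at \<alpha> x)\<bar> \<le> ?C * e * L" if x: "norm x \<le> 1" for x
  proof -
    let ?k = "\<lambda>y. norm (x - y) powr (- ?q)"
    note ki = pot_bound(1)[OF s f x]
    have si: "integrable lborel (\<lambda>y. \<Sum>\<alpha>\<in>I. monom_at \<alpha> x * (f y * a \<alpha> y))"
      using fai by (intro Bochner_Integration.integrable_sum integrable_mult_right)
    have "(\<Sum>\<alpha>\<in>I. c \<alpha> * monom_at \<alpha> x) = ?C * (\<Sum>\<alpha>\<in>I. monom_at \<alpha> x * (\<integral>y. f y * a \<alpha> y \<partial>lborel))"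
      unfolding c_def sum_distrib_left by (intro sum.cong refl) (simp add: mult_ac)
    also have "(\<Sum>\<alpha>\<in>I. monom_at \<alpha> x * (\<integral>y. f y * a \<alpha> y \<partial>lborel)) = (\<integral>y. (\<Sum>\<alpha>\<in>I. monom_at \<alpha> x * (f y * a \<alpha> y)) \<partial>lborel)"
      using fai by (subst Bochner_Integration.integral_sum) auto
    finally have "pot s f x - (\<Sum>\<alpha>\<in>I. c \<alpha> * monom_at \<alpha> x) = ?C * (\<integral>y. f y * ?k y - (\<Sum>\<alpha>\<in>I. monom_at \<alpha> x * (f y * a \<alpha> y)) \<partial>lborel)"
      unfolding pot_def using ki si by (simp add: right_diff_distrib)
    moreover have "\<bar>\<integral>y. f y * ?k y - (\<Sum>\<alpha>\<in>I. monom_at \<alpha> x * (f y * a \<alpha> y)) \<partial>lborel\<bar> \<le> (\<integral>y. e * \<bar>f y\<bar> \<partial>lborel)"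
    proof (rule Bochner_Integration.integral_abs_bound_integral)
      show "integrable lborel (\<lambda>y. f y * ?k y - (\<Sum>\<alpha>\<in>I. monom_at \<alpha> x * (f y * a \<alpha> y)))" using ki si by (rule Bochner_Integration.integrable_diff)
      show "integrable lborel (\<lambda>y. e * \<bar>f y\<bar>)" using absfi by simp
      fix y
      have eq: "f y * ?k y - (\<Sum>\<alpha>\<in>I. monom_at \<alpha> x * (f y * a \<alpha> y)) = f y * (?k y - (\<Sum>\<alpha>\<in>I. monom_at \<alpha> x * a \<alpha> y))"
        by (simp add: right_diff_distrib sum_distrib_left mult_ac)
      show "\<bar>f y * ?k y - (\<Sum>\<alpha>\<in>I. monom_at \<alpha> x * (f y * a \<alpha> y))\<bar> \<le> e * \<bar>f y\<bar>"
      proof (cases "y \<in> Ann")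
        case True
        then have "\<bar>?k y - (\<Sum>\<alpha>\<in>I. monom_at \<alpha> x * a \<alpha> y)\<bar> \<le> e" using x by (intro k) (auto simp: mem_Ann)
        then show ?thesis unfolding eq abs_mult by (subst mult.commute) (rule mult_right_mono, auto)
      qed (simp add: f0)
    qed
    ultimately have "\<bar>pot s f x - (\<Sum>\<alpha>\<in>I. c \<alpha> * monom_at \<alpha> x)\<bar> \<le> ?C * (e * (\<integral>y. \<bar>f y\<bar> \<partial>lborel))"
      using C by (simp add: abs_mult)
    also have "\<dots> \<le> ?C * (e * L)" using C e0 L by (intro mult_left_mono) auto
    finally show ?thesis by (simp add: mult.assoc)
  qed
  have m: "(\<lambda>x. pot s f x - (\<Sum>\<alpha>\<in>I. c \<alpha> * monom_at \<alpha> x)) \<in> borel_measurable borel" by measurable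
  show ?thesis using 1 2 m unfolding bdd_fn_def by blast
qed

text \<open>Testing the equation with its own solution gives energy = load, and one square root of
  the energy cancels.\<close>

lemma weak_energy_bound:
  assumes s: "0 < s" "s < 1" and \<gamma>: "adm \<gamma>" and w: "weak s \<gamma> F v" and K: "\<bar>load \<gamma> F v\<bar> \<le> K * sqrt (Bform s \<gamma> v v)" "0 \<le> K"
  shows "sqrt (Bform s \<gamma> v v) \<le> K"
proof (cases "sqrt (Bform s \<gamma> v v) = 0")
  case False
  have B0: "0 \<le> Bform s \<gamma> v v" by (rule Bform_nonneg[OF s \<gamma>])
  have "Bform s \<gamma> v v = load \<gamma> F v" using w by (simp add: weak_def)
  then have "sqrt (Bform s \<gamma> v v) * sqrt (Bform s \<gamma> v v) \<le> K * sqrt (Bform s \<gamma> v v)" using K B0 by simp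
  then show ?thesis by (rule mult_right_le_imp_le) (use False B0 in auto)
qed (use K in simp)

text \<open>The remainder is tested against the combination \<open>W\<close> of the solutions for monomials, which has
  bounded energy because it solves the equation with the bounded right-hand side \<open>GN\<close>; an estimate
  for each monomial separately would lose the exponentially large coefficients \<open>d\<close>.\<close>

lemma load_expansion:
  fixes \<gamma> F G v :: "'n::finite fn"
  assumes s: "0 < s" "s < 1" and \<gamma>: "adm \<gamma>" and I: "finite I"
    and K: "\<And>F b \<phi>. bdd_fn F b \<Longrightarrow> \<phi> \<in> H0 s \<Longrightarrow> \<bar>load \<gamma> F \<phi>\<bar> \<le> K * b * sqrt (Bform s \<gamma> \<phi> \<phi>)" and K0: "0 < K"
    and F: "bdd_fn F b" and G: "bdd_fn G b" and v: "weak s \<gamma> F v" and e: "0 \<le> e" "e \<le> b"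
    and RF: "bdd_fn (\<lambda>x. F x - (\<Sum>\<alpha>\<in>I. c \<alpha> * monom_at \<alpha> x)) e"
    and RG: "bdd_fn (\<lambda>x. G x - (\<Sum>\<alpha>\<in>I. d \<alpha> * monom_at \<alpha> x)) e"
  shows "\<bar>load \<gamma> G v - (\<Sum>\<alpha>\<in>I. \<Sum>\<beta>\<in>I. c \<alpha> * d \<beta> * Qm s \<gamma> \<alpha> \<beta>)\<bar> \<le> 3 * K\<^sup>2 * b * e"
proof -
  define FN where "FN x = (\<Sum>\<alpha>\<in>I. c \<alpha> * monom_at \<alpha> x)" for x
  define GN where "GN x = (\<Sum>\<alpha>\<in>I. d \<alpha> * monom_at \<alpha> x)" for x
  define W where "W x = (\<Sum>\<beta>\<in>I. d \<beta> * wsol s \<gamma> \<beta> x)" for x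
  have b0: "0 \<le> b" using e by simp
  have vH: "v \<in> H0 s" using v by (simp add: weak_def)
  note ws = weak_sum[where F=monom_at and w="wsol s \<gamma>", OF s \<gamma> I bdd_fn_monom weak_wsol[OF s \<gamma>]]
  have GNW: "weak s \<gamma> GN W" "bdd_fn GN (\<Sum>\<alpha>\<in>I. \<bar>d \<alpha>\<bar>)"
    and Wl: "\<And>H b. bdd_fn H b \<Longrightarrow> load \<gamma> H W = (\<Sum>\<beta>\<in>I. d \<beta> * load \<gamma> H (wsol s \<gamma> \<beta>))"
    using ws[of d] by (auto simp: GN_def[abs_def] W_def[abs_def])
  have WH: "W \<in> H0 s" using GNW(1) by (simp add: weak_def)
  have FNb: "bdd_fn FN (\<Sum>\<alpha>\<in>I. \<bar>c \<alpha>\<bar>)" and FNl: "\<And>\<phi>. \<phi> \<in> H0 s \<Longrightarrow> load \<gamma> FN \<phi> = (\<Sum>\<alpha>\<in>I. c \<alpha> * load \<gamma> (monom_at \<alpha>) \<phi>)"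
    using ws[of c] by (auto simp: FN_def[abs_def])
  have RF': "bdd_fn (\<lambda>x. F x - FN x) e" and RG': "bdd_fn (\<lambda>x. G x - GN x) e" using RF RG by (simp_all add: FN_def GN_def)
  \<comment> \<open>The bound in \<open>GNW\<close> by the sum of the |d_alpha| is far too large;
    \<open>GN\<close> differs from \<open>G\<close> by at most e <= b, hence 2b.\<close>
  have GNb: "bdd_fn GN (2 * b)"
    using bdd_fn_lin[OF G RG', of 1 "-1"] e by (auto simp: bdd_fn_def intro: order_trans)
  have W_en: "sqrt (Bform s \<gamma> W W) \<le> K * (2 * b)"
    by (rule weak_energy_bound[OF s \<gamma> GNW(1)]) (use K[OF GNb WH] K0 b0 in auto)
  have v_en: "sqrt (Bform s \<gamma> v v) \<le> K * b"
    by (rule weak_energy_bound[OF s \<gamma> v]) (use K[OF F vH] K0 b0 in auto)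
  \<comment> \<open>The remainder of \<open>G\<close> is tested against \<open>v\<close>; symmetry
    then exchanges the load \<open>GN\<close> on \<open>v\<close> for the load \<open>F\<close> on
    \<open>W\<close>, and the remainder of \<open>F\<close> is tested against \<open>W\<close>. The
    factor 3 is 1 for \<open>v\<close> plus 2 for \<open>W\<close>.\<close>
  have "load \<gamma> G v = load \<gamma> GN v + load \<gamma> (\<lambda>x. G x - GN x) v"
    using load_lin_left[OF \<gamma> GNb RG' vH, of 1 1] by simp
  moreover have "load \<gamma> GN v = load \<gamma> F W" by (rule weak_load_sym[OF s v GNW(1)])
  moreover have "load \<gamma> F W = load \<gamma> FN W + load \<gamma> (\<lambda>x. F x - FN x) W"
    using load_lin_left[OF \<gamma> FNb RF' WH, of 1 1] by simp
  moreover have "load \<gamma> FN W = (\<Sum>\<alpha>\<in>I. \<Sum>\<beta>\<in>I. c \<alpha> * d \<beta> * Qm s \<gamma> \<alpha> \<beta>)"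
    unfolding FNl[OF WH] Wl[OF bdd_fn_monom] Qm_def by (simp add: sum_distrib_left mult.assoc)
  moreover have "\<bar>load \<gamma> (\<lambda>x. G x - GN x) v\<bar> \<le> K * e * (K * b)"
    using order_trans[OF K[OF RG' vH] mult_left_mono[OF v_en, of "K * e"]] K0 e by simp
  moreover have "\<bar>load \<gamma> (\<lambda>x. F x - FN x) W\<bar> \<le> K * e * (K * (2 * b))"
    using order_trans[OF K[OF RF' WH] mult_left_mono[OF W_en, of "K * e"]] K0 e by simp
  moreover have "K * e * (K * b) + K * e * (K * (2 * b)) = 3 * K\<^sup>2 * b * e" by (simp add: power2_eq_square)
  ultimately show ?thesis by linarith
qed

text \<open>The kernel expansion is used with the integration variable y in the ball: the monomials
  in y produce the moments \<open>Pm\<close>, while the coefficients are evaluated at the point x of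
  the annulus. The remainder is integrated against a function of modulus at most 1 on the
  ball.\<close>

lemma pot_perturbation_diff:
  fixes \<gamma>1 \<gamma>2 :: "'n::finite fn" and a :: "('n \<Rightarrow> nat) \<Rightarrow> real^'n \<Rightarrow> real"
  assumes s: "0 < s" "s < 1" and \<gamma>: "adm \<gamma>1" "adm \<gamma>2" and x: "x \<in> Ann" and I: "finite I"
    and a: "(\<Sum>\<alpha>\<in>I. \<bar>a \<alpha> x\<bar>) \<le> A" and d: "0 \<le> \<delta>" "\<And>\<alpha>. \<alpha> \<in> I \<Longrightarrow> \<bar>Pm \<gamma>1 \<alpha> - Pm \<gamma>2 \<alpha>\<bar> \<le> \<delta>"
    and k: "\<And>y. norm y \<le> 1 \<Longrightarrow> \<bar>norm (y - x) powr (- (real CARD('n) + 2 * s)) - (\<Sum>\<alpha>\<in>I. monom_at \<alpha> y * a \<alpha> x)\<bar> \<le> e"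
  shows "\<bar>pot s (\<lambda>y. sqrt (\<gamma>1 y) - 1) x - pot s (\<lambda>y. sqrt (\<gamma>2 y) - 1) x\<bar>
     \<le> C_ns CARD('n) s * (A * \<delta> + e * measure lborel (cball (0::real^'n) 1))"
proof -
  let ?C = "C_ns CARD('n) s" and ?q = "real CARD('n) + 2 * s"
  have C: "0 < ?C" by (rule C_ns_pos[OF s])
  let ?k = "\<lambda>y. norm (x - y) powr (- ?q)"
  define B1 where "B1 y = sqrt (\<gamma>1 y) - 1" for y
  define B2 where "B2 y = sqrt (\<gamma>2 y) - 1" for y
  have ki: "integrable lborel (\<lambda>y. (sqrt (\<gamma> y) - 1) * ?k y)" if "adm \<gamma>" for \<gamma> :: "'n fn"
  proof (rule Bochner_Integration.integrable_bound[OF adm_perturbation(4)[OF that]])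
    have [measurable]: "\<gamma> \<in> borel_measurable borel" by (rule adm_measurable[OF that])
    show "(\<lambda>y. (sqrt (\<gamma> y) - 1) * ?k y) \<in> borel_measurable lborel" by measurable
    show "AE y in lborel. norm ((sqrt (\<gamma> y) - 1) * ?k y) \<le> norm (sqrt (\<gamma> y) - 1)"
    proof (intro AE_I2)
      fix y
      show "norm ((sqrt (\<gamma> y) - 1) * ?k y) \<le> norm (sqrt (\<gamma> y) - 1)"
      proof (cases "norm y \<le> 1")
        case True
        have "1 \<le> norm (y - x)" using True x by (intro norm_diff_ge_1) (auto simp: mem_Ann)
        then have "?k y \<le> 1" using s powr_mono2'[of "- ?q" 1 "norm (x - y)"] by (simp add: norm_minus_commute)
        then show ?thesis by (simp add: abs_mult mult_left_le)
      next
        case False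
        then have "\<gamma> y = 1" using that by (simp add: adm_def)
        then show ?thesis by simp
      qed
    qed
  qed
  note k1 = ki[OF \<gamma>(1), folded B1_def] and k2 = ki[OF \<gamma>(2), folded B2_def]
  have m1: "integrable lborel (\<lambda>y. B1 y * monom_at \<alpha> y)" and m2: "integrable lborel (\<lambda>y. B2 y * monom_at \<alpha> y)" for \<alpha>
    using adm_perturbation(3)[OF \<gamma>(1)] adm_perturbation(3)[OF \<gamma>(2)] by (simp_all add: B1_def B2_def)
  have si: "integrable lborel (\<lambda>y. \<Sum>\<alpha>\<in>I. a \<alpha> x * (B1 y * monom_at \<alpha> y - B2 y * monom_at \<alpha> y))"
    using m1 m2 by (intro Bochner_Integration.integrable_sum integrable_mult_right Bochner_Integration.integrable_diff)
  have S: "(\<integral>y. (\<Sum>\<alpha>\<in>I. a \<alpha> x * (B1 y * monom_at \<alpha> y - B2 y * monom_at \<alpha> y)) \<partial>lborel) = (\<Sum>\<alpha>\<in>I. a \<alpha> x * (Pm \<gamma>1 \<alpha> - Pm \<gamma>2 \<alpha>))"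
    using m1 m2 by (subst Bochner_Integration.integral_sum) (auto simp: Pm_def B1_def B2_def)
  have "\<bar>\<Sum>\<alpha>\<in>I. a \<alpha> x * (Pm \<gamma>1 \<alpha> - Pm \<gamma>2 \<alpha>)\<bar> \<le> (\<Sum>\<alpha>\<in>I. \<bar>a \<alpha> x\<bar> * \<delta>)"
    by (rule order_trans[OF sum_abs]) (auto simp: abs_mult intro!: sum_mono mult_left_mono d)
  also have "\<dots> \<le> A * \<delta>" unfolding sum_distrib_right[symmetric] by (rule mult_right_mono[OF a d(1)])
  finally have T1: "\<bar>\<Sum>\<alpha>\<in>I. a \<alpha> x * (Pm \<gamma>1 \<alpha> - Pm \<gamma>2 \<alpha>)\<bar> \<le> A * \<delta>" .
  have e0: "0 \<le> e" using k[of 0] by simp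
  have T2: "\<bar>\<integral>y. (B1 y - B2 y) * ?k y - (\<Sum>\<alpha>\<in>I. a \<alpha> x * (B1 y * monom_at \<alpha> y - B2 y * monom_at \<alpha> y)) \<partial>lborel\<bar> \<le> (\<integral>y. e * indicator (cball (0::real^'n) 1) y \<partial>lborel)"
  proof (rule Bochner_Integration.integral_abs_bound_integral)
    show "integrable lborel (\<lambda>y. (B1 y - B2 y) * ?k y - (\<Sum>\<alpha>\<in>I. a \<alpha> x * (B1 y * monom_at \<alpha> y - B2 y * monom_at \<alpha> y)))"
      using k1 k2 si by (simp add: left_diff_distrib)
    show "integrable lborel (\<lambda>y. e * indicator (cball (0::real^'n) 1) y)"
      by (intro integrable_mult_right integrable_real_indicator) (auto intro!: emeasure_bounded_finite[unfolded infinity_ennreal_def])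
    fix y
    have b: "\<bar>B1 y - B2 y\<bar> \<le> indicator (cball 0 1) y"
      using adm_perturbation(1,2)[OF \<gamma>(1), of y] adm_perturbation(1,2)[OF \<gamma>(2), of y]
      unfolding B1_def B2_def by linarith
    have eq: "(B1 y - B2 y) * ?k y - (\<Sum>\<alpha>\<in>I. a \<alpha> x * (B1 y * monom_at \<alpha> y - B2 y * monom_at \<alpha> y))
       = (B1 y - B2 y) * (?k y - (\<Sum>\<alpha>\<in>I. monom_at \<alpha> y * a \<alpha> x))"
      by (simp add: algebra_simps sum_distrib_left sum_subtractf)
    show "\<bar>(B1 y - B2 y) * ?k y - (\<Sum>\<alpha>\<in>I. a \<alpha> x * (B1 y * monom_at \<alpha> y - B2 y * monom_at \<alpha> y))\<bar> \<le> e * indicator (cball 0 1) y"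
    proof (cases "norm y \<le> 1")
      case True
      have "\<bar>B1 y - B2 y\<bar> * \<bar>?k y - (\<Sum>\<alpha>\<in>I. monom_at \<alpha> y * a \<alpha> x)\<bar> \<le> 1 * e"
        using b k[OF True] True by (intro mult_mono) (auto simp: norm_minus_commute)
      then show ?thesis unfolding eq abs_mult using True by simp
    next
      case False
      then have "B1 y - B2 y = 0" using b by simp
      then show ?thesis unfolding eq using False by simp
    qed
  qed
  have "pot s B1 x - pot s B2 x = ?C * (\<integral>y. (B1 y - B2 y) * ?k y \<partial>lborel)"
    unfolding pot_def using k1 k2 by (simp add: left_diff_distrib right_diff_distrib)
  also have "(\<integral>y. (B1 y - B2 y) * ?k y \<partial>lborel) = (\<integral>y. (B1 y - B2 y) * ?k y - (\<Sum>\<alpha>\<in>I. a \<alpha> x * (B1 y * monom_at \<alpha> y - B2 y * monom_at \<alpha> y)) \<partial>lborel)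
     + (\<Sum>\<alpha>\<in>I. a \<alpha> x * (Pm \<gamma>1 \<alpha> - Pm \<gamma>2 \<alpha>))"
  proof -
    have "integrable lborel (\<lambda>y. (B1 y - B2 y) * ?k y)" using k1 k2 by (simp add: left_diff_distrib)
    from Bochner_Integration.integral_diff[OF this si] show ?thesis unfolding S by simp
  qed
  finally have "\<bar>pot s B1 x - pot s B2 x\<bar> = ?C * \<bar>(\<integral>y. (B1 y - B2 y) * ?k y - (\<Sum>\<alpha>\<in>I. a \<alpha> x * (B1 y * monom_at \<alpha> y - B2 y * monom_at \<alpha> y)) \<partial>lborel)
     + (\<Sum>\<alpha>\<in>I. a \<alpha> x * (Pm \<gamma>1 \<alpha> - Pm \<gamma>2 \<alpha>))\<bar>"
    using C by (simp add: abs_mult)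
  also have "\<dots> \<le> ?C * (A * \<delta> + e * measure lborel (cball (0::real^'n) 1))"
    using T1 T2 C by (intro mult_left_mono) auto
  finally show ?thesis by (simp add: B1_def[abs_def] B2_def[abs_def])
qed

lemma hs_norm_L2:
  fixes f :: "'n::finite fn"
  assumes s: "0 < s" "s < 1" and f: "hs_norm s f \<le> 1"
  shows "(\<integral>x. (f x)\<^sup>2 \<partial>lborel) \<le> 1"
proof -
  have "0 \<le> integral\<^sup>L plane (gagliardo s f f)"
    by (rule Bochner_Integration.integral_nonneg) (simp add: gagliardo_eq)
  then have "0 \<le> C_ns CARD('n) s / 2 * integral\<^sup>L plane (gagliardo s f f)"
    using C_ns_pos[OF s, of "CARD('n)"] by simp
  then show ?thesis using f unfolding hs_norm_def by (simp only: real_sqrt_le_1_iff)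
qed

text \<open>\<open>K\<close>, \<open>M\<close> and \<open>r\<close> depend on n and s only, so N and
  the mesh \<open>\<delta>\<close> can be chosen afterwards. \<open>M ^ N\<close> occurs twice
  because each entry of \<open>Qm\<close> is weighted by one coefficient of \<open>f\<close> and one
  of \<open>g\<close>.\<close>

lemma DN_stability:
  assumes s: "0 < s" "s < 1" "2 * s < real CARD('n::finite)"
  shows "\<exists>K M r. 1 \<le> K \<and> 1 \<le> M \<and> 0 < r \<and> r < 1 \<and>
    (\<forall>(\<gamma>::'n fn) \<alpha> \<beta>. adm \<gamma> \<longrightarrow> \<bar>Qm s \<gamma> \<alpha> \<beta>\<bar> \<le> K \<and> \<bar>Pm \<gamma> \<alpha>\<bar> \<le> K) \<and>
    (\<forall>N \<delta> \<gamma>1 (\<gamma>2::'n fn). adm \<gamma>1 \<longrightarrow> adm \<gamma>2 \<longrightarrow> 0 \<le> \<delta> \<longrightarrow>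
      (\<forall>\<alpha>\<in>midx (2 * N). \<forall>\<beta>\<in>midx (2 * N). \<bar>Qm s \<gamma>1 \<alpha> \<beta> - Qm s \<gamma>2 \<alpha> \<beta>\<bar> \<le> \<delta>) \<longrightarrow>
      (\<forall>\<alpha>\<in>midx (2 * N). \<bar>Pm \<gamma>1 \<alpha> - Pm \<gamma>2 \<alpha>\<bar> \<le> \<delta>) \<longrightarrow>
      DN_diff_norm s \<gamma>1 \<gamma>2 \<le> ereal (K * (M ^ N * M ^ N * \<delta> + r ^ N)))"
proof -
  let ?C = "C_ns CARD('n) s" and ?q = "real CARD('n) + 2 * s"
  have C: "0 < ?C" by (rule C_ns_pos[OF s(1,2)])
  obtain K0 where K0: "0 < K0" and K0b: "\<And>\<gamma> F b \<phi>. adm \<gamma> \<Longrightarrow> bdd_fn F b \<Longrightarrow> \<phi> \<in> H0 s \<Longrightarrow>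
      \<bar>load \<gamma> F (\<phi>::'n fn)\<bar> \<le> K0 * b * sqrt (Bform s \<gamma> \<phi> \<phi>)"
    using load_bound[OF s(1,2), where 'n='n] unfolding bdd_fn_def by blast
  obtain M D r where M: "1 \<le> M" and D: "1 \<le> D" and r: "0 < r" "r < 1" and app: "\<And>N. \<exists>a :: ('n \<Rightarrow> nat) \<Rightarrow> real^'n \<Rightarrow> real.
     (\<forall>\<alpha>. a \<alpha> \<in> borel_measurable borel) \<and>
     (\<forall>y. norm y \<le> 3 \<longrightarrow> (\<Sum>\<alpha>\<in>midx (2 * N). \<bar>a \<alpha> y\<bar>) \<le> D * M ^ N) \<and>
     (\<forall>x y. norm x \<le> 1 \<longrightarrow> 2 \<le> norm y \<longrightarrow> norm y \<le> 3 \<longrightarrow>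
        \<bar>norm (x - y) powr (- ?q) - (\<Sum>\<alpha>\<in>midx (2 * N). monom_at \<alpha> x * a \<alpha> y)\<bar> \<le> D * r ^ N)"
    using kernel_approx[where 'n='n and q="?q"] by blast
  define L where "L = sqrt (measure lborel (cball (0::real^'n) 3))"
  define \<mu> where "\<mu> = measure lborel (cball (0::real^'n) 1)"
  have L0: "0 \<le> L" and \<mu>0: "0 \<le> \<mu>" by (auto simp: L_def \<mu>_def)
  define c1 where "c1 = ?C * D * L"
  have c10: "0 \<le> c1" using C D L0 by (simp add: c1_def)
  \<comment> \<open>The summands dominate separately the bounds for \<open>Qm\<close> and
    \<open>Pm\<close>, the factor of \<open>M ^ N * M ^ N * \<delta>\<close> and the factor of
    \<open>r ^ N\<close>.\<close>
  define K where "K = c1\<^sup>2 + 6 * K0\<^sup>2 * c1\<^sup>2 + ?C * D + ?C * D * \<mu> + K0\<^sup>2 + \<mu> + 1"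
  have Knn: "0 \<le> c1\<^sup>2" "0 \<le> 6 * K0\<^sup>2 * c1\<^sup>2" "0 \<le> ?C * D" "0 \<le> ?C * D * \<mu>" "0 \<le> K0\<^sup>2"
    using C D \<mu>0 by auto
  have K1: "1 \<le> K" "K0\<^sup>2 \<le> K" "\<mu> \<le> K" "c1\<^sup>2 + ?C * D \<le> K" "6 * K0\<^sup>2 * c1\<^sup>2 + ?C * D * \<mu> \<le> K"
    using Knn \<mu>0 unfolding K_def by linarith+
  have QP: "\<bar>Qm s \<gamma> \<alpha> \<beta>\<bar> \<le> K \<and> \<bar>Pm \<gamma> \<alpha>\<bar> \<le> K" if \<gamma>: "adm \<gamma>" for \<gamma> :: "'n fn" and \<alpha> \<beta>
  proof
    have w: "weak s \<gamma> (monom_at \<beta>) (wsol s \<gamma> \<beta>)" by (rule weak_wsol[OF s(1,2) \<gamma>])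
    then have wH: "wsol s \<gamma> \<beta> \<in> H0 s" by (simp add: weak_def)
    have en: "sqrt (Bform s \<gamma> (wsol s \<gamma> \<beta>) (wsol s \<gamma> \<beta>)) \<le> K0"
      by (rule weak_energy_bound[OF s(1,2) \<gamma> w]) (use K0b[OF \<gamma> bdd_fn_monom wH, of \<beta>] K0 in auto)
    have "\<bar>Qm s \<gamma> \<alpha> \<beta>\<bar> \<le> K0 * 1 * sqrt (Bform s \<gamma> (wsol s \<gamma> \<beta>) (wsol s \<gamma> \<beta>))"
      unfolding Qm_def by (rule K0b[OF \<gamma> bdd_fn_monom wH])
    also have "\<dots> \<le> K0 * 1 * K0" using en K0 by (intro mult_left_mono) auto
    also have "\<dots> \<le> K" using K1(2) by (simp add: power2_eq_square)
    finally show "\<bar>Qm s \<gamma> \<alpha> \<beta>\<bar> \<le> K" .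
    have "\<bar>Pm \<gamma> \<alpha>\<bar> \<le> (\<integral>x. indicator (cball (0::real^'n) 1) x \<partial>lborel)"
      unfolding Pm_def
    proof (rule Bochner_Integration.integral_abs_bound_integral[OF adm_perturbation(3)[OF \<gamma>]])
      show "integrable lborel (indicator (cball (0::real^'n) 1) :: _ \<Rightarrow> real)"
        by (intro integrable_real_indicator) (auto intro!: emeasure_bounded_finite[unfolded infinity_ennreal_def])
      fix x
      show "\<bar>(sqrt (\<gamma> x) - 1) * monom_at \<alpha> x\<bar> \<le> indicator (cball 0 1) x"
      proof (cases "norm x \<le> 1")
        case True
        then have "\<bar>sqrt (\<gamma> x) - 1\<bar> * \<bar>monom_at \<alpha> x\<bar> \<le> 1 * 1"
          using adm_perturbation(1,2)[OF \<gamma>, of x] monom_at_bound[OF True, of \<alpha>] by (intro mult_mono) auto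
        then show ?thesis using True by (simp add: abs_mult)
      next
        case False
        then have "\<gamma> x = 1" using \<gamma> by (simp add: adm_def)
        then show ?thesis by simp
      qed
    qed
    also have "\<dots> = \<mu>" by (simp add: \<mu>_def)
    finally show "\<bar>Pm \<gamma> \<alpha>\<bar> \<le> K" using K1(3) by simp
  qed
  have main: "DN_diff_norm s \<gamma>1 \<gamma>2 \<le> ereal (K * (M ^ N * M ^ N * \<delta> + r ^ N))"
    if \<gamma>: "adm \<gamma>1" "adm \<gamma>2" and \<delta>: "0 \<le> \<delta>"
      and Q: "\<And>\<alpha> \<beta>. \<alpha> \<in> midx (2 * N) \<Longrightarrow> \<beta> \<in> midx (2 * N) \<Longrightarrow> \<bar>Qm s \<gamma>1 \<alpha> \<beta> - Qm s \<gamma>2 \<alpha> \<beta>\<bar> \<le> \<delta>"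
      and P: "\<And>\<alpha>. \<alpha> \<in> midx (2 * N) \<Longrightarrow> \<bar>Pm \<gamma>1 \<alpha> - Pm \<gamma>2 \<alpha>\<bar> \<le> \<delta>" for N \<delta> and \<gamma>1 \<gamma>2 :: "'n fn"
  proof -
    let ?I = "midx (2 * N) :: ('n \<Rightarrow> nat) set"
    obtain a :: "('n \<Rightarrow> nat) \<Rightarrow> real^'n \<Rightarrow> real" where am: "\<And>\<alpha>. a \<alpha> \<in> borel_measurable borel"
      and a: "\<And>y. norm y \<le> 3 \<Longrightarrow> (\<Sum>\<alpha>\<in>?I. \<bar>a \<alpha> y\<bar>) \<le> D * M ^ N"
      and k: "\<And>x y. norm x \<le> 1 \<Longrightarrow> 2 \<le> norm y \<Longrightarrow> norm y \<le> 3 \<Longrightarrow>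
        \<bar>norm (x - y) powr (- ?q) - (\<Sum>\<alpha>\<in>?I. monom_at \<alpha> x * a \<alpha> y)\<bar> \<le> D * r ^ N"
      using app[of N] by blast
    have rN: "0 \<le> r ^ N" "r ^ N \<le> 1" using r by (auto simp: power_le_one)
    have MN: "1 \<le> M ^ N" using M by simp
    have bound: "\<bar>DN s \<gamma>1 f g - DN s \<gamma>2 f g\<bar> \<le> K * (M ^ N * M ^ N * \<delta> + r ^ N)"
      if f: "f \<in> Hs_annulus s" "hs_norm s f \<le> 1" and g: "g \<in> Hs_annulus s" "hs_norm s g \<le> 1" for f g :: "'n fn"
    proof -
      define f' where "f' x = (if x \<in> Ann then f x else 0)" for x
      define g' where "g' x = (if x \<in> Ann then g x else 0)" for x
      have fH: "f' \<in> Hann s" and f2: "AE x in lborel. f x = f' x" and fm: "f' \<in> borel_measurable borel"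
        using Hs_annulus_restrict[OF s(1,2) f(1)] by (simp_all only: f'_def[abs_def])
      have gH: "g' \<in> Hann s" and g2: "AE x in lborel. g x = g' x" and gm: "g' \<in> borel_measurable borel"
        using Hs_annulus_restrict[OF s(1,2) g(1)] by (simp_all only: g'_def[abs_def])
      have fm0: "f \<in> borel_measurable borel" and gm0: "g \<in> borel_measurable borel"
        using f g by (auto simp: Hs_annulus_def Hs_iff)
      have nf: "(\<integral>x. (f' x)\<^sup>2 \<partial>lborel) \<le> 1"
      proof -
        have "(\<integral>x. (f' x)\<^sup>2 \<partial>lborel) = (\<integral>x. (f x)\<^sup>2 \<partial>lborel)"
          using f2 fm fm0 by (intro integral_cong_AE) (auto elim: eventually_mono)
        then show ?thesis using hs_norm_L2[OF s(1,2) f(2)] by simp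
      qed
      have ng: "(\<integral>x. (g' x)\<^sup>2 \<partial>lborel) \<le> 1"
      proof -
        have "(\<integral>x. (g' x)\<^sup>2 \<partial>lborel) = (\<integral>x. (g x)\<^sup>2 \<partial>lborel)"
          using g2 gm gm0 by (intro integral_cong_AE) (auto elim: eventually_mono)
        then show ?thesis using hs_norm_L2[OF s(1,2) g(2)] by simp
      qed
      have Lf: "(\<integral>y. \<bar>f' y\<bar> \<partial>lborel) \<le> L"
        using order_trans[OF Hann_L1(2)[OF fH] mult_left_le[of "sqrt (\<integral>x. (f' x)\<^sup>2 \<partial>lborel)"]] nf L0 by (simp add: L_def)
      have Lg: "(\<integral>y. \<bar>g' y\<bar> \<partial>lborel) \<le> L"
        using order_trans[OF Hann_L1(2)[OF gH] mult_left_le[of "sqrt (\<integral>x. (g' x)\<^sup>2 \<partial>lborel)"]] ng L0 by (simp add: L_def)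
      obtain c where c: "(\<Sum>\<alpha>\<in>?I. \<bar>c \<alpha>\<bar>) \<le> ?C * (D * M ^ N) * L"
          "bdd_fn (\<lambda>x. pot s f' x - (\<Sum>\<alpha>\<in>?I. c \<alpha> * monom_at \<alpha> x)) (?C * (D * r ^ N) * L)"
        using pot_expansion[OF s(1,2) fH Lf am a finite_midx k] by blast
      obtain d where d: "(\<Sum>\<alpha>\<in>?I. \<bar>d \<alpha>\<bar>) \<le> ?C * (D * M ^ N) * L"
          "bdd_fn (\<lambda>x. pot s g' x - (\<Sum>\<alpha>\<in>?I. d \<alpha> * monom_at \<alpha> x)) (?C * (D * r ^ N) * L)"
        using pot_expansion[OF s(1,2) gH Lg am a finite_midx k] by blast
      have c': "(\<Sum>\<alpha>\<in>?I. \<bar>c \<alpha>\<bar>) \<le> c1 * M ^ N" "bdd_fn (\<lambda>x. pot s f' x - (\<Sum>\<alpha>\<in>?I. c \<alpha> * monom_at \<alpha> x)) (c1 * r ^ N)"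
        and d': "(\<Sum>\<alpha>\<in>?I. \<bar>d \<alpha>\<bar>) \<le> c1 * M ^ N" "bdd_fn (\<lambda>x. pot s g' x - (\<Sum>\<alpha>\<in>?I. d \<alpha> * monom_at \<alpha> x)) (c1 * r ^ N)"
        using c d by (simp_all add: c1_def mult_ac)
      have CL: "?C * L \<le> c1" using mult_right_mono[OF D, of "?C * L"] C L0 by (simp add: c1_def mult_ac)
      have bmono: "bdd_fn F b \<Longrightarrow> b \<le> b' \<Longrightarrow> bdd_fn F b'" for F :: "'n fn" and b b'
        by (auto simp: bdd_fn_def intro: order_trans)
      have pF: "bdd_fn (pot s f') c1"
        by (rule bmono[OF pot_bdd_fn[OF s(1,2) fH]]) (use mult_left_mono[OF Lf, of ?C] C CL in linarith)
      have pG: "bdd_fn (pot s g') c1"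
        by (rule bmono[OF pot_bdd_fn[OF s(1,2) gH]]) (use mult_left_mono[OF Lg, of ?C] C CL in linarith)
      have ce: "0 \<le> c1 * r ^ N" "c1 * r ^ N \<le> c1" using c10 rN by (auto simp: mult_left_le)
      obtain v1 where v1: "weak s \<gamma>1 (pot s f') v1" "DN s \<gamma>1 f g = Bform s \<gamma>1 f' g' - load \<gamma>1 (pot s g') v1"
        using DN_formula[OF s(1,2,3) \<gamma>(1) f(1) g(1)] by (auto simp: f'_def[abs_def] g'_def[abs_def])
      obtain v2 where v2: "weak s \<gamma>2 (pot s f') v2" "DN s \<gamma>2 f g = Bform s \<gamma>2 f' g' - load \<gamma>2 (pot s g') v2"
        using DN_formula[OF s(1,2,3) \<gamma>(2) f(1) g(1)] by (auto simp: f'_def[abs_def] g'_def[abs_def])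
      let ?S = "\<lambda>\<gamma>. \<Sum>\<alpha>\<in>?I. \<Sum>\<beta>\<in>?I. c \<alpha> * d \<beta> * Qm s \<gamma> \<alpha> \<beta>"
      have e1: "\<bar>load \<gamma>1 (pot s g') v1 - ?S \<gamma>1\<bar> \<le> 3 * K0\<^sup>2 * c1 * (c1 * r ^ N)"
        by (rule load_expansion[OF s(1,2) \<gamma>(1) finite_midx K0b[OF \<gamma>(1)] K0 pF pG v1(1) ce c'(2) d'(2)])
      have e2: "\<bar>load \<gamma>2 (pot s g') v2 - ?S \<gamma>2\<bar> \<le> 3 * K0\<^sup>2 * c1 * (c1 * r ^ N)"
        by (rule load_expansion[OF s(1,2) \<gamma>(2) finite_midx K0b[OF \<gamma>(2)] K0 pF pG v2(1) ce c'(2) d'(2)])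
      have e3: "\<bar>?S \<gamma>1 - ?S \<gamma>2\<bar> \<le> (c1 * M ^ N) * (c1 * M ^ N) * \<delta>"
      proof -
        have "?S \<gamma>1 - ?S \<gamma>2 = (\<Sum>\<alpha>\<in>?I. \<Sum>\<beta>\<in>?I. c \<alpha> * d \<beta> * (Qm s \<gamma>1 \<alpha> \<beta> - Qm s \<gamma>2 \<alpha> \<beta>))"
          by (simp add: sum_subtractf right_diff_distrib)
        also have "\<bar>\<dots>\<bar> \<le> (\<Sum>\<alpha>\<in>?I. \<Sum>\<beta>\<in>?I. \<bar>c \<alpha>\<bar> * \<bar>d \<beta>\<bar> * \<delta>)"
          by (intro order_trans[OF sum_abs] sum_mono) (auto simp: abs_mult intro!: order_trans[OF sum_abs] sum_mono mult_left_mono Q)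
        also have "\<dots> = (\<Sum>\<alpha>\<in>?I. \<bar>c \<alpha>\<bar>) * (\<Sum>\<beta>\<in>?I. \<bar>d \<beta>\<bar>) * \<delta>"
          unfolding sum_product by (simp only: sum_distrib_right)
        also have "\<dots> \<le> (c1 * M ^ N) * (c1 * M ^ N) * \<delta>"
          using c'(1) d'(1) \<delta> c10 MN by (intro mult_right_mono mult_mono) (auto intro: sum_nonneg)
        finally show ?thesis .
      qed
      define E where "E = ?C * (D * M ^ N * \<delta> + D * r ^ N * \<mu>)"
      have E0: "0 \<le> E" using C D MN \<delta> rN \<mu>0 by (simp add: E_def)
      have e4: "\<bar>Bform s \<gamma>1 f' g' - Bform s \<gamma>2 f' g'\<bar> \<le> E"
      proof -
        let ?m1 = "pot s (\<lambda>y. sqrt (\<gamma>1 y) - 1)" and ?m2 = "pot s (\<lambda>y. sqrt (\<gamma>2 y) - 1)"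
        have fgi: "integrable lborel (\<lambda>x. f' x * g' x)" using fH gH by (intro sq_integrable_mult) (auto simp: Hann_def Hs_iff)
        have fg1: "(\<integral>x. \<bar>f' x * g' x\<bar> \<partial>lborel) \<le> 1"
        proof -
          have "sq_integrable lborel (\<lambda>x. \<bar>f' x\<bar>)" "sq_integrable lborel (\<lambda>x. \<bar>g' x\<bar>)"
            using fH gH by (auto simp: Hann_def Hs_iff sq_integrable_def)
          from integral_Cauchy_Schwarz_abs[OF this] have "(\<integral>x. \<bar>f' x * g' x\<bar> \<partial>lborel) \<le> sqrt (\<integral>x. (f' x)\<^sup>2 \<partial>lborel) * sqrt (\<integral>x. (g' x)\<^sup>2 \<partial>lborel)"
            by (simp add: abs_mult)
          also have "\<dots> \<le> 1 * 1" using nf ng by (intro mult_mono) auto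
          finally show ?thesis by simp
        qed
        have [measurable]: "\<gamma>1 \<in> borel_measurable borel" "\<gamma>2 \<in> borel_measurable borel" using \<gamma> by (auto simp: adm_def)
        have md: "\<bar>?m1 x - ?m2 x\<bar> \<le> E" if "x \<in> Ann" for x
          unfolding E_def \<mu>_def
        proof (rule pot_perturbation_diff[OF s(1,2) \<gamma> that finite_midx _ \<delta>])
          show "(\<Sum>\<alpha>\<in>?I. \<bar>a \<alpha> x\<bar>) \<le> D * M ^ N" using that by (intro a) (auto simp: mem_Ann)
          show "\<bar>norm (y - x) powr (- ?q) - (\<Sum>\<alpha>\<in>?I. monom_at \<alpha> y * a \<alpha> x)\<bar> \<le> D * r ^ N" if "norm y \<le> 1" for y
            using that \<open>x \<in> Ann\<close> by (intro k) (auto simp: mem_Ann)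
        qed (use P in auto)
        have mi: "integrable lborel (\<lambda>x. f' x * g' x * pot s (\<lambda>y. sqrt (\<gamma> y) - 1) x)" if \<gamma>': "adm \<gamma>" for \<gamma> :: "'n fn"
        proof -
          have [measurable]: "\<gamma> \<in> borel_measurable borel" using \<gamma>' by (auto simp: adm_def)
          \<comment> \<open>The potential of the perturbation vanishes for the constant conductivity
            1, so the difference estimate against it bounds the potential itself.\<close>
          have a1: "adm (\<lambda>_::real^'n. 1)" by (simp add: adm_def)
          have "\<exists>B. \<forall>x\<in>Ann. \<bar>pot s (\<lambda>y. sqrt (\<gamma> y) - 1) x\<bar> \<le> B"
          proof (intro exI ballI)
            fix x :: "real^'n" assume x: "x \<in> Ann"
            have P1: "\<bar>Pm \<gamma> \<alpha> - Pm (\<lambda>_. 1) \<alpha>\<bar> \<le> 2 * K" for \<alpha> using QP[OF \<gamma>', of \<alpha> \<alpha>] QP[OF a1, of \<alpha> \<alpha>] by linarith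
            have "\<bar>pot s (\<lambda>y. sqrt (\<gamma> y) - 1) x - pot s (\<lambda>y. sqrt ((\<lambda>_. 1) y) - 1) x\<bar>
                \<le> ?C * (D * M ^ N * (2 * K) + D * r ^ N * measure lborel (cball (0::real^'n) 1))"
            proof (rule pot_perturbation_diff[OF s(1,2) \<gamma>' a1 x finite_midx])
              show "(\<Sum>\<alpha>\<in>?I. \<bar>a \<alpha> x\<bar>) \<le> D * M ^ N" using x by (intro a) (auto simp: mem_Ann)
              show "\<bar>norm (y - x) powr (- ?q) - (\<Sum>\<alpha>\<in>?I. monom_at \<alpha> y * a \<alpha> x)\<bar> \<le> D * r ^ N" if "norm y \<le> 1" for y
                using that x by (intro k) (auto simp: mem_Ann)
            qed (use P1 K1(1) in auto)
            then show "\<bar>pot s (\<lambda>y. sqrt (\<gamma> y) - 1) x\<bar> \<le> ?C * (D * M ^ N * (2 * K) + D * r ^ N * measure lborel (cball (0::real^'n) 1))"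
              by (simp add: pot_def)
          qed
          then obtain B where B: "\<And>x. x \<in> Ann \<Longrightarrow> \<bar>pot s (\<lambda>y. sqrt (\<gamma> y) - 1) x\<bar> \<le> B" by blast
          show ?thesis
          proof (rule Bochner_Integration.integrable_bound)
            show "integrable lborel (\<lambda>x. B * (f' x * g' x))" using fgi by simp
            show "(\<lambda>x. f' x * g' x * pot s (\<lambda>y. sqrt (\<gamma> y) - 1) x) \<in> borel_measurable lborel" using fm gm by measurable
            show "AE x in lborel. norm (f' x * g' x * pot s (\<lambda>y. sqrt (\<gamma> y) - 1) x) \<le> norm (B * (f' x * g' x))"
            proof (intro AE_I2)
              fix x show "norm (f' x * g' x * pot s (\<lambda>y. sqrt (\<gamma> y) - 1) x) \<le> norm (B * (f' x * g' x))"
              proof (cases "x \<in> Ann")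
                case True
                then have "\<bar>pot s (\<lambda>y. sqrt (\<gamma> y) - 1) x\<bar> \<le> \<bar>B\<bar>" using B[of x] by linarith
                then show ?thesis unfolding real_norm_def abs_mult[of "f' x * g' x"] abs_mult[of B]
                  by (subst mult.commute) (rule mult_right_mono, auto)
              qed (simp add: f'_def)
            qed
          qed
        qed
        have "Bform s \<gamma>1 f' g' - Bform s \<gamma>2 f' g' = (\<integral>x. f' x * g' x * ?m1 x - f' x * g' x * ?m2 x \<partial>lborel)"
          unfolding Bform_Hann[OF s(1,2) \<gamma>(1) fH gH] Bform_Hann[OF s(1,2) \<gamma>(2) fH gH] using mi[OF \<gamma>(1)] mi[OF \<gamma>(2)] by simp
        also have "\<bar>\<dots>\<bar> \<le> (\<integral>x. E * \<bar>f' x * g' x\<bar> \<partial>lborel)"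
        proof (rule Bochner_Integration.integral_abs_bound_integral)
          show "integrable lborel (\<lambda>x. f' x * g' x * ?m1 x - f' x * g' x * ?m2 x)" using mi[OF \<gamma>(1)] mi[OF \<gamma>(2)] by simp
          show "integrable lborel (\<lambda>x. E * \<bar>f' x * g' x\<bar>)" using fgi by simp
          fix x
          have "f' x * g' x * ?m1 x - f' x * g' x * ?m2 x = (?m1 x - ?m2 x) * (f' x * g' x)" by (simp add: algebra_simps)
          moreover have "\<bar>?m1 x - ?m2 x\<bar> * \<bar>f' x * g' x\<bar> \<le> E * \<bar>f' x * g' x\<bar>"
          proof (cases "x \<in> Ann")
            case True
            then show ?thesis by (intro mult_right_mono md) auto
          qed (simp add: f'_def)
          ultimately show "\<bar>f' x * g' x * ?m1 x - f' x * g' x * ?m2 x\<bar> \<le> E * \<bar>f' x * g' x\<bar>" by (simp only: abs_mult)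
        qed
        also have "\<dots> = E * (\<integral>x. \<bar>f' x * g' x\<bar> \<partial>lborel)" by simp
        also have "\<dots> \<le> E" by (rule mult_left_le[OF fg1 E0])
        finally show ?thesis .
      qed
      have "\<bar>DN s \<gamma>1 f g - DN s \<gamma>2 f g\<bar> \<le> E + 3 * K0\<^sup>2 * c1 * (c1 * r ^ N) + 3 * K0\<^sup>2 * c1 * (c1 * r ^ N) + (c1 * M ^ N) * (c1 * M ^ N) * \<delta>"
        unfolding v1(2) v2(2) using e1 e2 e3 e4 by linarith
      also have "\<dots> \<le> (c1\<^sup>2 + ?C * D) * (M ^ N * M ^ N * \<delta>) + (6 * K0\<^sup>2 * c1\<^sup>2 + ?C * D * \<mu>) * r ^ N"
      proof -
        \<comment> \<open>The moments carry only one factor \<open>M ^ N\<close>; it is enlarged to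
          two to match the term from \<open>Qm\<close>.\<close>
        have "M ^ N * \<delta> \<le> M ^ N * (M ^ N * \<delta>)" using mult_right_mono[OF MN, of "M ^ N * \<delta>"] MN \<delta> by simp
        from mult_left_mono[OF this Knn(3)] show ?thesis
          unfolding E_def by (simp add: power2_eq_square algebra_simps)
      qed
      also have "\<dots> \<le> K * (M ^ N * M ^ N * \<delta>) + K * r ^ N"
        using K1(4,5) MN \<delta> rN by (intro add_mono mult_right_mono) auto
      finally show ?thesis by (simp add: distrib_left)
    qed
    show ?thesis unfolding DN_diff_norm_def
      by (rule SUP_least) (use bound in auto)
  qed
  show ?thesis using K1(1) M r QP main by (intro exI[of _ K] exI[of _ M] exI[of _ r]) blast
qed

section \<open>Conductivities with many bumps\<close>

text \<open>The spacing 3 exceeds the side 2 of the support of \<open>psi\<close>, so the supports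
  of different bumps are disjoint; with the offset 1 the bump at \<open>j\<close> occupies
  [3j, 3j+2] in each coordinate.\<close>

definition ctr :: "('n::finite \<Rightarrow> nat) \<Rightarrow> real^'n" where
  "ctr j = (\<chi> i. 3 * real (j i) + 1)"

text \<open>The parameters make the family closed under partial derivatives: the constant
  \<open>b\<close> becomes 0, one entry of \<open>\<kappa>\<close> rises and \<open>c\<close> is
  divided by \<open>r\<close>.\<close>

definition bumps :: "('n::finite \<Rightarrow> nat) set \<Rightarrow> real \<Rightarrow> real \<Rightarrow> ('n \<Rightarrow> nat) \<Rightarrow> real \<Rightarrow> real^'n \<Rightarrow> real" where
  "bumps \<sigma> r b \<kappa> c x = b + c * (\<Sum>j\<in>\<sigma>. psi \<kappa> ((1 / r) *\<^sub>R x - ctr j))"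

lemma bumps_DERIV:
  "((\<lambda>t. bumps \<sigma> r b \<kappa> c (x + t *\<^sub>R axis i 1)) has_real_derivative bumps \<sigma> r 0 (\<kappa>(i := Suc (\<kappa> i))) (c / r) x) (at 0)"
proof -
  let ?\<kappa>' = "\<kappa>(i := Suc (\<kappa> i))"
  have 1: "((\<lambda>t. psi \<kappa> ((1 / r) *\<^sub>R (x + t *\<^sub>R axis i 1) - ctr j)) has_real_derivative psi ?\<kappa>' ((1 / r) *\<^sub>R x - ctr j) * (1 / r)) (at 0)" for j
  proof -
    let ?z = "(1 / r) *\<^sub>R x - ctr j"
    have "((\<lambda>t. psi \<kappa> (?z + (t * (1 / r)) *\<^sub>R axis i 1)) has_real_derivative psi ?\<kappa>' ?z * (1 / r)) (at 0)"
    proof (rule DERIV_chain2[where f="\<lambda>t. psi \<kappa> (?z + t *\<^sub>R axis i 1)" and g="\<lambda>t. t * (1 / r)"])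
      show "((\<lambda>t. psi \<kappa> (?z + t *\<^sub>R axis i 1)) has_real_derivative psi ?\<kappa>' ?z) (at (0 * (1 / r)))"
        using psi_DERIV[of \<kappa> ?z i] by simp
      show "((\<lambda>t. t * (1 / r)) has_real_derivative 1 / r) (at 0)"
        using DERIV_cmult_right[OF DERIV_ident, of "1 / r"] by simp
    qed
    moreover have "(1 / r) *\<^sub>R (x + t *\<^sub>R axis i 1) - ctr j = ?z + (t * (1 / r)) *\<^sub>R axis i 1" for t
      by (simp add: algebra_simps)
    ultimately show ?thesis by (simp only:)
  qed
  have 2: "((\<lambda>t. \<Sum>j\<in>\<sigma>. psi \<kappa> ((1 / r) *\<^sub>R (x + t *\<^sub>R axis i 1) - ctr j)) has_real_derivative (\<Sum>j\<in>\<sigma>. psi ?\<kappa>' ((1 / r) *\<^sub>R x - ctr j) * (1 / r))) (at 0)"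
    by (rule DERIV_sum) (rule 1)
  have "((\<lambda>t. b + c * (\<Sum>j\<in>\<sigma>. psi \<kappa> ((1 / r) *\<^sub>R (x + t *\<^sub>R axis i 1) - ctr j))) has_real_derivative (0 + c * (\<Sum>j\<in>\<sigma>. psi ?\<kappa>' ((1 / r) *\<^sub>R x - ctr j) * (1 / r)))) (at 0)"
    by (intro DERIV_add DERIV_const DERIV_cmult 2)
  moreover have "0 + c * (\<Sum>j\<in>\<sigma>. psi ?\<kappa>' ((1 / r) *\<^sub>R x - ctr j) * (1 / r)) = bumps \<sigma> r 0 ?\<kappa>' (c / r) x"
    by (simp add: bumps_def flip: sum_divide_distrib)
  ultimately show ?thesis unfolding bumps_def[of \<sigma> r b] by simp
qed

lemma pd_bumps: "pd i (bumps \<sigma> r b \<kappa> c) = bumps \<sigma> r 0 (\<kappa>(i := Suc (\<kappa> i))) (c / r)"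
  by (rule ext) (simp add: pd_def DERIV_imp_deriv[OF bumps_DERIV])

lemma dpart_bumps:
  "dpart is (bumps \<sigma> r b (\<lambda>_. 0) c) = bumps \<sigma> r (if is = [] then b else 0) (count_list is) (c / r ^ length is)"
proof (induction "is")
  case (Cons i "is")
  have eq: "(count_list is)(i := Suc (count_list is i)) = count_list (i # is)" by auto
  show ?case unfolding dpart.simps Cons.IH pd_bumps eq length_Cons power_Suc divide_divide_eq_left
    by (simp only: list.distinct if_False mult.commute simp_thms)
qed simp

lemma continuous_bumps: "continuous_on S (bumps \<sigma> r b \<kappa> c)"
proof -
  have "continuous_on S (\<lambda>x. psi \<kappa> ((1 / r) *\<^sub>R x - ctr j))" for j
    by (rule continuous_on_compose2[OF continuous_psi[of UNIV]]) (auto intro!: continuous_intros)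
  then show ?thesis unfolding bumps_def by (intro continuous_intros)
qed

lemma Ck_on_bumps: "Ck_on k U (bumps \<sigma> r b \<kappa> c)"
proof (rule Ck_onI[where S="{g. \<exists>b \<kappa> c. g = bumps \<sigma> r b \<kappa> c}"])
  fix g i assume "g \<in> {g. \<exists>b \<kappa> c. g = bumps \<sigma> r b \<kappa> c}"
  then obtain b \<kappa> c where g: "g = bumps \<sigma> r b \<kappa> c" by blast
  show "pd i g \<in> {g. \<exists>b \<kappa> c. g = bumps \<sigma> r b \<kappa> c}" unfolding g pd_bumps by blast
  show "(\<lambda>t. g (x + t *\<^sub>R axis i 1)) differentiable (at 0)" for x
    unfolding g using bumps_DERIV real_differentiable_def by blast
  show "continuous_on UNIV g" unfolding g by (rule continuous_bumps)
qed blast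

lemma sum_at_most_one:
  fixes f :: "'a \<Rightarrow> real"
  assumes "finite S" "\<And>j j'. j \<in> S \<Longrightarrow> j' \<in> S \<Longrightarrow> f j \<noteq> 0 \<Longrightarrow> f j' \<noteq> 0 \<Longrightarrow> j = j'"
    "\<And>j. j \<in> S \<Longrightarrow> \<bar>f j\<bar> \<le> B" "0 \<le> B"
  shows "\<bar>\<Sum>j\<in>S. f j\<bar> \<le> B"
proof (cases "\<exists>j\<in>S. f j \<noteq> 0")
  case True
  then obtain j where j: "j \<in> S" "f j \<noteq> 0" by blast
  have "(\<Sum>j\<in>S. f j) = (\<Sum>j\<in>{j}. f j)"
    using j assms(1,2) by (intro sum.mono_neutral_right) auto
  then show ?thesis using assms(3)[OF j(1)] by simp
next
  case False
  then have "(\<Sum>j\<in>S. f j) = 0" by (intro sum.neutral) auto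
  then show ?thesis using assms(4) by simp
qed

lemma psi_ctr_unique:
  fixes X :: "real^'n::finite"
  assumes "psi \<kappa> (X - ctr j) \<noteq> 0" "psi \<kappa> (X - ctr j') \<noteq> 0"
  shows "j = j'"
proof
  fix i
  have "\<bar>X $ i - (3 * real (j i) + 1)\<bar> \<le> 1" "\<bar>X $ i - (3 * real (j' i) + 1)\<bar> \<le> 1"
    using psi_support[OF assms(1), of i] psi_support[OF assms(2), of i] by (simp_all add: ctr_def)
  then have "\<bar>3 * real (j i) - 3 * real (j' i)\<bar> \<le> 2" by linarith
  then show "j i = j' i" by linarith
qed

text \<open>Interpolation: a quantity bounded both by a constant and by t is bounded by that
  constant, or by t, raised to any power of t between 0 and 1 after normalisation.\<close>

lemma min_le_powr:
  fixes t a :: real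
  assumes "0 < t" "0 \<le> a" "a \<le> 1"
  shows "min 1 t \<le> t powr a"
proof (cases "t \<le> 1")
  case True
  then have "t powr 1 \<le> t powr a" using assms by (intro powr_mono') auto
  then show ?thesis using assms True by simp
next
  case False
  then show ?thesis using assms ge_one_powr_ge_zero[of t a] by simp
qed

context
  fixes A :: real and m :: nat and \<sigma> :: "('n::finite \<Rightarrow> nat) set"
  assumes A: "1 \<le> A" "\<And>k t. k \<le> Suc m \<Longrightarrow> \<bar>dbump k t\<bar> \<le> A" and \<sigma>: "finite \<sigma>"
begin

lemma A_pow: "1 \<le> A ^ CARD('n)" using A(1) by simp

lemma bumps_bound:
  assumes "\<And>i. \<kappa> i \<le> m" "0 \<le> c"
  shows "\<bar>bumps \<sigma> r b \<kappa> c x\<bar> \<le> \<bar>b\<bar> + c * A ^ CARD('n)"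
proof -
  have "\<bar>\<Sum>j\<in>\<sigma>. psi \<kappa> ((1 / r) *\<^sub>R x - ctr j)\<bar> \<le> A ^ CARD('n)"
    using psi_ctr_unique psi_bounds(1)[where \<kappa>=\<kappa>, OF A assms(1)] A_pow by (intro sum_at_most_one[OF \<sigma>]) auto
  then have "c * \<bar>\<Sum>j\<in>\<sigma>. psi \<kappa> ((1 / r) *\<^sub>R x - ctr j)\<bar> \<le> c * A ^ CARD('n)" using assms(2) by (rule mult_left_mono)
  then show ?thesis unfolding bumps_def
    using abs_triangle_ineq[of b "c * (\<Sum>j\<in>\<sigma>. psi \<kappa> ((1 / r) *\<^sub>R x - ctr j))"] assms(2) by (simp add: abs_mult)
qed

text \<open>The points may lie in different bumps, so the sum is split into the bump that is nonzero
  at \<open>x\<close> and the one that is zero at \<open>x\<close> but nonzero at \<open>y\<close>.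
  Each part has at most one nonzero term, so the number of bumps does not enter; the constant 4 is 2
  for the parts times 2 in the bound \<open>B\<close>.\<close>

lemma bumps_Holder:
  assumes \<kappa>: "\<And>i. \<kappa> i \<le> m" and c: "0 \<le> c" and r: "0 < r" and a: "0 \<le> a" "a \<le> 1" and xy: "x \<noteq> y"
  shows "\<bar>bumps \<sigma> r b \<kappa> c x - bumps \<sigma> r b \<kappa> c y\<bar> \<le> c * (4 * A ^ CARD('n) * real CARD('n)) * (dist x y / r) powr a"
proof -
  define t where "t = dist x y / r"
  have t: "0 < t" using xy r by (simp add: t_def)
  define B where "B = 2 * A ^ CARD('n) * real CARD('n) * t powr a"
  have B0: "0 \<le> B" using A_pow by (simp add: B_def)
  let ?f = "\<lambda>j x. psi \<kappa> ((1 / r) *\<^sub>R x - ctr j)"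
  have n1: "1 \<le> real CARD('n)" by (simp add: Suc_leI)
  have le: "\<bar>?f j x - ?f j y\<bar> \<le> B" for j
  proof -
    have d: "dist ((1 / r) *\<^sub>R x - ctr j) ((1 / r) *\<^sub>R y - ctr j) = t"
      using r by (simp add: dist_norm t_def flip: scaleR_right_diff_distrib)
    have 1: "\<bar>?f j x - ?f j y\<bar> \<le> A ^ CARD('n) * real CARD('n) * t"
      using psi_bounds(2)[where \<kappa>=\<kappa>, OF A \<kappa>, of "(1 / r) *\<^sub>R x - ctr j" "(1 / r) *\<^sub>R y - ctr j"] unfolding d .
    have "\<bar>?f j x - ?f j y\<bar> \<le> A ^ CARD('n) + A ^ CARD('n)"
      using psi_bounds(1)[where \<kappa>=\<kappa>, OF A \<kappa>, of "(1 / r) *\<^sub>R x - ctr j"] psi_bounds(1)[where \<kappa>=\<kappa>, OF A \<kappa>, of "(1 / r) *\<^sub>R y - ctr j"] by linarith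
    also have "\<dots> \<le> 2 * A ^ CARD('n) * real CARD('n)" using mult_left_mono[OF n1, of "2 * A ^ CARD('n)"] A_pow by simp
    finally have 2: "\<bar>?f j x - ?f j y\<bar> \<le> 2 * A ^ CARD('n) * real CARD('n) * 1" by simp
    have "0 \<le> A ^ CARD('n) * real CARD('n) * t" using A_pow t by simp
    with 1 have 1: "\<bar>?f j x - ?f j y\<bar> \<le> 2 * A ^ CARD('n) * real CARD('n) * t" by linarith
    have "\<bar>?f j x - ?f j y\<bar> \<le> 2 * A ^ CARD('n) * real CARD('n) * min 1 t"
      using 1 2 by (cases "t \<le> 1") (simp_all add: min_def)
    also have "\<dots> \<le> B" unfolding B_def using A_pow min_le_powr[OF t a] by (intro mult_left_mono) auto
    finally show ?thesis .
  qed
  have "(\<Sum>j\<in>\<sigma>. ?f j x) - (\<Sum>j\<in>\<sigma>. ?f j y) = (\<Sum>j\<in>\<sigma>. if ?f j x \<noteq> 0 then ?f j x - ?f j y else 0) + (\<Sum>j\<in>\<sigma>. if ?f j x = 0 then ?f j x - ?f j y else 0)"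
    unfolding sum_subtractf[symmetric] sum.distrib[symmetric] by (intro sum.cong) auto
  moreover have "\<bar>\<Sum>j\<in>\<sigma>. if ?f j x \<noteq> 0 then ?f j x - ?f j y else 0\<bar> \<le> B"
  proof (rule sum_at_most_one[OF \<sigma>])
    show "j = j'" if "(if ?f j x \<noteq> 0 then ?f j x - ?f j y else 0) \<noteq> 0" "(if ?f j' x \<noteq> 0 then ?f j' x - ?f j' y else 0) \<noteq> 0" for j j'
      using that by (intro psi_ctr_unique[of \<kappa> "(1 / r) *\<^sub>R x"]) (auto split: if_splits)
  qed (use le B0 in auto)
  moreover have "\<bar>\<Sum>j\<in>\<sigma>. if ?f j x = 0 then ?f j x - ?f j y else 0\<bar> \<le> B"
  proof (rule sum_at_most_one[OF \<sigma>])
    show "j = j'" if "(if ?f j x = 0 then ?f j x - ?f j y else 0) \<noteq> 0" "(if ?f j' x = 0 then ?f j' x - ?f j' y else 0) \<noteq> 0" for j j'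
      using that by (intro psi_ctr_unique[of \<kappa> "(1 / r) *\<^sub>R y"]) (auto split: if_splits)
    show "\<bar>if ?f j x = 0 then ?f j x - ?f j y else 0\<bar> \<le> B" for j using le[of j] B0 by auto
  qed (use B0 in auto)
  ultimately have "\<bar>(\<Sum>j\<in>\<sigma>. ?f j x) - (\<Sum>j\<in>\<sigma>. ?f j y)\<bar> \<le> 2 * B" by linarith
  then have "c * \<bar>(\<Sum>j\<in>\<sigma>. ?f j x) - (\<Sum>j\<in>\<sigma>. ?f j y)\<bar> \<le> c * (2 * B)" using c by (rule mult_left_mono)
  moreover have "bumps \<sigma> r b \<kappa> c x - bumps \<sigma> r b \<kappa> c y = c * ((\<Sum>j\<in>\<sigma>. ?f j x) - (\<Sum>j\<in>\<sigma>. ?f j y))"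
    by (simp add: bumps_def right_diff_distrib)
  ultimately show ?thesis using c by (simp add: abs_mult B_def t_def mult_ac)
qed

text \<open>A derivative costs 1/r and the Hoelder quotient r^-a, altogether r^-l. An amplitude of
  order r^l therefore keeps the norm bounded independently of \<open>r\<close> and of
  \<open>\<sigma>\<close>.\<close>

lemma holder_norm_bumps:
  assumes l: "0 < l" "m = nat \<lfloor>l\<rfloor>" and r: "0 < r" "r \<le> 1" and c: "0 \<le> c" "c \<le> C * r powr l"
  shows "holder_norm l U (bumps \<sigma> r 1 (\<lambda>_. 0) c) \<le> ereal ((1 + C * A ^ CARD('n)) + C * (4 * A ^ CARD('n) * real CARD('n)))"
proof -
  let ?g = "bumps \<sigma> r 1 (\<lambda>_. 0) c"
  define a where "a = l - of_int \<lfloor>l\<rfloor>"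
  have a: "0 \<le> a" "a \<le> 1" unfolding a_def by linarith+
  have ml: "real m = of_int \<lfloor>l\<rfloor>" using l by simp
  have lpos: "0 < r powr l" using r by simp
  have C0: "0 \<le> C" using c lpos by (meson mult_neg_pos not_less order_trans)
  have cnt: "count_list is i \<le> m" if "length is \<le> m" for "is" :: "'n list" and i
    using count_le_length[of "is" i] that by simp
  have ck: "c / r ^ k \<le> C" "0 \<le> c / r ^ k" if "k \<le> m" for k
  proof -
    have "r powr l \<le> r powr real k" using r that ml by (intro powr_mono') linarith+
    then have "r powr l \<le> r ^ k" using r by (simp add: powr_realpow)
    then have "c \<le> C * r ^ k" using c C0 by (meson mult_left_mono order_trans)
    then show "c / r ^ k \<le> C" using r by (simp add: divide_le_eq)
    show "0 \<le> c / r ^ k" using c r by simp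
  qed
  have "\<bar>dpart is ?g x\<bar> \<le> 1 + C * A ^ CARD('n)" if "length is \<le> m" for "is" x
  proof -
    have "\<bar>dpart is ?g x\<bar> \<le> \<bar>if is = [] then 1 else 0\<bar> + (c / r ^ length is) * A ^ CARD('n)"
      unfolding dpart_bumps using cnt[OF that] ck[OF that] by (intro bumps_bound) auto
    also have "\<dots> \<le> 1 + C * A ^ CARD('n)"
      using ck[OF that] A_pow by (intro add_mono mult_right_mono) auto
    finally show ?thesis .
  qed
  then have 1: "(SUP is\<in>{is. length is \<le> m}. SUP x\<in>U. ereal \<bar>dpart is ?g x\<bar>) \<le> ereal (1 + C * A ^ CARD('n))"
    by (auto intro!: SUP_least)
  have "\<bar>dpart is ?g x - dpart is ?g y\<bar> / dist x y powr a \<le> C * (4 * A ^ CARD('n) * real CARD('n))"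
    if "length is = m" "x \<noteq> y" for "is" x y
  proof -
    let ?H = "4 * A ^ CARD('n) * real CARD('n)"
    have d: "0 < dist x y powr a" using that by simp
    have "\<bar>dpart is ?g x - dpart is ?g y\<bar> \<le> (c / r ^ m) * ?H * (dist x y / r) powr a"
      unfolding dpart_bumps that(1) using that cnt[of "is"] ck(2)[of m] r a by (intro bumps_Holder) auto
    also have "\<dots> = (c / (r ^ m * r powr a)) * ?H * dist x y powr a"
      using r by (simp add: powr_divide)
    also have "r ^ m * r powr a = r powr l"
    proof -
      have "r ^ m * r powr a = r powr real m * r powr a" using r by (simp add: powr_realpow)
      also have "\<dots> = r powr (real m + a)" by (simp add: powr_add)
      finally show ?thesis by (simp add: a_def ml)
    qed
    also have "(c / r powr l) * ?H * dist x y powr a \<le> C * ?H * dist x y powr a"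
      using c lpos A_pow by (intro mult_right_mono) (auto simp: divide_le_eq)
    finally show ?thesis using d by (simp add: divide_le_eq)
  qed
  then have 2: "(SUP is\<in>{is. length is = m}. SUP p\<in>{(x,y). x \<in> U \<and> y \<in> U \<and> x \<noteq> y}.
          ereal (\<bar>dpart is ?g (fst p) - dpart is ?g (snd p)\<bar> / dist (fst p) (snd p) powr a)) \<le> ereal (C * (4 * A ^ CARD('n) * real CARD('n)))"
    by (auto intro!: SUP_least)
  show ?thesis
    unfolding holder_norm_def Let_def l(2)[symmetric] a_def[symmetric]
    by (rule order_trans[OF add_mono[OF 1 2]]) simp
qed

end

text \<open>On the support of the bumps every coordinate is at most 3 (d + 1) r, and the l1 norm
  bounds the Euclidean norm.\<close>

lemma bumps_far:
  fixes x :: "real^'n::finite"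
  assumes \<sigma>: "\<sigma> \<subseteq> midx d" and r: "0 < r" "3 * real CARD('n) * real (d + 1) * r \<le> 1" and x: "1 < norm x"
  shows "bumps \<sigma> r b \<kappa> c x = b"
proof -
  have "psi \<kappa> ((1 / r) *\<^sub>R x - ctr j) = 0" if j: "j \<in> \<sigma>" for j
  proof (rule ccontr)
    assume nz: "psi \<kappa> ((1 / r) *\<^sub>R x - ctr j) \<noteq> 0"
    have "\<bar>x $ i\<bar> \<le> 3 * real (d + 1) * r" for i
    proof -
      have "\<bar>x $ i / r - (3 * real (j i) + 1)\<bar> \<le> 1" using psi_support[OF nz, of i] by (simp add: ctr_def)
      moreover have "real (j i) \<le> real d" using \<sigma> j by (auto simp: midx_def)
      ultimately have "\<bar>x $ i / r\<bar> \<le> 3 * real (d + 1)" by simp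
      then show ?thesis using r(1) by (simp add: divide_le_eq)
    qed
    then have "(\<Sum>i\<in>UNIV. \<bar>x $ i\<bar>) \<le> (\<Sum>i\<in>(UNIV::'n set). 3 * real (d + 1) * r)" by (rule sum_mono)
    also have "\<dots> = 3 * real CARD('n) * real (d + 1) * r" by simp
    finally have "norm x \<le> 1" using norm_le_l1_cart[of x] r(2) by linarith
    then show False using x by simp
  qed
  then show ?thesis by (simp add: bumps_def)
qed

text \<open>The value at a centre reveals whether its index belongs to \<open>\<sigma>\<close>,
  which separates different conductivities.\<close>

lemma bumps_at_ctr:
  fixes j :: "'n::finite \<Rightarrow> nat"
  assumes "finite \<sigma>" "0 < r"
  shows "bumps \<sigma> r b (\<lambda>_. 0) c (r *\<^sub>R ctr j) = b + (if j \<in> \<sigma> then c * psi (\<lambda>_. 0) (0::real^'n) else 0)"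
proof -
  have z: "psi (\<lambda>_. 0) (ctr j - ctr j') = 0" if "j' \<noteq> j" for j'
  proof (rule ccontr)
    assume nz: "psi (\<lambda>_. 0) (ctr j - ctr j') \<noteq> 0"
    have "j = j'" by (rule psi_ctr_unique[OF _ nz]) (simp add: less_imp_neq[OF psi_0_pos, symmetric])
    then show False using that by simp
  qed
  have "(\<Sum>j'\<in>\<sigma>. psi (\<lambda>_. 0) ((1 / r) *\<^sub>R (r *\<^sub>R ctr j) - ctr j')) = (\<Sum>j'\<in>\<sigma>. if j' = j then psi (\<lambda>_. 0) (0::real^'n) else 0)"
    using assms(2) z by (intro sum.cong) auto
  then show ?thesis using assms(1) by (simp add: bumps_def)
qed

lemma norm_ctr_less:
  fixes j :: "'n::finite \<Rightarrow> nat"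
  assumes "j \<in> midx d" "0 < r" "3 * real CARD('n) * real (d + 1) * r \<le> 1"
  shows "norm (r *\<^sub>R ctr j) < 1"
proof -
  have "\<bar>(r *\<^sub>R ctr j) $ i\<bar> \<le> r * (3 * real d + 1)" for i
    using assms(1,2) by (auto simp: ctr_def midx_def abs_mult intro!: mult_left_mono)
  then have "(\<Sum>i\<in>UNIV. \<bar>(r *\<^sub>R ctr j) $ i\<bar>) \<le> (\<Sum>i\<in>(UNIV::'n set). r * (3 * real d + 1))" by (rule sum_mono)
  also have "\<dots> = real CARD('n) * r * (3 * real d + 1)" by simp
  also have "\<dots> < real CARD('n) * r * (3 * real (d + 1))" using assms(2) by (intro mult_strict_left_mono) auto
  also have "\<dots> \<le> 1" using assms(3) by (simp add: mult_ac)
  finally show ?thesis using norm_le_l1_cart[of "r *\<^sub>R ctr j"] by linarith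
qed

text \<open>By continuity the strict inequality persists on a nonempty open set, which is not a null
  set.\<close>

lemma esssup_ge_of_continuous:
  fixes D :: "real^'n::finite \<Rightarrow> real"
  assumes D: "continuous_on UNIV D" and x0: "x0 \<in> ball 0 1" "e < D x0"
  shows "ereal e \<le> esssup (restrict_space lborel (ball 0 1)) (\<lambda>x. ereal (D x))"
proof (rule ccontr)
  assume "\<not> ?thesis"
  then have lt: "esssup (restrict_space lborel (ball 0 1)) (\<lambda>x. ereal (D x)) < ereal e" by simp
  have "AE x in restrict_space lborel (ball 0 1). ereal (D x) \<le> esssup (restrict_space lborel (ball 0 1)) (\<lambda>x. ereal (D x))"
    by (rule esssup_AE)
  then have "AE x in restrict_space lborel (ball 0 1). ereal (D x) < ereal e"
  proof eventually_elim
    case (elim x)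
    from le_less_trans[OF elim lt] show ?case .
  qed
  then have ae: "AE x in lborel. x \<in> ball 0 1 \<longrightarrow> D x < e"
    by (subst (asm) AE_restrict_space_iff) auto
  let ?O = "ball 0 1 \<inter> {x. e < D x}"
  have "open ?O" by (intro open_Int open_ball open_Collect_less continuous_on_const D)
  moreover have "x0 \<in> ?O" using x0 by simp
  ultimately have "\<not> negligible ?O" using open_not_negligible by blast
  moreover have "?O \<in> null_sets lborel"
    using ae \<open>open ?O\<close> by (subst AE_iff_null_sets) (auto elim: eventually_mono)
  ultimately show False using negligible_iff_null_sets null_sets_completionI by blast
qed

section \<open>The pigeonhole argument\<close>

text \<open>Cells are labelled by the integers floor(q/delta), and equal labels force a difference
  of at most delta. The labels range over -B..B with B < K/delta + 1, at most 2K/delta + 3 values;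
  this is the origin of the constant 3.\<close>

lemma pigeonhole_reals:
  fixes q :: "'s \<Rightarrow> 't \<Rightarrow> real" and p :: nat
  assumes S: "finite S" and T: "finite T" and q: "\<And>\<sigma> t. \<sigma> \<in> S \<Longrightarrow> t \<in> T \<Longrightarrow> \<bar>q \<sigma> t\<bar> \<le> K" and \<delta>: "0 < \<delta>"
    and p: "2 * K / \<delta> + 3 \<le> real p" and card: "p ^ card T < card S"
  shows "\<exists>\<sigma>\<in>S. \<exists>\<sigma>'\<in>S. \<sigma> \<noteq> \<sigma>' \<and> (\<forall>t\<in>T. \<bar>q \<sigma> t - q \<sigma>' t\<bar> \<le> \<delta>)"
proof -
  define B where "B = \<lceil>K / \<delta>\<rceil>"
  define \<Phi> where "\<Phi> \<sigma> = (\<lambda>t\<in>T. \<lfloor>q \<sigma> t / \<delta>\<rfloor>)" for \<sigma>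
  have "\<Phi> ` S \<subseteq> T \<rightarrow>\<^sub>E {- B..B}"
  proof (intro image_subsetI PiE_I)
    fix \<sigma> t assume *: "\<sigma> \<in> S" "t \<in> T"
    have "q \<sigma> t / \<delta> \<le> K / \<delta>" "- (K / \<delta>) \<le> q \<sigma> t / \<delta>"
      using q[OF *] \<delta> by (auto simp: abs_le_iff field_simps)
    then have "\<lfloor>q \<sigma> t / \<delta>\<rfloor> \<le> B" "- B \<le> \<lfloor>q \<sigma> t / \<delta>\<rfloor>" unfolding B_def by linarith+
    then show "\<Phi> \<sigma> t \<in> {- B..B}" using * by (simp add: \<Phi>_def)
  qed (simp add: \<Phi>_def)
  then have "card (\<Phi> ` S) \<le> card (T \<rightarrow>\<^sub>E {- B..B})" using T by (intro card_mono finite_PiE) auto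
  also have "\<dots> = nat (2 * B + 1) ^ card T" using T by (simp add: card_PiE)
  also have "\<dots> \<le> p ^ card T"
  proof (rule power_mono)
    have "real_of_int (2 * B + 1) \<le> real p" using p unfolding B_def by simp linarith
    then have "2 * B + 1 \<le> int p" by linarith
    then show "nat (2 * B + 1) \<le> p" by simp
  qed simp
  finally have "card (\<Phi> ` S) < card S" using card by simp
  then have "\<not> inj_on \<Phi> S" by (rule pigeonhole)
  then obtain \<sigma> \<sigma>' where \<sigma>: "\<sigma> \<in> S" "\<sigma>' \<in> S" "\<sigma> \<noteq> \<sigma>'" "\<Phi> \<sigma> = \<Phi> \<sigma>'" by (auto simp: inj_on_def)
  have "\<bar>q \<sigma> t - q \<sigma>' t\<bar> \<le> \<delta>" if "t \<in> T" for t
  proof -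
    have "\<lfloor>q \<sigma> t / \<delta>\<rfloor> = \<lfloor>q \<sigma>' t / \<delta>\<rfloor>" using fun_cong[OF \<sigma>(4), of t] that by (simp add: \<Phi>_def)
    then have "\<bar>q \<sigma> t / \<delta> - q \<sigma>' t / \<delta>\<bar> \<le> 1" by linarith
    then have "\<bar>q \<sigma> t - q \<sigma>' t\<bar> / \<delta> \<le> 1" using \<delta> by (simp flip: diff_divide_distrib)
    then show ?thesis using \<delta> by (simp add: divide_le_eq)
  qed
  then show ?thesis using \<sigma> by blast
qed

theorem theorem1p6:
  fixes s l :: real
  assumes "0 < s" "s < 1" "2 * s < real CARD('n::finite)"
    and "0 < l" "l \<notin> \<nat>" "0 < l - 2 * s" "l - 2 * s \<notin> \<nat>"
  shows "\<exists>\<beta>>0. \<exists>\<epsilon>0>0. \<forall>\<epsilon>. 0 < \<epsilon> \<and> \<epsilon> < \<epsilon>0 \<longrightarrow>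
     (\<exists>\<gamma>1 \<gamma>2 :: real^'n \<Rightarrow> real.
        \<gamma>1 \<in> holder_space l \<and> \<gamma>2 \<in> holder_space l \<and>
        DN_diff_norm s \<gamma>1 \<gamma>2
          \<le> ereal (exp (- (\<epsilon> powr (- (real CARD('n) / ((2 * real CARD('n) + 3) * l)))))) \<and>
        esssup (restrict_space lborel (ball 0 1)) (\<lambda>x. ereal \<bar>\<gamma>1 x - \<gamma>2 x\<bar>) \<ge> ereal \<epsilon> \<and>
        holder_norm l (ball 0 1) \<gamma>1 \<le> ereal \<beta> \<and> holder_norm l (ball 0 1) \<gamma>2 \<le> ereal \<beta> \<and>
        (\<forall>x. 1 \<le> \<gamma>1 x \<and> \<gamma>1 x \<le> 2) \<and> (\<forall>x. 1 \<le> \<gamma>2 x \<and> \<gamma>2 x \<le> 2))"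
proof -
  let ?n = "CARD('n)"
  obtain K M \<rho> where K: "1 \<le> K" and M: "1 \<le> M" and \<rho>: "0 < \<rho>" "\<rho> < 1"
    and QP: "\<And>(\<gamma>::'n fn) \<alpha> \<beta>. adm \<gamma> \<Longrightarrow> \<bar>Qm s \<gamma> \<alpha> \<beta>\<bar> \<le> K \<and> \<bar>Pm \<gamma> \<alpha>\<bar> \<le> K"
    and stab: "\<And>N \<delta> \<gamma>1 (\<gamma>2::'n fn). adm \<gamma>1 \<Longrightarrow> adm \<gamma>2 \<Longrightarrow> 0 \<le> \<delta> \<Longrightarrow>
      (\<forall>\<alpha>\<in>midx (2 * N). \<forall>\<beta>\<in>midx (2 * N). \<bar>Qm s \<gamma>1 \<alpha> \<beta> - Qm s \<gamma>2 \<alpha> \<beta>\<bar> \<le> \<delta>) \<Longrightarrow>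
      (\<forall>\<alpha>\<in>midx (2 * N). \<bar>Pm \<gamma>1 \<alpha> - Pm \<gamma>2 \<alpha>\<bar> \<le> \<delta>) \<Longrightarrow>
      DN_diff_norm s \<gamma>1 \<gamma>2 \<le> ereal (K * (M ^ N * M ^ N * \<delta> + \<rho> ^ N))"
    using DN_stability[OF assms(1-3)] by blast
  define m where "m = nat \<lfloor>l\<rfloor>"
  obtain A where A: "1 \<le> A" "\<And>k t. k \<le> Suc m \<Longrightarrow> \<bar>dbump k t\<bar> \<le> A" using dbump_bounded by blast
  have An: "1 \<le> A ^ ?n" using A(1) by simp
  define p0 where "p0 = psi (\<lambda>_. 0) (0::real^'n)"
  have p0: "0 < p0" unfolding p0_def by (rule psi_0_pos)
  \<comment> \<open>With amplitude C eps the bump at its centre has height 2 eps, which leaves the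
    strict inequality needed for the essential supremum.\<close>
  define C where "C = 2 / p0"
  have C: "0 < C" using p0 by (simp add: C_def)
  define \<beta> where "\<beta> = (1 + C * A ^ ?n) + C * (4 * A ^ ?n * real ?n)"
  have \<beta>: "0 < \<beta>" using C An unfolding \<beta>_def by (intro add_pos_nonneg) auto
  \<comment> \<open>2^p bounds the N-th root of the number of mesh values per coordinate: 2K/delta +
    3 <= (5 K M^2 / rho)^N.\<close>
  obtain p where p: "5 * K * M\<^sup>2 / \<rho> \<le> 2 ^ p"
    using real_arch_pow[of 2 "5 * K * M\<^sup>2 / \<rho>"] by (auto intro: less_imp_le)
  have n1: "1 \<le> real ?n" by (simp add: Suc_leI)
  define \<theta> where "\<theta> = real ?n / ((2 * real ?n + 3) * l)"
  have \<theta>: "0 < \<theta>" using assms(4) n1 by (simp add: \<theta>_def)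
  have ln\<rho>: "0 < - ln \<rho>" using \<rho> by simp
  have lnK: "0 \<le> ln (2 * K)" using K by simp
  \<comment> \<open>Chosen so that N <= c2 L whenever L >= 1; the final 1 accounts for the rounding
    in \<open>N\<close>.\<close>
  define c2 where "c2 = (1 + ln (2 * K)) / (- ln \<rho>) + 1"
  have "0 \<le> (1 + ln (2 * K)) / (- ln \<rho>)" using ln\<rho> lnK by (intro divide_nonneg_pos) auto
  then have c2: "1 \<le> c2" unfolding c2_def by linarith
  \<comment> \<open>Collects the counting constants: 2 from D + 1 <= 2D, 9^n from (2N + 1)^(2n) <=
    (3N)^(2n), the power of c2 from N <= c2 L, and (6n)^n from the lower bound d + 1 >=
    1/(6nr).\<close>
  define c5 where "c5 = 2 * real p * 9 ^ ?n * c2 ^ (2 * ?n + 1) * (6 * real ?n) ^ ?n"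
  have c5: "0 \<le> c5" using c2 by (simp add: c5_def)
  define L0 where "L0 = c5 + 1"
  have L0: "1 \<le> L0" using c5 by (simp add: L0_def)
  \<comment> \<open>The three terms guarantee in turn L >= L0 > c5, r <= 1/(6n), and c A^n <= 1,
    which keeps the conductivities below 2.\<close>
  define \<epsilon>0 where "\<epsilon>0 = min (L0 powr (- (1 / \<theta>))) (min ((1 / (6 * real ?n)) powr l) (1 / (C * A ^ ?n)))"
  have \<epsilon>0: "0 < \<epsilon>0" unfolding \<epsilon>0_def using L0 n1 C An by auto
  have main: "\<exists>\<gamma>1 \<gamma>2 :: real^'n \<Rightarrow> real.
        \<gamma>1 \<in> holder_space l \<and> \<gamma>2 \<in> holder_space l \<and>
        DN_diff_norm s \<gamma>1 \<gamma>2 \<le> ereal (exp (- (\<epsilon> powr (- \<theta>)))) \<and>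
        esssup (restrict_space lborel (ball 0 1)) (\<lambda>x. ereal \<bar>\<gamma>1 x - \<gamma>2 x\<bar>) \<ge> ereal \<epsilon> \<and>
        holder_norm l (ball 0 1) \<gamma>1 \<le> ereal \<beta> \<and> holder_norm l (ball 0 1) \<gamma>2 \<le> ereal \<beta> \<and>
        (\<forall>x. 1 \<le> \<gamma>1 x \<and> \<gamma>1 x \<le> 2) \<and> (\<forall>x. 1 \<le> \<gamma>2 x \<and> \<gamma>2 x \<le> 2)"
    if \<epsilon>: "0 < \<epsilon>" "\<epsilon> < \<epsilon>0" for \<epsilon>
  proof -
    define L where "L = \<epsilon> powr (- \<theta>)"
    have "L0 \<le> L"
    proof -
      have "(L0 powr (- (1 / \<theta>))) powr (- \<theta>) \<le> \<epsilon> powr (- \<theta>)"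
        using \<epsilon> \<theta> by (intro powr_mono2') (auto simp: \<epsilon>0_def)
      then show ?thesis using \<theta> L0 by (simp add: powr_powr L_def)
    qed
    then have L: "c5 < L" "1 \<le> L" using L0 by (auto simp: L0_def)
    define r where "r = \<epsilon> powr (1 / l)"
    have r: "0 < r" using \<epsilon> by (simp add: r_def)
    have rl: "r powr l = \<epsilon>" using \<epsilon> assms(4) by (simp add: r_def powr_powr)
    have rn: "r \<le> 1 / (6 * real ?n)"
    proof -
      have "r \<le> ((1 / (6 * real ?n)) powr l) powr (1 / l)"
        unfolding r_def using \<epsilon> assms(4) by (intro powr_mono2) (auto simp: \<epsilon>0_def)
      then show ?thesis using assms(4) n1 by (simp add: powr_powr)
    qed
    then have nr: "6 * real ?n * r \<le> 1" using n1 by (simp add: pos_le_divide_eq mult.commute)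
    have r1: "r \<le> 1"
    proof -
      have "1 \<le> 6 * real ?n" using n1 by linarith
      then have "1 * r \<le> 6 * real ?n * r" using r by (intro mult_right_mono) auto
      then show ?thesis using nr by linarith
    qed
    \<comment> \<open>The largest grid that fits: 3 n (d + 1) r <= 1. The floor is at least 2, so
      the subtraction on naturals is exact; indices start at 0, so there are (d + 1)^n
      centres.\<close>
    define d where "d = nat \<lfloor>1 / (3 * real ?n * r)\<rfloor> - 1"
    have q2: "2 \<le> 1 / (3 * real ?n * r)" using nr n1 r by (simp add: pos_le_divide_eq)
    have d1: "real (d + 1) = of_int \<lfloor>1 / (3 * real ?n * r)\<rfloor>"
      unfolding d_def using q2 by linarith
    have dr: "3 * real ?n * real (d + 1) * r \<le> 1"
    proof -
      have "real (d + 1) \<le> 1 / (3 * real ?n * r)" unfolding d1 by simp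
      then have "real (d + 1) * (3 * real ?n * r) \<le> 1" using n1 r by (simp add: pos_le_divide_eq)
      then show ?thesis by (simp only: mult_ac)
    qed
    have dlow: "1 / (6 * real ?n * r) \<le> real (d + 1)"
    proof -
      have "1 / (3 * real ?n * r) - 1 \<le> real (d + 1)" unfolding d1 by linarith
      moreover have "1 / (3 * real ?n * r) = 2 * (1 / (6 * real ?n * r))" by simp
      ultimately show ?thesis using q2 by linarith
    qed
    \<comment> \<open>The least N with 2 K rho^N <= exp(-L).\<close>
    define N where "N = nat \<lceil>(L + ln (2 * K)) / (- ln \<rho>)\<rceil>"
    have x0: "0 < (L + ln (2 * K)) / (- ln \<rho>)" using L lnK ln\<rho> by (intro divide_pos_pos) auto
    have N: "(L + ln (2 * K)) / (- ln \<rho>) \<le> real N" "real N \<le> (L + ln (2 * K)) / (- ln \<rho>) + 1" "1 \<le> N"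
      using x0 unfolding N_def by linarith+
    have Nc: "real N \<le> c2 * L"
    proof -
      have "L + ln (2 * K) \<le> (1 + ln (2 * K)) * L" using L lnK mult_left_mono[OF L(2) lnK] by (simp add: algebra_simps)
      then have "(L + ln (2 * K)) / (- ln \<rho>) \<le> (1 + ln (2 * K)) * L / (- ln \<rho>)" using ln\<rho> by (intro divide_right_mono) auto
      then show ?thesis using N(2) L(2) unfolding c2_def by (simp add: algebra_simps)
    qed
    have \<rho>N: "2 * K * \<rho> ^ N \<le> exp (- L)"
    proof -
      have "L + ln (2 * K) \<le> real N * (- ln \<rho>)" using N(1) by (simp only: pos_divide_le_eq[OF ln\<rho>])
      then have "real N * ln \<rho> + ln (2 * K) \<le> - L" by simp
      then have "exp (real N * ln \<rho> + ln (2 * K)) \<le> exp (- L)" by simp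
      then show ?thesis using K \<rho> by (simp add: exp_add exp_of_nat_mult mult_ac)
    qed
    define c where "c = C * \<epsilon>"
    have c: "0 \<le> c" "c \<le> C * r powr l" using C \<epsilon> by (auto simp: c_def rl)
    have cA: "c * A ^ ?n \<le> 1"
    proof -
      have "\<epsilon> \<le> 1 / (C * A ^ ?n)" using \<epsilon> by (simp add: \<epsilon>0_def)
      then have "\<epsilon> * (C * A ^ ?n) \<le> 1" using C An by (simp add: pos_le_divide_eq)
      then show ?thesis by (simp add: c_def mult_ac)
    qed
    define g where "g \<sigma> = bumps \<sigma> r 1 (\<lambda>_. 0) c" for \<sigma> :: "('n \<Rightarrow> nat) set"
    let ?S = "Pow (midx d :: ('n \<Rightarrow> nat) set)"
    have fin: "finite \<sigma>" if "\<sigma> \<in> ?S" for \<sigma> using that finite_subset[OF _ finite_midx] by auto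
    have g12: "1 \<le> g \<sigma> x \<and> g \<sigma> x \<le> 2" if "\<sigma> \<in> ?S" for \<sigma> x
    proof -
      have "0 \<le> (\<Sum>j\<in>\<sigma>. psi (\<lambda>_. 0) ((1 / r) *\<^sub>R x - ctr j))" by (intro sum_nonneg psi_nonneg)
      then have "1 \<le> g \<sigma> x" using c by (simp add: g_def bumps_def)
      moreover have "\<bar>g \<sigma> x\<bar> \<le> \<bar>1\<bar> + c * A ^ ?n" unfolding g_def using A fin[OF that] c by (intro bumps_bound) auto
      ultimately show ?thesis using cA by simp
    qed
    have gcont: "continuous_on UNIV (g \<sigma>)" for \<sigma> unfolding g_def by (rule continuous_bumps)
    have gadm: "adm (g \<sigma>)" if "\<sigma> \<in> ?S" for \<sigma>
      unfolding adm_def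
    proof (intro conjI allI impI)
      show "g \<sigma> \<in> borel_measurable borel" by (rule borel_measurable_continuous_onI[OF gcont])
      show "1 < norm x \<Longrightarrow> g \<sigma> x = 1" for x unfolding g_def using that dr r by (intro bumps_far) auto
    qed (use g12[OF that] in auto)
    have ghold: "holder_norm l U (g \<sigma>) \<le> ereal \<beta>" if "\<sigma> \<in> ?S" for \<sigma> U
      unfolding g_def \<beta>_def by (rule holder_norm_bumps[OF A fin[OF that] assms(4) m_def r r1 c])
    have gspace: "g \<sigma> \<in> holder_space l" if "\<sigma> \<in> ?S" for \<sigma>
      unfolding holder_space_def using ghold[OF that, of UNIV] Ck_on_bumps[of "nat \<lfloor>l\<rfloor>" UNIV \<sigma> r 1 "\<lambda>_. 0" c]
      by (auto simp: g_def intro: le_less_trans)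
    \<comment> \<open>Balances the two errors in the stability estimate: M^(2N) delta equals
      rho^N.\<close>
    define \<delta> where "\<delta> = \<rho> ^ N / (M ^ N * M ^ N)"
    have MN: "1 \<le> M ^ N" using M by simp
    have \<delta>: "0 < \<delta>" using \<rho> M by (simp add: \<delta>_def)
    let ?I = "midx (2 * N) :: ('n \<Rightarrow> nat) set"
    let ?T = "?I \<times> (insert None (Some ` ?I))"
    \<comment> \<open>One family of numbers for the pigeonhole: \<open>None\<close> selects a moment
      and \<open>Some\<close> an entry of the solution matrix.\<close>
    define q where "q \<sigma> t = (case snd t of None \<Rightarrow> Pm (g \<sigma>) (fst t) | Some \<beta> \<Rightarrow> Qm s (g \<sigma>) (fst t) \<beta>)" for \<sigma> and t :: "('n \<Rightarrow> nat) \<times> ('n \<Rightarrow> nat) option"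
    have "\<exists>\<sigma>\<in>?S. \<exists>\<sigma>'\<in>?S. \<sigma> \<noteq> \<sigma>' \<and> (\<forall>t\<in>?T. \<bar>q \<sigma> t - q \<sigma>' t\<bar> \<le> \<delta>)"
    proof (rule pigeonhole_reals[where K=K and p="(2 ^ p) ^ N"])
      show "\<bar>q \<sigma> t\<bar> \<le> K" if "\<sigma> \<in> ?S" for \<sigma> t
        unfolding q_def using QP[OF gadm[OF that]] by (auto split: option.split)
      show "2 * K / \<delta> + 3 \<le> real ((2 ^ p) ^ N)"
      proof -
        define X where "X = M ^ N * M ^ N / \<rho> ^ N"
        have "\<rho> ^ N \<le> 1" "0 < \<rho> ^ N" using \<rho> by (auto simp: power_le_one)
        moreover have "1 \<le> M ^ N * M ^ N" using mult_mono[OF MN MN] MN by simp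
        ultimately have X1: "1 \<le> X" by (simp add: X_def)
        have "2 * K / \<delta> + 3 = 2 * K * X + 3" by (simp add: \<delta>_def X_def)
        also have "\<dots> \<le> 5 * K * X" using mult_mono[OF K X1] K by linarith
        also have "\<dots> \<le> (5 * K) ^ N * X"
          using power_increasing[OF N(3), of "5 * K"] K X1 by (intro mult_right_mono) auto
        also have "\<dots> = (5 * K * M\<^sup>2 / \<rho>) ^ N"
          by (simp add: X_def power_mult_distrib power_divide power2_eq_square)
        also have "\<dots> \<le> (2 ^ p) ^ N" using p K M \<rho> by (intro power_mono) auto
        finally show ?thesis by simp
      qed
      have cT: "card ?T = (2 * N + 1) ^ ?n * ((2 * N + 1) ^ ?n + 1)"
        by (simp add: card_cartesian_product card_image card_midx)
      have "p * N * card ?T < (d + 1) ^ ?n"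
      proof -
        define D where "D = (real (2 * N + 1)) ^ ?n"
        have D1: "1 \<le> D" unfolding D_def by (rule one_le_power) simp
        have D3: "D \<le> (3 * real N) ^ ?n" unfolding D_def using N(3) by (intro power_mono) auto
        have "real (p * N * card ?T) = real p * real N * (D * (D + 1))" unfolding cT by (simp add: D_def algebra_simps)
        also have "\<dots> \<le> real p * real N * (D * (2 * D))" using D1 by (intro mult_left_mono) auto
        also have "\<dots> = 2 * real p * (real N * (D * D))" by simp
        also have "\<dots> \<le> 2 * real p * (real N * ((3 * real N) ^ ?n * (3 * real N) ^ ?n))"
          using D1 D3 by (intro mult_left_mono mult_mono) auto
        also have "\<dots> = 2 * real p * 9 ^ ?n * real N ^ (2 * ?n + 1)"
        proof -
          have "(3 * real N) ^ ?n * (3 * real N) ^ ?n = 9 ^ ?n * (real N ^ ?n * real N ^ ?n)"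
            using power_mult_distrib[of 3 "3::real" ?n] by (simp add: power_mult_distrib mult_ac)
          moreover have "real N ^ (2 * ?n + 1) = real N * (real N ^ ?n * real N ^ ?n)"
            unfolding mult_2 power_add power_one_right by (rule mult.commute)
          ultimately show ?thesis by (simp only: mult_ac)
        qed
        also have "\<dots> \<le> 2 * real p * 9 ^ ?n * (c2 * L) ^ (2 * ?n + 1)"
          using Nc by (intro mult_left_mono power_mono) auto
        also have "\<dots> = c5 * (L ^ (2 * ?n + 1) / (6 * real ?n) ^ ?n)"
          using n1 by (simp add: c5_def power_mult_distrib)
        \<comment> \<open>The surplus of two powers of L is spent here: c5 < L <= L^2.\<close>
        also have "\<dots> < L * L * (L ^ (2 * ?n + 1) / (6 * real ?n) ^ ?n)"
        proof (rule mult_strict_right_mono)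
          have "1 * L \<le> L * L" using L by (intro mult_right_mono) auto
          then show "c5 < L * L" using L(1) by simp
          show "0 < L ^ (2 * ?n + 1) / (6 * real ?n) ^ ?n" using L n1 by (intro divide_pos_pos zero_less_power) auto
        qed
        also have "\<dots> = L ^ (2 * ?n + 3) / (6 * real ?n) ^ ?n" by (simp add: power_add power3_eq_cube)
        \<comment> \<open>By the choice of theta, L^(2n+3) = eps^(-n/l) = r^-n, which up to the
          factor (6n)^n is bounded by the number of centres.\<close>
        also have "L ^ (2 * ?n + 3) = (1 / r) ^ ?n"
        proof -
          have "L ^ (2 * ?n + 3) = L powr real (2 * ?n + 3)" using L by (subst powr_realpow) auto
          also have "\<dots> = \<epsilon> powr (- \<theta> * real (2 * ?n + 3))" by (simp add: L_def powr_powr)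
          also have "- \<theta> * real (2 * ?n + 3) = - (1 / l) * real ?n"
            using assms(4) by (simp add: \<theta>_def add_nonneg_eq_0_iff field_simps)
          also have "\<epsilon> powr (- (1 / l) * real ?n) = (\<epsilon> powr (- (1 / l))) powr real ?n" by (simp add: powr_powr)
          also have "\<epsilon> powr (- (1 / l)) = 1 / r" by (simp add: r_def powr_minus_divide)
          also have "(1 / r) powr real ?n = (1 / r) ^ ?n" using r by (simp add: powr_realpow)
          finally show ?thesis .
        qed
        also have "(1 / r) ^ ?n / (6 * real ?n) ^ ?n = (1 / (6 * real ?n * r)) ^ ?n"
          by (simp add: power_divide power_mult_distrib mult.commute)
        also have "\<dots> \<le> real (d + 1) ^ ?n" using dlow n1 r by (intro power_mono) auto
        finally have "real (p * N * card ?T) < real ((d + 1) ^ ?n)" by (simp only: of_nat_power)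
        then show ?thesis by (simp only: of_nat_less_iff)
      qed
      then have "(2::nat) ^ (p * N * card ?T) < 2 ^ ((d + 1) ^ ?n)" by simp
      then show "((2 ^ p) ^ N) ^ card ?T < card ?S"
        by (simp add: card_Pow card_midx power_mult)
    qed (use \<delta> in simp_all)
    then obtain \<sigma> \<sigma>' where \<sigma>: "\<sigma> \<in> ?S" "\<sigma>' \<in> ?S" "\<sigma> \<noteq> \<sigma>'" and qq: "\<And>t. t \<in> ?T \<Longrightarrow> \<bar>q \<sigma> t - q \<sigma>' t\<bar> \<le> \<delta>" by blast
    have "DN_diff_norm s (g \<sigma>) (g \<sigma>') \<le> ereal (K * (M ^ N * M ^ N * \<delta> + \<rho> ^ N))"
    proof (rule stab[OF gadm[OF \<sigma>(1)] gadm[OF \<sigma>(2)] less_imp_le[OF \<delta>]])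
      show "\<forall>\<alpha>\<in>?I. \<forall>\<beta>\<in>?I. \<bar>Qm s (g \<sigma>) \<alpha> \<beta> - Qm s (g \<sigma>') \<alpha> \<beta>\<bar> \<le> \<delta>"
      proof (intro ballI)
        fix \<alpha> \<beta> assume "\<alpha> \<in> ?I" "\<beta> \<in> ?I"
        then show "\<bar>Qm s (g \<sigma>) \<alpha> \<beta> - Qm s (g \<sigma>') \<alpha> \<beta>\<bar> \<le> \<delta>" using qq[of "(\<alpha>, Some \<beta>)"] by (simp add: q_def)
      qed
      show "\<forall>\<alpha>\<in>?I. \<bar>Pm (g \<sigma>) \<alpha> - Pm (g \<sigma>') \<alpha>\<bar> \<le> \<delta>"
      proof (intro ballI)
        fix \<alpha> assume "\<alpha> \<in> ?I"
        then show "\<bar>Pm (g \<sigma>) \<alpha> - Pm (g \<sigma>') \<alpha>\<bar> \<le> \<delta>" using qq[of "(\<alpha>, None)"] by (simp add: q_def)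
      qed
    qed
    also have "K * (M ^ N * M ^ N * \<delta> + \<rho> ^ N) = 2 * K * \<rho> ^ N" using M by (simp add: \<delta>_def)
    also have "ereal (2 * K * \<rho> ^ N) \<le> ereal (exp (- L))" using \<rho>N by simp
    finally have DNle: "DN_diff_norm s (g \<sigma>) (g \<sigma>') \<le> ereal (exp (- (\<epsilon> powr (- \<theta>))))" by (simp add: L_def)
    \<comment> \<open>At the centre of a bump present in only one of the two conductivities they
      differ by its full height.\<close>
    obtain j where j: "(j \<in> \<sigma>) \<noteq> (j \<in> \<sigma>')" using \<sigma>(3) by blast
    then have jd: "j \<in> midx d" using \<sigma> by blast
    have "\<bar>g \<sigma> (r *\<^sub>R ctr j) - g \<sigma>' (r *\<^sub>R ctr j)\<bar> = c * p0"
      unfolding g_def bumps_at_ctr[OF fin[OF \<sigma>(1)] r] bumps_at_ctr[OF fin[OF \<sigma>(2)] r] p0_def[symmetric]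
      using j c p0 by auto
    also have "\<dots> = 2 * \<epsilon>" using p0 by (simp add: c_def C_def)
    finally have "\<epsilon> < \<bar>g \<sigma> (r *\<^sub>R ctr j) - g \<sigma>' (r *\<^sub>R ctr j)\<bar>" using \<epsilon> by simp
    moreover have "r *\<^sub>R ctr j \<in> ball 0 1" using norm_ctr_less[OF jd r dr] by simp
    moreover have "continuous_on UNIV (\<lambda>x. \<bar>g \<sigma> x - g \<sigma>' x\<bar>)" by (intro continuous_intros gcont)
    ultimately have "ereal \<epsilon> \<le> esssup (restrict_space lborel (ball 0 1)) (\<lambda>x. ereal \<bar>g \<sigma> x - g \<sigma>' x\<bar>)"
      by (intro esssup_ge_of_continuous)
    then show ?thesis
      using gspace[OF \<sigma>(1)] gspace[OF \<sigma>(2)] DNle ghold[OF \<sigma>(1)] ghold[OF \<sigma>(2)] g12[OF \<sigma>(1)] g12[OF \<sigma>(2)] by blast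
  qed
  show ?thesis using \<beta> \<epsilon>0 main unfolding \<theta>_def by blast
qed

end
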